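(* $g_{\mathcal{DG}}(n) = 2^{\Theta(n)}$; that is, there exist constants $c_1, c_2 > 0$ and $n_0$ such that for all $n \geq n_0$, $2^{c_1 n} \leq g_{\mathcal{DG}}(n) \leq 2^{c_2 n}$.
   Context: The intersection graph of a tuple of sets $(A(v) : v \in V)$ is the graph with vertex set $V$ in which distinct $u,v$ are adjacent iff $A(u)\cap A(v) \neq \emptyset$; the tuple is then said to realize the graph. A disk graph is a graph that is (isomorphic to) the intersection graph of finitely many open disks (of positive radius) in $\mathbb{R}^2$. Let $\mathcal{DG}(n)$ be the set of disk graphs with $n$ vertices. The bit size of an integer $n$ is $\mathrm{bitsize}(n) := 1 + \lceil \log_2(|n|+1)\rceil$, and the bit size of a rational number $q = \frac{n}{m}$, with $n,m$ relatively prime integers ($m\ge 1$), is $\mathrm{bitsize}(q) := \mathrm{bitsize}(n) + \mathrm{bitsize}(m)$. For a disk graph $G$, $g_{\mathcal{DG}}(G)$ denotes the minimum, over all realizations of $G$ by open disks with centers in $\mathbb{Q}^2$ and rational radii, of the sum of the bit sizes of all the coordinates of the centers and all the radii (such realizations exist for every disk graph). Let $g_{\mathcal{DG}}(n) := \max_{G \in \mathcal{DG}(n)} g_{\mathcal{DG}}(G)$. *)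

theory Defs
  imports
    "HOL-Analysis.Analysis"
    "Graph_Theory.Pair_Digraph"
    "Graph_Theory.Digraph_Isomorphism"
begin

text \<open>
  As in the library, a finite simple graph is a symmetric loop-free digraph
  (\<^locale>\<open>pair_graph\<close>): the edge \<open>uv\<close> is the pair of arcs \<open>(u, v)\<close>, \<open>(v, u)\<close>.
\<close>

definition intersection_graph :: "'v set \<Rightarrow> ('v \<Rightarrow> 'p set) \<Rightarrow> 'v pair_pre_digraph" where
  "intersection_graph V A =
     \<lparr>pverts = V, parcs = {(u, v). u \<in> V \<and> v \<in> V \<and> u \<noteq> v \<and> A u \<inter> A v \<noteq> {}}\<rparr>"

lemma pair_graph_intersection_graph:
  assumes "finite V"
  shows "pair_graph (intersection_graph V A)"
proof -
  have "finite (parcs (intersection_graph V A))"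
    by (rule finite_subset[of _ "V \<times> V"]) (use assms in \<open>auto simp: intersection_graph_def\<close>)
  then show ?thesis
    using assms
    by unfold_locales
       (auto simp: intersection_graph_def symmetric_def arcs_ends_conv sym_def image_iff)
qed

definition realizes :: "('v \<Rightarrow> 'p set) \<Rightarrow> 'v pair_pre_digraph \<Rightarrow> bool" where
  "realizes A G \<longleftrightarrow> intersection_graph (pverts G) A = G"

definition open_disk :: "(real ^ 2) set \<Rightarrow> bool" where
  "open_disk D \<longleftrightarrow> (\<exists>c r. r > 0 \<and> D = ball c r)"

text \<open>A finite tuple may be indexed by natural numbers, since only isomorphism is required.\<close>

definition disk_graph :: "'v pair_pre_digraph \<Rightarrow> bool" where
  "disk_graph G \<longleftrightarrow>
     (\<exists>(V :: nat set) A. finite V \<and> (\<forall>v\<in>V. open_disk (A v)) \<and>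
        digraph_iso (with_proj (intersection_graph V A)) (with_proj G))"

text \<open>Every finite graph has an isomorphic copy whose vertices are natural numbers.\<close>

definition DG :: "nat \<Rightarrow> nat pair_pre_digraph set" where
  "DG n = {G. disk_graph G \<and> card (pverts G) = n}"

definition bitsize_int :: "int \<Rightarrow> nat" where
  "bitsize_int n = 1 + nat \<lceil>log 2 (real_of_int (\<bar>n\<bar> + 1))\<rceil>"

text \<open>\<^const>\<open>quotient_of\<close> yields the reduced fraction with positive denominator.\<close>

definition bitsize :: "rat \<Rightarrow> nat" where
  "bitsize q = bitsize_int (fst (quotient_of q)) + bitsize_int (snd (quotient_of q))"

definition rat_disk :: "rat \<Rightarrow> rat \<Rightarrow> rat \<Rightarrow> (real ^ 2) set" where
  "rat_disk x y r = ball (vector [of_rat x, of_rat y]) (of_rat r)"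

definition rat_realization ::
  "'v pair_pre_digraph \<Rightarrow> ('v \<Rightarrow> rat) \<Rightarrow> ('v \<Rightarrow> rat) \<Rightarrow> ('v \<Rightarrow> rat) \<Rightarrow> bool" where
  "rat_realization G x y r \<longleftrightarrow>
     (\<forall>v\<in>pverts G. r v > 0) \<and> realizes (\<lambda>v. rat_disk (x v) (y v) (r v)) G"

text \<open>
  The minimum is over an infinite set of natural numbers, hence \<open>LEAST\<close> and not \<^const>\<open>Min\<close>;
  it is meaningful because every disk graph has a rational realization.
\<close>

definition g_DG_graph :: "'v pair_pre_digraph \<Rightarrow> nat" where
  "g_DG_graph G =
     (LEAST k. \<exists>x y r. rat_realization G x y r \<and>
        k = (\<Sum>v\<in>pverts G. bitsize (x v) + bitsize (y v) + bitsize (r v)))"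

text \<open>
  Although \<^term>\<open>DG n\<close> is infinite for positive \<open>n\<close>, it has finitely many isomorphism classes and
  \<^const>\<open>g_DG_graph\<close> is invariant under isomorphism, so \<^const>\<open>Max\<close> is taken of a finite set.
\<close>

definition g_DG :: "nat \<Rightarrow> nat" where
  "g_DG n = Max (g_DG_graph ` DG n)"

end

theory Submission
  imports Defs "HOL-Real_Asymp.Real_Asymp"
begin

text \<open>
  Upper bound. After scaling, the realizations by disks form a set \<open>g \<ge> 0\<close> for finitely many quadratic
  polynomials with small integer coefficients. Take a maximal set of these polynomials with a common
  zero in it, let \<open>Q\<close> be the sum of their squares, and minimise \<open>Q + \<epsilon> (\<Sum> x\<^sub>i ^ 6)\<close>. For \<open>\<epsilon>\<close> tending to 0
  the minimisers subconverge to a feasible point, and by maximality the other constraints are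
  eventually inactive, so that the minimisers solve \<open>x\<^sub>i ^ 5 = t * q\<^sub>i\<close> with \<open>t = -1 / (6 \<epsilon>)\<close> and \<open>q\<^sub>i\<close> the
  \<open>i\<close>-th partial derivative of \<open>Q\<close>. These equations rewrite every monomial into exponents below 5, and
  by pigeonhole every coordinate satisfies a nontrivial relation with small integer coefficients in
  \<open>t\<close> and \<open>x\<^sub>i\<close>. Letting \<open>t\<close> tend to infinity, each coordinate of the limit is a root of a polynomial
  with small integer coefficients, hence small, and can be rounded.

  Lower bound. Fix a disk \<open>L\<close>, normalised to the unit disk. On the disks disjoint from \<open>L\<close> there is a function
  \<open>gap\<close> that satisfies the Ptolemy inequality, is at least 1 on disjoint disks and less than 2 on
  intersecting ones. Dividing by the gaps to a further disk \<open>E\<close> turns it into a metric, so that a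
  suitable pattern of intersections, repeated \<open>m\<close> times, forces a chain of distances that are squared in
  every round. The start of the induction needs disks that are nearly tangent to \<open>E\<close>; this is forced by
  many disjoint disks each of which meets \<open>L\<close>, \<open>E\<close> and the given disk. A gap of size \<open>2 ^ 2 ^ m\<close> costs
  about \<open>2 ^ m\<close> bits.
\<close>

section \<open>Integer polynomials of bounded size\<close>

text \<open>The sixth powers exceed the degree 4 of \<open>Q\<close>, so that in every equation the
  pure power \<open>x\<^sub>i ^ 5\<close> dominates \<open>q\<^sub>i\<close>, of degree 3, and only
  \<open>5 ^ (3 * n)\<close> normal monomials remain. This yields coordinates below 2 to a power
  \<open>2 ^ O(n)\<close>. Minimising with a penalty avoids Lagrange multipliers, which may fail to
  exist at a degenerate feasible point.

  A graph records which disks meet, never which ones touch. The model of the lower bound is the case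
  of disks resting on a line \<open>L\<close>, with \<open>E\<close> the half-plane above the
  parallel line at height 1. There two disks of radii \<open>r\<close>, \<open>r'\<close> with
  contact points at distance \<open>d\<close> have gap \<open>d / (2 * sqrt (r * r'))\<close>, the
  gap of a disk of radius \<open>r\<close> to \<open>E\<close> is \<open>1 / sqrt (2 * r)\<close>,
  and dividing by the gaps to \<open>E\<close> leaves \<open>d\<close> itself. An arbitrary
  realization has no tangencies, but the thresholds 1 and 2 hold for all disks off \<open>L\<close>,
  so every round loses only a constant factor, which a large starting weight absorbs.\<close>

definition mon :: "nat multiset \<Rightarrow> (nat \<Rightarrow> real) \<Rightarrow> real" where
  "mon M x = (\<Prod>i\<in>#M. x i)"

lemma mon_simps [simp]: "mon {#} x = 1" "mon (add_mset i M) x = x i * mon M x"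
  "mon (M + N) x = mon M x * mon N x"
  by (auto simp: mon_def)

text \<open>The list of terms may repeat a monomial, so that sums are concatenations.
  \<open>L\<close> bounds the sum of the absolute coefficients, which is subadditive under sums and
  submultiplicative under products.\<close>

definition int_poly :: "nat set \<Rightarrow> nat \<Rightarrow> nat \<Rightarrow> ((nat \<Rightarrow> real) \<Rightarrow> real) \<Rightarrow> bool" where
  "int_poly I d L f \<longleftrightarrow> (\<exists>ps :: (int \<times> nat multiset) list.
     (\<forall>p\<in>set ps. size (snd p) \<le> d \<and> set_mset (snd p) \<subseteq> I) \<and>
     (\<Sum>p\<leftarrow>ps. nat \<bar>fst p\<bar>) \<le> L \<and> f = (\<lambda>x. \<Sum>p\<leftarrow>ps. of_int (fst p) * mon (snd p) x))"

lemma int_poly_mono: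
  "int_poly I d L f \<Longrightarrow> d \<le> d' \<Longrightarrow> L \<le> L' \<Longrightarrow> int_poly I d' L' f"
  unfolding int_poly_def by (elim exE, rule exI) (auto intro: order_trans)

lemma int_poly_const: "nat \<bar>c\<bar> \<le> L \<Longrightarrow> int_poly I d L (\<lambda>x. of_int c)"
  unfolding int_poly_def by (rule exI[of _ "[(c, {#})]"]) auto

lemma int_poly_var: "i \<in> I \<Longrightarrow> int_poly I 1 1 (\<lambda>x. x i)"
  unfolding int_poly_def by (rule exI[of _ "[(1, {#i#})]"]) auto

lemma int_poly_add:
  assumes "int_poly I d L f" "int_poly I d L' g"
  shows "int_poly I d (L + L') (\<lambda>x. f x + g x)"
proof -
  obtain ps qs where "\<forall>p\<in>set ps. size (snd p) \<le> d \<and> set_mset (snd p) \<subseteq> I"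
    "(\<Sum>p\<leftarrow>ps. nat \<bar>fst p\<bar>) \<le> L" "f = (\<lambda>x. \<Sum>p\<leftarrow>ps. of_int (fst p) * mon (snd p) x)"
    "\<forall>p\<in>set qs. size (snd p) \<le> d \<and> set_mset (snd p) \<subseteq> I"
    "(\<Sum>p\<leftarrow>qs. nat \<bar>fst p\<bar>) \<le> L'" "g = (\<lambda>x. \<Sum>p\<leftarrow>qs. of_int (fst p) * mon (snd p) x)"
    using assms unfolding int_poly_def by auto
  then show ?thesis
    unfolding int_poly_def by (intro exI[of _ "ps @ qs"]) auto
qed

lemma int_poly_mult_monom:
  assumes "int_poly I d L f" "size M \<le> d'" "set_mset M \<subseteq> I"
  shows "int_poly I (d' + d) (nat \<bar>c\<bar> * L) (\<lambda>x. of_int c * mon M x * f x)"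
proof -
  obtain ps where ps: "\<forall>p\<in>set ps. size (snd p) \<le> d \<and> set_mset (snd p) \<subseteq> I"
    "(\<Sum>p\<leftarrow>ps. nat \<bar>fst p\<bar>) \<le> L" "f = (\<lambda>x. \<Sum>p\<leftarrow>ps. of_int (fst p) * mon (snd p) x)"
    using assms unfolding int_poly_def by auto
  let ?qs = "map (\<lambda>p. (c * fst p, M + snd p)) ps"
  have "(\<Sum>p\<leftarrow>?qs. nat \<bar>fst p\<bar>) = nat \<bar>c\<bar> * (\<Sum>p\<leftarrow>ps. nat \<bar>fst p\<bar>)"
    by (induction ps) (auto simp: abs_mult nat_mult_distrib algebra_simps)
  moreover have "(\<Sum>p\<leftarrow>?qs. of_int (fst p) * mon (snd p) x) = of_int c * mon M x * f x" for x
    unfolding ps(3) by (induction ps) (auto simp: algebra_simps)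
  ultimately show ?thesis
    unfolding int_poly_def using ps(1,2) assms(2,3)
    by (intro exI[of _ ?qs]) (auto intro: add_mono)
qed

lemma int_poly_mult:
  assumes "int_poly I d L f" "int_poly I d' L' g"
  shows "int_poly I (d + d') (L * L') (\<lambda>x. f x * g x)"
proof -
  obtain ps where ps: "\<forall>p\<in>set ps. size (snd p) \<le> d \<and> set_mset (snd p) \<subseteq> I"
    "(\<Sum>p\<leftarrow>ps. nat \<bar>fst p\<bar>) \<le> L" "f = (\<lambda>x. \<Sum>p\<leftarrow>ps. of_int (fst p) * mon (snd p) x)"
    using assms unfolding int_poly_def by auto
  have "int_poly I (d + d') ((\<Sum>p\<leftarrow>ps. nat \<bar>fst p\<bar>) * L')
     (\<lambda>x. (\<Sum>p\<leftarrow>ps. of_int (fst p) * mon (snd p) x) * g x)"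
    using ps(1)
  proof (induction ps)
    case Nil
    then show ?case using int_poly_const[of 0 0] by simp
  next
    case (Cons p ps)
    then have "int_poly I (d + d') (nat \<bar>fst p\<bar> * L') (\<lambda>x. of_int (fst p) * mon (snd p) x * g x)"
      by (intro int_poly_mult_monom[OF assms(2)]) auto
    from int_poly_add[OF this Cons.IH] Cons.prems show ?case
      by (simp add: algebra_simps)
  qed
  then show ?thesis
    unfolding ps(3) by (rule int_poly_mono) (use ps(2) in auto)
qed

lemma int_poly_diff:
  assumes "int_poly I d L f" "int_poly I d L' g"
  shows "int_poly I d (L + L') (\<lambda>x. f x - g x)"
proof -
  have "int_poly I d L' (\<lambda>x. - g x)"
    using int_poly_mult_monom[OF assms(2), of "{#}" 0 "-1"] by simp
  from int_poly_add[OF assms(1) this] show ?thesis by simp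
qed

lemma int_poly_sum:
  assumes "finite A" "\<And>a. a \<in> A \<Longrightarrow> int_poly I d L (f a)"
  shows "int_poly I d (card A * L) (\<lambda>x. \<Sum>a\<in>A. f a x)"
  using assms
proof (induction rule: finite_induct)
  case empty
  then show ?case using int_poly_const[of 0 0] by simp
next
  case (insert a A)
  then have "int_poly I d (L + card A * L) (\<lambda>x. f a x + (\<Sum>a\<in>A. f a x))"
    by (intro int_poly_add) auto
  with insert show ?case by simp
qed

lemma mon_deriv:
  assumes "set_mset M \<subseteq> I" "size M \<le> Suc d"
  shows "\<exists>f'. int_poly I d (Suc d) f' \<and>
    (\<forall>x. ((\<lambda>s. mon M (x(i := s))) has_real_derivative f' x) (at (x i)))"
  using assms
proof (induction d arbitrary: M)
  case 0
  then have "M = {#} \<or> (\<exists>j. M = {#j#})"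
    by (metis One_nat_def le_Suc_eq le_zero_eq size_1_singleton_mset size_eq_0_iff_empty)
  then show ?case
  proof (elim disjE exE)
    assume "M = {#}"
    then show ?thesis using int_poly_const[of 0] by (intro exI[of _ "\<lambda>x. 0"]) auto
  next
    fix j assume M: "M = {#j#}"
    show ?thesis
    proof (cases "j = i")
      case True
      then show ?thesis using M int_poly_const[of 1 1]
        by (intro exI[of _ "\<lambda>x. 1"]) auto
    next
      case False
      then show ?thesis using M int_poly_const[of 0]
        by (intro exI[of _ "\<lambda>x. 0"]) auto
    qed
  qed
next
  case (Suc d)
  show ?case
  proof (cases "M = {#}")
    case True
    then show ?thesis using int_poly_const[of 0] by (intro exI[of _ "\<lambda>x. 0"]) auto
  next
    case False
    then obtain j N where M: "M = add_mset j N" by (meson multiset_cases)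
    then obtain f' where f': "int_poly I d (Suc d) f'"
      "\<And>x. ((\<lambda>s. mon N (x(i := s))) has_real_derivative f' x) (at (x i))"
    proof -
      have "set_mset N \<subseteq> I" "size N \<le> Suc d" using Suc.prems M by auto
      from Suc.IH[OF this] show thesis using that by blast
    qed
    have N: "int_poly I (Suc d) 1 (mon N)"
      unfolding int_poly_def using Suc.prems M by (intro exI[of _ "[(1, N)]"]) auto
    have j: "int_poly I 1 1 (\<lambda>x. x j)" using Suc.prems M by (intro int_poly_var) auto
    have 1: "int_poly I (Suc d) (Suc d) (\<lambda>x. x j * f' x)"
      using int_poly_mult[OF j f'(1)] by simp
    show ?thesis
    proof (cases "j = i")
      case True
      have "((\<lambda>s. mon M (x(i := s))) has_real_derivative x j * f' x + mon N x) (at (x i))" for x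
        using DERIV_mult[OF DERIV_ident f'(2)[of x]] M True by (simp add: algebra_simps)
      moreover have "int_poly I (Suc d) (Suc (Suc d)) (\<lambda>x. x j * f' x + mon N x)"
        using int_poly_add[OF 1 N] by simp
      ultimately show ?thesis by blast
    next
      case False
      have "((\<lambda>s. mon M (x(i := s))) has_real_derivative x j * f' x) (at (x i))" for x
        using DERIV_cmult[OF f'(2)[of x], of "x j"] M False by (simp add: algebra_simps)
      moreover have "int_poly I (Suc d) (Suc (Suc d)) (\<lambda>x. x j * f' x)"
        using 1 by (rule int_poly_mono) auto
      ultimately show ?thesis by blast
    qed
  qed
qed

lemma int_poly_deriv:
  assumes "int_poly I (Suc d) L f"
  shows "\<exists>f'. int_poly I d (Suc d * L) f' \<and>
    (\<forall>x. ((\<lambda>s. f (x(i := s))) has_real_derivative f' x) (at (x i)))"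
proof -
  obtain ps where ps: "\<forall>p\<in>set ps. size (snd p) \<le> Suc d \<and> set_mset (snd p) \<subseteq> I"
    "(\<Sum>p\<leftarrow>ps. nat \<bar>fst p\<bar>) \<le> L" "f = (\<lambda>x. \<Sum>p\<leftarrow>ps. of_int (fst p) * mon (snd p) x)"
    using assms unfolding int_poly_def by auto
  have "\<exists>f'. int_poly I d (Suc d * (\<Sum>p\<leftarrow>ps. nat \<bar>fst p\<bar>)) f' \<and>
    (\<forall>x. ((\<lambda>s. \<Sum>p\<leftarrow>ps. of_int (fst p) * mon (snd p) (x(i := s))) has_real_derivative f' x) (at (x i)))"
    using ps(1)
  proof (induction ps)
    case Nil
    then show ?case using int_poly_const[of 0] by (intro exI[of _ "\<lambda>x. 0"]) auto
  next
    case (Cons p ps)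
    then obtain f' where f': "int_poly I d (Suc d * (\<Sum>p\<leftarrow>ps. nat \<bar>fst p\<bar>)) f'"
      "\<And>x. ((\<lambda>s. \<Sum>p\<leftarrow>ps. of_int (fst p) * mon (snd p) (x(i := s))) has_real_derivative f' x) (at (x i))"
    proof -
      have "\<forall>p\<in>set ps. size (snd p) \<le> Suc d \<and> set_mset (snd p) \<subseteq> I" using Cons.prems by auto
      from Cons.IH[OF this] show thesis using that by blast
    qed
    obtain g' where g': "int_poly I d (Suc d) g'"
      "\<And>x. ((\<lambda>s. mon (snd p) (x(i := s))) has_real_derivative g' x) (at (x i))"
    proof -
      have "set_mset (snd p) \<subseteq> I" "size (snd p) \<le> Suc d" using Cons.prems by auto
      from mon_deriv[OF this] show thesis using that by blast
    qed
    have 1: "int_poly I d (nat \<bar>fst p\<bar> * Suc d) (\<lambda>x. of_int (fst p) * g' x)"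
      using int_poly_mult_monom[OF g'(1), of "{#}" 0 "fst p"] by simp
    have 2: "((\<lambda>s. \<Sum>p\<leftarrow>p # ps. of_int (fst p) * mon (snd p) (x(i := s))) has_real_derivative
        of_int (fst p) * g' x + f' x) (at (x i))" for x
      using DERIV_add[OF DERIV_cmult[OF g'(2)[of x]] f'(2)[of x]] by simp
    have 3: "int_poly I d (Suc d * (\<Sum>p\<leftarrow>p # ps. nat \<bar>fst p\<bar>)) (\<lambda>x. of_int (fst p) * g' x + f' x)"
      using int_poly_add[OF 1 f'(1)] by (simp add: algebra_simps)
    show ?case using 2 3 by blast
  qed
  then show ?thesis
    unfolding ps(3) using ps(2) by (meson int_poly_mono mult_le_mono2 order_refl)
qed

lemma int_poly_continuous: "int_poly I d L f \<Longrightarrow> continuous_on UNIV f"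
proof -
  have mon: "continuous_on UNIV (mon M)" for M
    by (induction M) (auto intro!: continuous_intros continuous_on_product_coordinates)
  assume "int_poly I d L f"
  then obtain ps :: "(int \<times> nat multiset) list"
    where f: "f = (\<lambda>x. \<Sum>p\<leftarrow>ps. of_int (fst p) * mon (snd p) x)"
    unfolding int_poly_def by auto
  show ?thesis unfolding f
    by (induction ps) (auto intro!: continuous_intros mon)
qed

section \<open>Elimination by a pigeonhole argument\<close>

text \<open>The pigeonhole form of Siegel's lemma: the vectors with entries in \<open>{0..H}\<close>
  outnumber the possible images, which lie in a box of radius \<open>H * W\<close>. The difference
  of two vectors with the same image solves the system.\<close>

lemma siegel:
  fixes a :: "'y \<Rightarrow> 'x \<Rightarrow> int"
  assumes fin: "finite X" "finite Y"
    and W: "\<And>y. y \<in> Y \<Longrightarrow> (\<Sum>x\<in>X. \<bar>a y x\<bar>) \<le> int W"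
    and card: "(2 * H * W + 1) ^ card Y < (H + 1) ^ card X"
  shows "\<exists>c :: 'x \<Rightarrow> int. (\<exists>x\<in>X. c x \<noteq> 0) \<and> (\<forall>x\<in>X. \<bar>c x\<bar> \<le> int H) \<and>
    (\<forall>y\<in>Y. (\<Sum>x\<in>X. a y x * c x) = 0)"
proof -
  let ?A = "PiE X (\<lambda>_. {0..int H})"
  let ?B = "PiE Y (\<lambda>_. {- int (H * W)..int (H * W)})"
  define f where "f c = (\<lambda>y\<in>Y. \<Sum>x\<in>X. a y x * c x)" for c
  have "f ` ?A \<subseteq> ?B"
  proof (rule image_subsetI, rule PiE_I)
    fix c y assume c: "c \<in> ?A" and y: "y \<in> Y"
    have "\<bar>\<Sum>x\<in>X. a y x * c x\<bar> \<le> (\<Sum>x\<in>X. \<bar>a y x\<bar> * int H)"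
      using c by (intro order_trans[OF sum_abs] sum_mono) (auto simp: abs_mult PiE_iff intro!: mult_left_mono)
    also have "\<dots> \<le> int W * int H"
      unfolding sum_distrib_right[symmetric] using W[OF y] by (intro mult_right_mono) auto
    finally show "f c y \<in> {- int (H * W)..int (H * W)}"
      using y by (auto simp: f_def mult.commute)
  qed (auto simp: f_def)
  moreover have "finite ?B" using fin by (intro finite_PiE) auto
  moreover have "card ?B < card ?A"
  proof -
    have "card ?A = (H + 1) ^ card X" using fin by (simp add: card_PiE nat_add_distrib)
    moreover have "card {- int (H * W)..int (H * W)} = 2 * H * W + 1"
      unfolding card_atLeastAtMost_int nat_eq_iff by simp
    then have "card ?B = (2 * H * W + 1) ^ card Y"
      using fin by (simp only: card_PiE prod_constant)
    ultimately show ?thesis using card by simp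
  qed
  ultimately have "\<not> inj_on f ?A"
    using card_inj_on_le[of f ?A ?B] by auto
  then obtain c c' where c: "c \<in> ?A" "c' \<in> ?A" "f c = f c'" "c \<noteq> c'"
    by (auto simp: inj_on_def)
  have "\<exists>x\<in>X. c x \<noteq> c' x" using c by (metis PiE_ext)
  moreover have "\<bar>c x - c' x\<bar> \<le> int H" if "x \<in> X" for x
    using c(1,2) that by (fastforce simp: PiE_iff)
  moreover have "(\<Sum>x\<in>X. a y x * (c x - c' x)) = 0" if "y \<in> Y" for y
    using fun_cong[OF c(3), of y] that by (simp add: f_def algebra_simps sum_subtractf)
  ultimately show ?thesis by (intro exI[of _ "\<lambda>x. c x - c' x"]) auto
qed

section \<open>Normal forms modulo the equations of the minimisers\<close>

text \<open>With \<open>t\<close> treated as a coefficient, the equations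
  \<open>x i ^ 5 = t * q i x\<close> have pure powers of distinct variables as leading terms, like a
  Groebner basis. The bound 3 on the degree of \<open>q i\<close> makes rewriting terminate.\<close>

locale special_system =
  fixes I :: "nat set" and L :: nat and q :: "nat \<Rightarrow> (nat \<Rightarrow> real) \<Rightarrow> real"
  assumes fin: "finite I" and L: "L \<ge> 1" and q: "\<And>i. i \<in> I \<Longrightarrow> int_poly I 3 L (q i)"
begin

definition sol :: "real \<Rightarrow> (nat \<Rightarrow> real) \<Rightarrow> bool" where
  "sol t x \<longleftrightarrow> (\<forall>i\<in>I. x i ^ 5 = t * q i x)"

definition basis :: "(nat \<Rightarrow> nat) set" where
  "basis = PiE I (\<lambda>_. {..<5})"

lemma finite_basis: "finite basis"
  unfolding basis_def using fin by (intro finite_PiE) auto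

lemma card_basis: "card basis = 5 ^ card I"
  unfolding basis_def using fin by (simp add: card_PiE)

definition bmon :: "(nat \<Rightarrow> nat) \<Rightarrow> (nat \<Rightarrow> real) \<Rightarrow> real" where
  "bmon \<alpha> x = (\<Prod>i\<in>I. x i ^ \<alpha> i)"

text \<open>The coefficients \<open>e\<close> are chosen before \<open>t\<close> and
  \<open>x\<close>, so a linear relation among them is valid at all solutions and all parameters at
  once. \<open>s\<close> bounds the power of \<open>t\<close>, \<open>C\<close> the sum of the
  absolute coefficients.\<close>

definition reduces :: "nat \<Rightarrow> nat \<Rightarrow> (real \<Rightarrow> (nat \<Rightarrow> real) \<Rightarrow> real) \<Rightarrow> bool" where
  "reduces s C F \<longleftrightarrow> (\<exists>e :: nat \<Rightarrow> (nat \<Rightarrow> nat) \<Rightarrow> int.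
     (\<Sum>k\<le>s. \<Sum>\<alpha>\<in>basis. \<bar>e k \<alpha>\<bar>) \<le> int C \<and>
     (\<forall>t x. sol t x \<longrightarrow> F t x = (\<Sum>k\<le>s. \<Sum>\<alpha>\<in>basis. of_int (e k \<alpha>) * (t ^ k * bmon \<alpha> x))))"

lemma reduces_mono:
  assumes "reduces s C F" "s \<le> s'" "C \<le> C'"
  shows "reduces s' C' F"
proof -
  obtain e :: "nat \<Rightarrow> (nat \<Rightarrow> nat) \<Rightarrow> int" where e: "(\<Sum>k\<le>s. \<Sum>\<alpha>\<in>basis. \<bar>e k \<alpha>\<bar>) \<le> int C"
    "\<And>t x. sol t x \<Longrightarrow> F t x = (\<Sum>k\<le>s. \<Sum>\<alpha>\<in>basis. of_int (e k \<alpha>) * (t ^ k * bmon \<alpha> x))"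
    using assms(1) unfolding reduces_def by auto
  let ?e = "\<lambda>k \<alpha>. if k \<le> s then e k \<alpha> else 0"
  have *: "(\<Sum>k\<le>s'. G k) = (\<Sum>k\<le>s. G k)" if "\<And>k. k > s \<Longrightarrow> G k = 0" for G :: "nat \<Rightarrow> 'z::comm_monoid_add"
    using that assms(2) by (intro sum.mono_neutral_right) auto
  have "(\<Sum>k\<le>s'. \<Sum>\<alpha>\<in>basis. \<bar>?e k \<alpha>\<bar>) \<le> int C'"
    using e(1) assms(3) by (subst *) auto
  moreover have "F t x = (\<Sum>k\<le>s'. \<Sum>\<alpha>\<in>basis. of_int (?e k \<alpha>) * (t ^ k * bmon \<alpha> x))" if "sol t x" for t x
    using e(2)[OF that] by (subst *) auto
  ultimately show ?thesis unfolding reduces_def by (intro exI[of _ ?e]) auto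
qed

lemma reduces_cong:
  assumes "reduces s C F" "\<And>t x. sol t x \<Longrightarrow> F t x = G t x"
  shows "reduces s C G"
  using assms unfolding reduces_def by (elim exE, intro exI) auto

lemma reduces_zero: "reduces s C (\<lambda>t x. 0)"
  unfolding reduces_def by (intro exI[of _ "\<lambda>_ _. 0"]) auto

lemma reduces_add:
  assumes "reduces s C F" "reduces s C' G"
  shows "reduces s (C + C') (\<lambda>t x. F t x + G t x)"
proof -
  obtain e :: "nat \<Rightarrow> (nat \<Rightarrow> nat) \<Rightarrow> int" where e: "(\<Sum>k\<le>s. \<Sum>\<alpha>\<in>basis. \<bar>e k \<alpha>\<bar>) \<le> int C"
    "\<And>t x. sol t x \<Longrightarrow> F t x = (\<Sum>k\<le>s. \<Sum>\<alpha>\<in>basis. of_int (e k \<alpha>) * (t ^ k * bmon \<alpha> x))"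
    using assms(1) unfolding reduces_def by auto
  obtain e' :: "nat \<Rightarrow> (nat \<Rightarrow> nat) \<Rightarrow> int" where e': "(\<Sum>k\<le>s. \<Sum>\<alpha>\<in>basis. \<bar>e' k \<alpha>\<bar>) \<le> int C'"
    "\<And>t x. sol t x \<Longrightarrow> G t x = (\<Sum>k\<le>s. \<Sum>\<alpha>\<in>basis. of_int (e' k \<alpha>) * (t ^ k * bmon \<alpha> x))"
    using assms(2) unfolding reduces_def by auto
  have "(\<Sum>k\<le>s. \<Sum>\<alpha>\<in>basis. \<bar>e k \<alpha> + e' k \<alpha>\<bar>) \<le> (\<Sum>k\<le>s. \<Sum>\<alpha>\<in>basis. \<bar>e k \<alpha>\<bar> + \<bar>e' k \<alpha>\<bar>)"
    by (intro sum_mono) auto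
  also have "\<dots> \<le> int (C + C')" using e(1) e'(1) by (simp add: sum.distrib)
  finally show ?thesis
    unfolding reduces_def using e(2) e'(2)
    by (intro exI[of _ "\<lambda>k \<alpha>. e k \<alpha> + e' k \<alpha>"]) (auto simp: sum.distrib algebra_simps)
qed

lemma reduces_scale:
  assumes "reduces s C F"
  shows "reduces s (nat \<bar>c\<bar> * C) (\<lambda>t x. of_int c * F t x)"
proof -
  obtain e :: "nat \<Rightarrow> (nat \<Rightarrow> nat) \<Rightarrow> int" where e: "(\<Sum>k\<le>s. \<Sum>\<alpha>\<in>basis. \<bar>e k \<alpha>\<bar>) \<le> int C"
    "\<And>t x. sol t x \<Longrightarrow> F t x = (\<Sum>k\<le>s. \<Sum>\<alpha>\<in>basis. of_int (e k \<alpha>) * (t ^ k * bmon \<alpha> x))"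
    using assms(1) unfolding reduces_def by auto
  have "(\<Sum>k\<le>s. \<Sum>\<alpha>\<in>basis. \<bar>c * e k \<alpha>\<bar>) = \<bar>c\<bar> * (\<Sum>k\<le>s. \<Sum>\<alpha>\<in>basis. \<bar>e k \<alpha>\<bar>)"
    by (simp add: abs_mult sum_distrib_left)
  also have "\<dots> \<le> int (nat \<bar>c\<bar> * C)" using e(1) by (auto intro!: mult_left_mono)
  finally show ?thesis
    unfolding reduces_def using e(2)
    by (intro exI[of _ "\<lambda>k \<alpha>. c * e k \<alpha>"]) (auto simp: sum_distrib_left algebra_simps)
qed

lemma reduces_shift:
  assumes "reduces s C F"
  shows "reduces (Suc s) C (\<lambda>t x. t * F t x)"
proof -
  obtain e :: "nat \<Rightarrow> (nat \<Rightarrow> nat) \<Rightarrow> int" where e: "(\<Sum>k\<le>s. \<Sum>\<alpha>\<in>basis. \<bar>e k \<alpha>\<bar>) \<le> int C"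
    "\<And>t x. sol t x \<Longrightarrow> F t x = (\<Sum>k\<le>s. \<Sum>\<alpha>\<in>basis. of_int (e k \<alpha>) * (t ^ k * bmon \<alpha> x))"
    using assms(1) unfolding reduces_def by auto
  show ?thesis
    unfolding reduces_def using e
    by (intro exI[of _ "\<lambda>k \<alpha>. case k of 0 \<Rightarrow> 0 | Suc k \<Rightarrow> e k \<alpha>"])
      (auto simp: sum.atMost_Suc_shift sum_distrib_left algebra_simps simp del: sum.atMost_Suc)
qed

text \<open>Rewriting \<open>x i ^ 5\<close> as \<open>t * q i x\<close> replaces five factors by at
  most three and costs one power of \<open>t\<close> and one factor \<open>L\<close>. The degree
  drops at every rewriting, so it bounds both costs.\<close>

lemma reduces_mon: "set_mset M \<subseteq> I \<Longrightarrow> reduces (size M) (L ^ size M) (\<lambda>t x. mon M x)"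
proof (induction "size M" arbitrary: M rule: less_induct)
  case less
  show ?case
  proof (cases "\<exists>i\<in>#M. count M i \<ge> 5")
    case False
    define \<alpha> where "\<alpha> = restrict (count M) I"
    have \<alpha>: "\<alpha> \<in> basis"
      using False unfolding basis_def \<alpha>_def by (auto simp: PiE_iff) (metis count_eq_zero_iff not_less zero_less_numeral)
    have "mon M x = bmon \<alpha> x" for x
    proof -
      have "mon M x = (\<Prod>i\<in>set_mset M. x i ^ count M i)"
        unfolding mon_def by (simp add: image_prod_mset_multiplicity)
      also have "\<dots> = (\<Prod>i\<in>I. x i ^ count M i)"
        using less.prems fin by (intro prod.mono_neutral_left) (auto simp: not_in_iff)
      finally show ?thesis unfolding bmon_def \<alpha>_def by simp
    qed
    moreover have "(\<Sum>k\<le>(0::nat). \<Sum>\<beta>\<in>basis. \<bar>if \<beta> = \<alpha> then 1 else 0\<bar>) \<le> int 1"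
      using \<alpha> finite_basis by (simp add: if_distrib cong: if_cong)
    ultimately have "reduces 0 1 (\<lambda>t x. mon M x)"
      unfolding reduces_def using \<alpha> finite_basis
      by (intro exI[of _ "\<lambda>k \<beta>. if \<beta> = \<alpha> then 1 else 0"]) (auto simp: if_distrib if_distribR cong: if_cong)
    then show ?thesis by (rule reduces_mono) (use L in auto)
  next
    case True
    then obtain i where i: "i \<in># M" "count M i \<ge> 5" by auto
    then obtain M' where M': "M = replicate_mset 5 i + M'"
      by (metis count_le_replicate_mset_subset_eq subset_mset.le_iff_add)
    have iI: "i \<in> I" using i less.prems by auto
    obtain ps where ps: "\<forall>p\<in>set ps. size (snd p) \<le> 3 \<and> set_mset (snd p) \<subseteq> I"
      "(\<Sum>p\<leftarrow>ps. nat \<bar>fst p\<bar>) \<le> L" "q i = (\<lambda>x. \<Sum>p\<leftarrow>ps. of_int (fst p) * mon (snd p) x)"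
      using q[OF iI] unfolding int_poly_def by auto
    define m where "m = size M - 2"
    have m: "size M = Suc (Suc m)" using M' by (auto simp: m_def)
    have "reduces m ((\<Sum>p\<leftarrow>ps. nat \<bar>fst p\<bar>) * L ^ m)
        (\<lambda>t x. (\<Sum>p\<leftarrow>ps. of_int (fst p) * mon (snd p) x) * mon M' x)"
      using ps(1)
    proof (induction ps)
      case Nil
      then show ?case using reduces_zero by simp
    next
      case (Cons p ps)
      have sz: "size (snd p + M') \<le> m" and sub: "set_mset (snd p + M') \<subseteq> I"
        using Cons.prems M' less.prems by (auto simp: m_def)
      have "reduces (size (snd p + M')) (L ^ size (snd p + M')) (\<lambda>t x. mon (snd p + M') x)"
        by (rule less.hyps) (use sz sub m in auto)
      then have "reduces m (L ^ m) (\<lambda>t x. mon (snd p + M') x)"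
        by (rule reduces_mono) (use sz L in \<open>auto intro: power_increasing\<close>)
      from reduces_add[OF reduces_scale[OF this, of "fst p"] Cons.IH] Cons.prems
      show ?case by (simp add: algebra_simps)
    qed
    then have "reduces m (L ^ Suc m) (\<lambda>t x. q i x * mon M' x)"
      unfolding ps(3) by (rule reduces_mono) (use ps(2) in \<open>auto intro: mult_right_mono\<close>)
    then have "reduces (Suc m) (L ^ Suc m) (\<lambda>t x. t * (q i x * mon M' x))"
      by (rule reduces_shift)
    then have "reduces (Suc m) (L ^ Suc m) (\<lambda>t x. mon M x)"
      by (rule reduces_cong) (use iI in \<open>auto simp: sol_def M' mon_def\<close>)
    then show ?thesis
      by (rule reduces_mono) (use m L in \<open>auto intro: power_increasing\<close>)
  qed
qed

end

lemma sum_shift_conv: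
  fixes g :: "nat \<Rightarrow> 'a::comm_monoid_add"
  assumes "a \<le> n"
  shows "(\<Sum>k\<le>m. g (a + k)) = (\<Sum>k\<le>n + m. if a \<le> k \<and> k - a \<le> m then g k else 0)"
proof -
  have "(\<Sum>k\<le>n + m. if a \<le> k \<and> k - a \<le> m then g k else 0) = sum g {k \<in> {..n + m}. a \<le> k \<and> k - a \<le> m}"
    by (intro sum.inter_filter[symmetric]) auto
  also have "\<dots> = (\<Sum>k\<le>m. g (a + k))"
    using assms by (intro sum.reindex_bij_witness[of _ "\<lambda>k. a + k" "\<lambda>k. k - a"]) auto
  finally show ?thesis by simp
qed

context special_system begin

abbreviation (input) D :: nat where "D \<equiv> 5 ^ card I"
text \<open>\<open>W\<close> bounds the row sums of the linear system in
  \<open>polynomial_relation\<close>: each of the \<open>2 * D + 1\<close> powers of the variable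
  contributes at most \<open>L ^ (2 * D)\<close>. \<open>H\<close> makes \<open>H + 1\<close> a
  power of \<open>2 * W\<close>, so that the pigeonhole count becomes a comparison of
  exponents.\<close>

definition W :: nat where "W = (2 * D + 1) * L ^ (2 * D)"
definition H :: nat where "H = (2 * W) ^ (2 * D) - 1"

lemma H_card: "(2 * H * W + 1) ^ ((4 * D + 1) * D) < (H + 1) ^ ((2 * D + 1) * (2 * D + 1))"
proof -
  have D: "D \<ge> 1" by simp
  have W: "W \<ge> 1" unfolding W_def using L by (simp add: Suc_le_eq)
  have H: "H + 1 = (2 * W) ^ (2 * D)"
    unfolding H_def using W by simp
  have "2 * H * W + 1 \<le> 2 * W * (H + 1)" using W by (simp add: algebra_simps)
  also have "\<dots> = (2 * W) ^ (2 * D + 1)" unfolding H by simp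
  finally have "(2 * H * W + 1) ^ ((4 * D + 1) * D) \<le> ((2 * W) ^ (2 * D + 1)) ^ ((4 * D + 1) * D)"
    by (rule power_mono) simp
  also have "\<dots> = (2 * W) ^ ((2 * D + 1) * ((4 * D + 1) * D))"
    by (simp only: power_mult)
  also have "\<dots> < (2 * W) ^ ((2 * D) * ((2 * D + 1) * (2 * D + 1)))"
  proof (rule power_strict_increasing)
    have "(4 * d + 1) * d < (2 * d) * (2 * d + 1)" if "d \<ge> 1" for d :: nat
      using that by (simp add: algebra_simps)
    from this[OF D] have "(4 * D + 1) * D < (2 * D) * (2 * D + 1)" .
    then have "(2 * D + 1) * ((4 * D + 1) * D) < (2 * D + 1) * ((2 * D) * (2 * D + 1))"
      by (rule mult_strict_left_mono) simp
    then show "(2 * D + 1) * ((4 * D + 1) * D) < (2 * D) * ((2 * D + 1) * (2 * D + 1))"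
      by (simp only: mult_ac)
  qed (use W in simp)
  also have "\<dots> = (H + 1) ^ ((2 * D + 1) * (2 * D + 1))"
    unfolding H by (simp only: power_mult)
  finally show ?thesis .
qed

text \<open>The unknowns are the coefficients of \<open>t ^ a * x j ^ b\<close> with
  \<open>a\<close> and \<open>b\<close> up to \<open>2 * D\<close>, so there are
  \<open>(2 * D + 1) * (2 * D + 1)\<close> of them. The normal forms involve powers of
  \<open>t\<close> up to \<open>4 * D\<close> and \<open>D\<close> basis monomials, which gives only
  \<open>(4 * D + 1) * D\<close> equations.\<close>

lemma polynomial_relation:
  assumes j: "j \<in> I"
  shows "\<exists>c :: nat \<Rightarrow> nat \<Rightarrow> int. (\<exists>a\<le>2*D. \<exists>b\<le>2*D. c a b \<noteq> 0) \<and>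
     (\<forall>a\<le>2*D. \<forall>b\<le>2*D. \<bar>c a b\<bar> \<le> int H) \<and>
     (\<forall>t x. sol t x \<longrightarrow> (\<Sum>a\<le>2*D. \<Sum>b\<le>2*D. of_int (c a b) * t ^ a * x j ^ b) = 0)"
proof -
  let ?n = "2 * D"
  have "\<forall>b\<in>{..?n}. \<exists>e :: nat \<Rightarrow> (nat \<Rightarrow> nat) \<Rightarrow> int.
     (\<Sum>k\<le>?n. \<Sum>\<alpha>\<in>basis. \<bar>e k \<alpha>\<bar>) \<le> int (L ^ ?n) \<and>
     (\<forall>t x. sol t x \<longrightarrow> x j ^ b = (\<Sum>k\<le>?n. \<Sum>\<alpha>\<in>basis. of_int (e k \<alpha>) * (t ^ k * bmon \<alpha> x)))"
  proof
    fix b assume "b \<in> {..?n}"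
    then have b: "b \<le> ?n" by simp
    have "set_mset (replicate_mset b j) \<subseteq> I" using j by auto
    from reduces_mon[OF this] have "reduces ?n (L ^ ?n) (\<lambda>t x. mon (replicate_mset b j) x)"
      by (rule reduces_mono) (use b L power_increasing[OF b, of L] in auto)
    moreover have "mon (replicate_mset b j) x = x j ^ b" for x
      by (simp add: mon_def)
    ultimately show "\<exists>e :: nat \<Rightarrow> (nat \<Rightarrow> nat) \<Rightarrow> int.
     (\<Sum>k\<le>?n. \<Sum>\<alpha>\<in>basis. \<bar>e k \<alpha>\<bar>) \<le> int (L ^ ?n) \<and>
     (\<forall>t x. sol t x \<longrightarrow> x j ^ b = (\<Sum>k\<le>?n. \<Sum>\<alpha>\<in>basis. of_int (e k \<alpha>) * (t ^ k * bmon \<alpha> x)))"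
      unfolding reduces_def by simp
  qed
  from bchoice[OF this] obtain e :: "nat \<Rightarrow> nat \<Rightarrow> (nat \<Rightarrow> nat) \<Rightarrow> int"
    where e1: "\<And>b. b \<le> ?n \<Longrightarrow> (\<Sum>k\<le>?n. \<Sum>\<alpha>\<in>basis. \<bar>e b k \<alpha>\<bar>) \<le> int (L ^ ?n)"
      and e2: "\<And>b t x. b \<le> ?n \<Longrightarrow> sol t x \<Longrightarrow>
         x j ^ b = (\<Sum>k\<le>?n. \<Sum>\<alpha>\<in>basis. of_int (e b k \<alpha>) * (t ^ k * bmon \<alpha> x))"
    by blast
  \<comment> \<open>Multiplying by \<open>t ^ a\<close> shifts the normal form of
    \<open>x j ^ b\<close>, so its coefficient at \<open>t ^ k\<close> is the one with index
    \<open>k - a\<close> in \<open>e b\<close>.\<close>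
  define m where "m = (\<lambda>(k, \<alpha>) (a, b). if a \<le> k \<and> k - a \<le> ?n then e b (k - a) \<alpha> else 0)"
  let ?X = "{..?n} \<times> {..?n}" and ?Y = "{..?n + ?n} \<times> basis"
  have W: "(\<Sum>x\<in>?X. \<bar>m y x\<bar>) \<le> int W" if "y \<in> ?Y" for y
  proof -
    obtain k \<alpha> where y: "y = (k, \<alpha>)" "\<alpha> \<in> basis" using \<open>y \<in> ?Y\<close> by auto
    have "(\<Sum>a\<le>?n. \<bar>m y (a, b)\<bar>) \<le> int (L ^ ?n)" if "b \<le> ?n" for b
    proof -
      have "(\<Sum>a\<le>?n. \<bar>m y (a, b)\<bar>) = (\<Sum>a\<le>?n. if a \<le> k \<and> k - a \<le> ?n then \<bar>e b (k - a) \<alpha>\<bar> else 0)"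
        unfolding m_def y by (intro sum.cong) auto
      also have "\<dots> = (\<Sum>a | a \<in> {..?n} \<and> a \<le> k \<and> k - a \<le> ?n. \<bar>e b (k - a) \<alpha>\<bar>)"
        by (intro sum.inter_filter[symmetric]) auto
      also have "\<dots> = sum (\<lambda>k'. \<bar>e b k' \<alpha>\<bar>) ((\<lambda>a. k - a) ` {a \<in> {..?n}. a \<le> k \<and> k - a \<le> ?n})"
        by (subst sum.reindex) (auto simp: inj_on_def)
      also have "\<dots> \<le> (\<Sum>k'\<le>?n. \<bar>e b k' \<alpha>\<bar>)"
        by (intro sum_mono2) auto
      also have "\<dots> \<le> (\<Sum>k'\<le>?n. \<Sum>\<alpha>\<in>basis. \<bar>e b k' \<alpha>\<bar>)"
        using y finite_basis by (intro sum_mono member_le_sum) auto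
      finally show ?thesis using e1[OF that] by simp
    qed
    then have "(\<Sum>b\<le>?n. \<Sum>a\<le>?n. \<bar>m y (a, b)\<bar>) \<le> (\<Sum>b\<le>?n. int (L ^ ?n))"
      by (intro sum_mono) auto
    also have "\<dots> = int W" unfolding W_def by (simp add: algebra_simps)
    finally show ?thesis unfolding sum.cartesian_product' by (subst sum.swap)
  qed
  have "(2 * H * W + 1) ^ card ?Y < (H + 1) ^ card ?X"
  proof -
    have "card ?Y = (4 * D + 1) * D" "card ?X = (2 * D + 1) * (2 * D + 1)"
      by (auto simp: card_cartesian_product card_basis)
    then show ?thesis using H_card by (simp only:)
  qed
  moreover have "finite ?X" "finite ?Y" using finite_basis by auto
  ultimately have "\<exists>c. (\<exists>x\<in>?X. c x \<noteq> 0) \<and> (\<forall>x\<in>?X. \<bar>c x\<bar> \<le> int H) \<and>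
    (\<forall>y\<in>?Y. (\<Sum>x\<in>?X. m y x * c x) = 0)"
    by (intro siegel[where W = W] W)
  then obtain c where c: "\<exists>x\<in>?X. c x \<noteq> 0" "\<forall>x\<in>?X. \<bar>c x\<bar> \<le> int H"
    "\<forall>y\<in>?Y. (\<Sum>x\<in>?X. m y x * c x) = 0"
    by blast
  have "(\<Sum>a\<le>?n. \<Sum>b\<le>?n. of_int (c (a, b)) * t ^ a * x j ^ b) = 0" if sol: "sol t x" for t x
  proof -
    have "(\<Sum>a\<le>?n. \<Sum>b\<le>?n. of_int (c (a, b)) * t ^ a * x j ^ b) =
       (\<Sum>a\<le>?n. \<Sum>b\<le>?n. of_int (c (a, b)) * (\<Sum>k\<le>?n. t ^ (a + k) * (\<Sum>\<alpha>\<in>basis. of_int (e b k \<alpha>) * bmon \<alpha> x)))"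
      by (intro sum.cong refl, subst e2[OF _ sol])
        (auto simp: sum_distrib_left power_add mult_ac)
    also have "\<dots> = (\<Sum>a\<le>?n. \<Sum>b\<le>?n. of_int (c (a, b)) * (\<Sum>k\<le>?n + ?n.
        t ^ k * (\<Sum>\<alpha>\<in>basis. of_int (m (k, \<alpha>) (a, b)) * bmon \<alpha> x)))"
    proof -
      have "(\<Sum>k\<le>?n. t ^ (a + k) * (\<Sum>\<alpha>\<in>basis. of_int (e b k \<alpha>) * bmon \<alpha> x)) =
        (\<Sum>k\<le>?n + ?n. t ^ k * (\<Sum>\<alpha>\<in>basis. of_int (m (k, \<alpha>) (a, b)) * bmon \<alpha> x))"
        if "a \<le> ?n" for a b
        using sum_shift_conv[OF that, of "\<lambda>k. t ^ k * (\<Sum>\<alpha>\<in>basis. of_int (e b (k - a) \<alpha>) * bmon \<alpha> x)" ?n]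
        by (auto simp: m_def intro!: sum.cong)
      then show ?thesis by (intro sum.cong refl) auto
    qed
    also have "\<dots> = (\<Sum>a\<le>?n. \<Sum>b\<le>?n. \<Sum>k\<le>?n + ?n. \<Sum>\<alpha>\<in>basis.
        t ^ k * bmon \<alpha> x * of_int (m (k, \<alpha>) (a, b) * c (a, b)))"
      by (simp add: sum_distrib_left mult_ac)
    also have "\<dots> = (\<Sum>z\<in>?X. \<Sum>k\<le>?n + ?n. \<Sum>\<alpha>\<in>basis.
        t ^ k * bmon \<alpha> x * of_int (m (k, \<alpha>) z * c z))"
      by (simp add: sum.cartesian_product')
    also have "\<dots> = (\<Sum>k\<le>?n + ?n. \<Sum>\<alpha>\<in>basis. \<Sum>z\<in>?X. t ^ k * bmon \<alpha> x * of_int (m (k, \<alpha>) z * c z))"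
      by (subst sum.swap, rule sum.cong[OF refl], rule sum.swap)
    also have "\<dots> = (\<Sum>k\<le>?n + ?n. \<Sum>\<alpha>\<in>basis. t ^ k * bmon \<alpha> x * of_int (\<Sum>z\<in>?X. m (k, \<alpha>) z * c z))"
      by (simp add: sum_distrib_left)
    also have "\<dots> = 0"
      using c(3) by (intro sum.neutral ballI) auto
    finally show ?thesis .
  qed
  with c show ?thesis
    by (intro exI[of _ "\<lambda>a b. c (a, b)"]) auto
qed

end

section \<open>Roots of integer polynomials and the limit of a relation\<close>

text \<open>Cauchy's root bound. Integrality makes the leading coefficient at least 1 in absolute
  value, so the other coefficients alone determine the bound.\<close>

lemma int_poly_root_bound:
  fixes c :: "nat \<Rightarrow> int" and z :: real
  assumes nz: "\<exists>b\<le>n. c b \<noteq> 0" and H: "\<And>b. b \<le> n \<Longrightarrow> \<bar>c b\<bar> \<le> int H"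
    and root: "(\<Sum>b\<le>n. of_int (c b) * z ^ b) = 0"
  shows "\<bar>z\<bar> \<le> real H + 1"
proof (rule ccontr)
  assume "\<not> ?thesis"
  then have z: "\<bar>z\<bar> > real H + 1" by simp
  define d where "d = Max {b. b \<le> n \<and> c b \<noteq> 0}"
  have fin: "finite {b. b \<le> n \<and> c b \<noteq> 0}" by auto
  then have d: "d \<le> n" "c d \<noteq> 0"
    using Max_in[OF fin] nz unfolding d_def by auto
  have d_max: "c b = 0" if "b \<le> n" "d < b" for b
    using that Max_ge[OF fin, of b] unfolding d_def by (metis (mono_tags, lifting) mem_Collect_eq not_le)
  have "(\<Sum>b\<le>n. of_int (c b) * z ^ b) = (\<Sum>b\<le>d. of_int (c b) * z ^ b)"
    using d d_max by (intro sum.mono_neutral_right) auto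
  then have "of_int (c d) * z ^ d = - (\<Sum>b<d. of_int (c b) * z ^ b)"
    using root by (simp add: lessThan_Suc_atMost[symmetric])
  then have "\<bar>of_int (c d)\<bar> * \<bar>z\<bar> ^ d = \<bar>\<Sum>b<d. of_int (c b) * z ^ b\<bar>"
    by (metis abs_minus_cancel abs_mult power_abs)
  also have "\<dots> \<le> (\<Sum>b<d. real H * \<bar>z\<bar> ^ b)"
  proof (rule order_trans[OF sum_abs sum_mono])
    fix b assume "b \<in> {..<d}"
    then have "\<bar>c b\<bar> \<le> int H" using H[of b] d by auto
    then have "real_of_int \<bar>c b\<bar> \<le> real H" by linarith
    then show "\<bar>of_int (c b) * z ^ b\<bar> \<le> real H * \<bar>z\<bar> ^ b"
      by (simp add: abs_mult power_abs mult_right_mono)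
  qed
  finally have "\<bar>of_int (c d)\<bar> * \<bar>z\<bar> ^ d \<le> real H * (\<Sum>b<d. \<bar>z\<bar> ^ b)"
    by (simp add: sum_distrib_left)
  moreover have "real_of_int \<bar>c d\<bar> \<ge> 1" using d(2) by linarith
  then have "1 * \<bar>z\<bar> ^ d \<le> \<bar>of_int (c d)\<bar> * \<bar>z\<bar> ^ d"
    by (intro mult_right_mono) auto
  ultimately have 1: "\<bar>z\<bar> ^ d \<le> real H * (\<Sum>b<d. \<bar>z\<bar> ^ b)" by simp
  have "(\<Sum>b<d. \<bar>z\<bar> ^ b) \<ge> 0" by (intro sum_nonneg) auto
  then have "real H * (\<Sum>b<d. \<bar>z\<bar> ^ b) \<le> (\<bar>z\<bar> - 1) * (\<Sum>b<d. \<bar>z\<bar> ^ b)"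
    using z by (intro mult_right_mono) auto
  also have "\<dots> = \<bar>z\<bar> ^ d - 1" by (rule power_diff_1_eq[symmetric])
  finally show False using 1 by simp
qed

text \<open>After division by the highest power \<open>t ^ d\<close> that occurs with a nonzero
  coefficient, the lower powers of \<open>t\<close> vanish in the limit. Hence \<open>z\<close> is a
  root of the coefficient of \<open>t ^ d\<close>, which is nonzero by the choice of
  \<open>d\<close>.\<close>

lemma leading_coeff_limit:
  fixes c :: "nat \<Rightarrow> nat \<Rightarrow> int" and t y :: "nat \<Rightarrow> real"
  assumes nz: "\<exists>a\<le>n. \<exists>b\<le>n. c a b \<noteq> 0" and H: "\<And>a b. a \<le> n \<Longrightarrow> b \<le> n \<Longrightarrow> \<bar>c a b\<bar> \<le> int H"
    and t: "filterlim t at_infinity sequentially" and y: "y \<longlonglongrightarrow> z"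
    and rel: "\<forall>\<^sub>F m in sequentially. (\<Sum>a\<le>n. \<Sum>b\<le>n. of_int (c a b) * t m ^ a * y m ^ b) = 0"
  shows "\<bar>z\<bar> \<le> real H + 1"
proof -
  define d where "d = Max {a. a \<le> n \<and> (\<exists>b\<le>n. c a b \<noteq> 0)}"
  have fin: "finite {a. a \<le> n \<and> (\<exists>b\<le>n. c a b \<noteq> 0)}" by auto
  then have d: "d \<le> n" "\<exists>b\<le>n. c d b \<noteq> 0"
    using Max_in[OF fin] nz unfolding d_def by auto
  have d_max: "c a b = 0" if "a \<le> n" "d < a" "b \<le> n" for a b
    using that Max_ge[OF fin, of a] unfolding d_def by (metis (mono_tags, lifting) mem_Collect_eq not_le)
  define p where "p a m = (\<Sum>b\<le>n. of_int (c a b) * y m ^ b)" for a m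
  have p: "p a \<longlonglongrightarrow> (\<Sum>b\<le>n. of_int (c a b) * z ^ b)" for a
    unfolding p_def by (intro tendsto_intros y)
  have "(\<lambda>m. p d m + (\<Sum>a<d. p a m * inverse (t m) ^ (d - a))) \<longlonglongrightarrow>
     (\<Sum>b\<le>n. of_int (c d b) * z ^ b) + (\<Sum>a<d. (\<Sum>b\<le>n. of_int (c a b) * z ^ b) * 0 ^ (d - a))"
    by (intro tendsto_intros p tendsto_compose_filtermap)
      (rule filterlim_compose[OF tendsto_inverse_0 t])
  then have "(\<lambda>m. p d m + (\<Sum>a<d. p a m * inverse (t m) ^ (d - a))) \<longlonglongrightarrow>
     (\<Sum>b\<le>n. of_int (c d b) * z ^ b)"
    by (simp add: power_0_left)
  moreover have "\<forall>\<^sub>F m in sequentially. p d m + (\<Sum>a<d. p a m * inverse (t m) ^ (d - a)) = 0"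
  proof -
    have "\<forall>\<^sub>F m in sequentially. t m \<noteq> 0"
      using filterlim_at_infinity_imp_eventually_ne[OF t] .
    then show ?thesis using rel
    proof eventually_elim
      case (elim m)
      have "(\<Sum>a\<le>n. \<Sum>b\<le>n. of_int (c a b) * t m ^ a * y m ^ b) = (\<Sum>a\<le>n. t m ^ a * p a m)"
        unfolding p_def by (simp add: sum_distrib_left mult_ac)
      also have "\<dots> = (\<Sum>a\<le>d. t m ^ a * p a m)"
        using d d_max by (intro sum.mono_neutral_right) (auto simp: p_def)
      also have "\<dots> = t m ^ d * (p d m + (\<Sum>a<d. p a m * inverse (t m) ^ (d - a)))"
      proof -
        have "t m ^ a * p a m = t m ^ d * (p a m * inverse (t m) ^ (d - a))" if "a < d" for a
          using that elim(1) power_add[of "t m" a "d - a"] by (simp add: field_simps)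
        then have "(\<Sum>a<d. t m ^ a * p a m) = (\<Sum>a<d. t m ^ d * (p a m * inverse (t m) ^ (d - a)))"
          by (intro sum.cong) auto
        then show ?thesis
          by (simp add: lessThan_Suc_atMost[symmetric] distrib_left sum_distrib_left)
      qed
      finally show ?case using elim by simp
    qed
  qed
  ultimately have "(\<Sum>b\<le>n. of_int (c d b) * z ^ b) = 0"
    by (blast intro: LIMSEQ_unique tendsto_eventually)
  with d H show ?thesis by (intro int_poly_root_bound[of n "c d"]) auto
qed

section \<open>A feasible point of bounded size\<close>

lemma int_poly_cong_vars:
  assumes "int_poly I d L f" "\<And>i. i \<in> I \<Longrightarrow> x i = y i"
  shows "f x = f y"
proof -
  obtain ps where ps: "\<forall>p\<in>set ps. size (snd p) \<le> d \<and> set_mset (snd p) \<subseteq> I"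
    "f = (\<lambda>x. \<Sum>p\<leftarrow>ps. of_int (fst p) * mon (snd p) x)"
    using assms unfolding int_poly_def by auto
  have "mon M x = mon M y" if "set_mset M \<subseteq> I" for M
    unfolding mon_def using that assms(2) by (intro arg_cong[where f = prod_mset] image_mset_cong) auto
  then show ?thesis
    unfolding ps(2) using ps(1) by (intro arg_cong[where f = sum_list] map_cong) auto
qed

text \<open>Points are functions on all natural numbers, so compactness is Tychonoff's theorem.
  Every coordinate outside \<open>I\<close> is frozen at 0, since an unconstrained one would destroy
  it.\<close>

lemma compact_box:
  fixes I :: "nat set" and M :: real
  shows "compact {x :: nat \<Rightarrow> real. (\<forall>i\<in>I. \<bar>x i\<bar> \<le> M) \<and> (\<forall>i. i \<notin> I \<longrightarrow> x i = 0)}"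
proof -
  have "compactin (product_topology (\<lambda>i. euclidean) UNIV)
     (PiE UNIV (\<lambda>i :: nat. if i \<in> I then {-M..M} else {0 :: real}))"
    unfolding compactin_PiE by auto
  moreover have "PiE UNIV (\<lambda>i :: nat. if i \<in> I then {-M..M} else {0 :: real}) =
     {x. (\<forall>i\<in>I. \<bar>x i\<bar> \<le> M) \<and> (\<forall>i. i \<notin> I \<longrightarrow> x i = 0)}"
    by (auto simp: PiE_def Pi_def abs_le_iff split: if_splits)
  ultimately show ?thesis by (simp add: euclidean_product_topology)
qed

text \<open>The sum \<open>Q\<close> of at most \<open>card G\<close> squares has coefficient sum at
  most \<open>card G * c\<^sup>2\<close>. As \<open>Q\<close> has degree 4, differentiation
  multiplies this by at most 4, and the added 1 ensures \<open>L \<ge> 1\<close>.\<close>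

lemma bounded_feasible_point:
  fixes G :: "((nat \<Rightarrow> real) \<Rightarrow> real) set"
  assumes I: "finite I" and G: "finite G" "\<And>g. g \<in> G \<Longrightarrow> int_poly I 2 c g"
    and x0: "\<And>g. g \<in> G \<Longrightarrow> g x0 \<ge> 0" and L: "4 * (card G * c\<^sup>2) + 1 \<le> L"
  shows "\<exists>x. (\<forall>g\<in>G. g x \<ge> 0) \<and>
    (\<forall>i\<in>I. \<bar>x i\<bar> \<le> real (special_system.H I L) + 1)"
proof -
  define supp where "supp x \<longleftrightarrow> (\<forall>i. i \<notin> I \<longrightarrow> x i = 0)" for x :: "nat \<Rightarrow> real"
  define ok where "ok S \<longleftrightarrow> (\<exists>x. supp x \<and> (\<forall>g\<in>G. g x \<ge> 0) \<and> (\<forall>g\<in>S. g x = 0))"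
    for S :: "((nat \<Rightarrow> real) \<Rightarrow> real) set"
  have "ok {}"
  proof -
    have "g (\<lambda>i. if i \<in> I then x0 i else 0) = g x0" if "g \<in> G" for g
      by (rule int_poly_cong_vars[OF G(2)[OF that]]) auto
    then have "g (\<lambda>i. if i \<in> I then x0 i else 0) \<ge> 0" if "g \<in> G" for g
      using x0[OF that] that by metis
    then show ?thesis unfolding ok_def supp_def
      by (intro exI[of _ "\<lambda>i. if i \<in> I then x0 i else 0"]) auto
  qed
  then have "{S \<in> Pow G. ok S} \<noteq> {}" by blast
  from finite_has_maximal[OF _ this] G(1) obtain S where S: "S \<subseteq> G" "ok S"
    and S_max: "\<And>S'. S' \<subseteq> G \<Longrightarrow> ok S' \<Longrightarrow> S \<subseteq> S' \<Longrightarrow> S = S'"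
    by auto
  obtain z0 where z0: "supp z0" "\<And>g. g \<in> G \<Longrightarrow> g z0 \<ge> 0" "\<And>g. g \<in> S \<Longrightarrow> g z0 = 0"
    using S(2) unfolding ok_def by auto
  define Q where "Q x = (\<Sum>g\<in>S. g x * g x)" for x
  define R where "R x = (\<Sum>i\<in>I. x i ^ 6)" for x :: "nat \<Rightarrow> real"
  have finS: "finite S" using S G finite_subset by blast
  have Q: "int_poly I 4 (card S * (c * c)) Q"
  proof -
    have "int_poly I 4 (c * c) (\<lambda>x. g x * g x)" if "g \<in> S" for g
      using int_poly_mult[OF G(2) G(2), of g g] that S by auto
    from int_poly_sum[OF finS this] show ?thesis unfolding Q_def .
  qed
  have "\<exists>q. int_poly I 3 L q \<and> (\<forall>x. ((\<lambda>s. Q (x(i := s))) has_real_derivative q x) (at (x i)))" for i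
  proof -
    have "Suc 3 * (card S * (c * c)) \<le> L"
    proof -
      have "card S * (c * c) \<le> card G * (c * c)"
        by (rule mult_right_mono) (use card_mono[OF G(1) S(1)] in auto)
      then have "4 * (card S * (c * c)) \<le> L" using L unfolding power2_eq_square by linarith
      then show ?thesis
        unfolding Suc_numeral by (simp only: semiring_norm)
    qed
    moreover have "int_poly I (Suc 3) (card S * (c * c)) Q" using Q by (simp add: numeral_eq_Suc)
    ultimately show ?thesis using int_poly_deriv[of I 3 _ Q i] by (meson int_poly_mono order_refl)
  qed
  then obtain q where dq: "\<And>i. int_poly I 3 L (q i)"
    "\<And>i x. ((\<lambda>s. Q (x(i := s))) has_real_derivative q i x) (at (x i))" by metis
  interpret special_system I L q
    by unfold_locales (use I dq L in auto)
  \<comment> \<open>The members of \<open>S\<close> are not imposed in \<open>K\<close> but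
    penalised through \<open>Q\<close>. Comparison with \<open>z0\<close>, where \<open>Q\<close>
    vanishes, shows \<open>R \<le> R z0\<close> at the minimisers, so the slack 1 keeps the bound on
    \<open>R\<close> inactive there.\<close>
  define K where "K = {x. supp x \<and> R x \<le> R z0 + 1 \<and> (\<forall>g\<in>G - S. g x \<ge> 0)}"
  have contG: "continuous_on UNIV g" if "g \<in> G" for g
    using int_poly_continuous[OF G(2)[OF that]] .
  have contQ: "continuous_on UNIV Q" using int_poly_continuous[OF Q] .
  have contR: "continuous_on UNIV R" unfolding R_def
    by (intro continuous_intros continuous_on_product_coordinates)
  have Q0: "Q x \<ge> 0" for x unfolding Q_def by (intro sum_nonneg) auto
  have R0: "R x \<ge> 0" for x unfolding R_def by (intro sum_nonneg) auto
  have R_coord: "\<bar>x i\<bar> \<le> R z0 + 2" if "R x \<le> R z0 + 1" "i \<in> I" for x i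
  proof (rule ccontr)
    assume "\<not> ?thesis"
    then have "\<bar>x i\<bar> > R z0 + 2" by simp
    moreover have "\<bar>x i\<bar> ^ 1 \<le> \<bar>x i\<bar> ^ 6" using calculation R0[of z0] by (intro power_increasing) auto
    moreover have "\<bar>x i\<bar> ^ 6 \<le> R x" unfolding R_def
      using member_le_sum[of i I "\<lambda>i. x i ^ 6"] that I by (simp add: power_even_abs)
    ultimately show False using that by simp
  qed
  have "compact K"
  proof -
    have K: "K = {x. (\<forall>i\<in>I. \<bar>x i\<bar> \<le> R z0 + 2) \<and> (\<forall>i. i \<notin> I \<longrightarrow> x i = 0)} \<inter>
       ({x. R x \<le> R z0 + 1} \<inter> (\<Inter>g\<in>G - S. {x. 0 \<le> g x}))"
      unfolding K_def supp_def using R_coord by auto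
    have "closed ({x. R x \<le> R z0 + 1} \<inter> (\<Inter>g\<in>G - S. {x. 0 \<le> g x}))"
      using contR contG by (intro closed_Int closed_INT ballI closed_Collect_le) (auto intro!: continuous_intros)
    from compact_Int_closed[OF compact_box this] show ?thesis unfolding K .
  qed
  have z0K: "z0 \<in> K" unfolding K_def using z0 by auto
  have "\<exists>x\<in>K. \<forall>y\<in>K. Q x + R x / real (Suc m) \<le> Q y + R y / real (Suc m)" for m
  proof -
    have "continuous_on K (\<lambda>x. Q x + R x * (1 / real (Suc m)))"
      by (intro continuous_on_add continuous_on_mult_right
          continuous_on_subset[OF contQ] continuous_on_subset[OF contR] subset_UNIV)
    from continuous_attains_inf[OF \<open>compact K\<close> _ this] z0K show ?thesis by auto
  qed
  then have "\<forall>m. \<exists>x. x \<in> K \<and> (\<forall>y\<in>K. Q x + R x / real (Suc m) \<le> Q y + R y / real (Suc m))"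
    by blast
  from choice[OF this] obtain X where X: "\<And>m. X m \<in> K"
    "\<And>m y. y \<in> K \<Longrightarrow> Q (X m) + R (X m) / real (Suc m) \<le> Q y + R y / real (Suc m)"
    by blast
  have Qz0: "Q z0 = 0" unfolding Q_def
  proof (rule sum.neutral, rule ballI)
    fix g assume "g \<in> S"
    from z0(3)[OF this] show "g z0 * g z0 = 0" by (rule mult_eq_0_iff[THEN iffD2, OF disjI1])
  qed
  have RX: "R (X m) \<le> R z0" for m
  proof -
    have "R (X m) / real (Suc m) \<le> R z0 / real (Suc m)"
      using X(2)[OF z0K, of m] Q0[of "X m"] Qz0 by linarith
    then show ?thesis by (simp add: divide_le_cancel)
  qed
  have QX: "Q (X m) \<le> R z0 / real (Suc m)" for m
  proof -
    have "R (X m) / real (Suc m) \<ge> 0" using R0 by simp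
    then show ?thesis using X(2)[OF z0K, of m] Qz0 by linarith
  qed
  obtain l r where l: "l \<in> K" and r: "strict_mono r" "(X \<circ> r) \<longlonglongrightarrow> l"
    using seq_compactE[OF compact_imp_seq_compact[OF \<open>compact K\<close>], of X] X(1) by blast
  have lim: "(\<lambda>m. f (X (r m))) \<longlonglongrightarrow> f l" if "continuous_on UNIV f" for f :: "(nat \<Rightarrow> real) \<Rightarrow> real"
    using continuous_on_tendsto_compose[OF that r(2)] by (simp add: o_def)
  have "Q l = 0"
  proof -
    have "(\<lambda>m. Q (X (r m))) \<longlonglongrightarrow> 0"
    proof (rule tendsto_sandwich[OF _ _ tendsto_const])
      have "(\<lambda>m. R z0 / real (Suc m)) \<longlonglongrightarrow> 0"
        using LIMSEQ_Suc[OF lim_const_over_n[of "R z0"]] by simp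
      from LIMSEQ_subseq_LIMSEQ[OF this r(1)] show "(\<lambda>m. R z0 / real (Suc (r m))) \<longlonglongrightarrow> 0"
        by (simp add: o_def)
    qed (use Q0 QX in auto)
    with lim[OF contQ] show ?thesis using LIMSEQ_unique by blast
  qed
  then have lS: "g l = 0" if "g \<in> S" for g
    using that finS unfolding Q_def by (subst (asm) sum_nonneg_eq_0_iff) auto
  have lG: "g l \<ge> 0" if "g \<in> G" for g
  proof (cases "g \<in> S")
    case True
    from lS[OF this] show ?thesis by (rule eq_refl[OF sym])
  next
    case False
    with that l show ?thesis unfolding K_def by blast
  qed
  have lpos: "g l > 0" if "g \<in> G - S" for g
  proof (rule ccontr)
    assume "\<not> g l > 0"
    then have "g l = 0" using lG[of g] that by force
    then have "ok (insert g S)"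
      unfolding ok_def using l lS lG K_def by blast
    then have "S = insert g S" using that S(1) by (intro S_max) auto
    then show False using that by auto
  qed
  have "\<forall>\<^sub>F m in sequentially. \<forall>g\<in>G - S. g (X (r m)) > 0"
  proof (rule eventually_ball_finite)
    show "\<forall>g\<in>G - S. \<forall>\<^sub>F m in sequentially. g (X (r m)) > 0"
    proof
      fix g assume g: "g \<in> G - S"
      then have "g \<in> G" by blast
      from order_tendstoD(1)[OF lim[OF contG[OF this]] lpos[OF g]]
      show "\<forall>\<^sub>F m in sequentially. g (X (r m)) > 0" .
    qed
  qed (use G(1) in simp)
  then have sol: "\<forall>\<^sub>F m in sequentially. sol (- (real (Suc (r m)) / 6)) (X (r m))"
  proof eventually_elim
    case (elim m)
    let ?x = "X (r m)" and ?n = "real (Suc (r m))"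
    have "?x i ^ 5 = - (?n / 6) * q i ?x" if i: "i \<in> I" for i
    proof -
      let ?u = "\<lambda>s. ?x(i := s)"
      have contu: "isCont (\<lambda>s. f (?u s)) s" if "continuous_on UNIV f" for f :: "(nat \<Rightarrow> real) \<Rightarrow> real" and s
      proof -
        have "continuous_on UNIV ?u"
        proof (rule continuous_on_coordinatewise_then_product)
          show "continuous_on UNIV (\<lambda>s. ?u s j)" for j
            by (cases "j = i") (auto intro!: continuous_intros)
        qed
        from continuous_on_compose2[OF that this] show ?thesis
          by (auto simp: continuous_on_eq_continuous_at)
      qed
      \<comment> \<open>Both the bound on \<open>R\<close> and the constraints outside
        \<open>S\<close> are strict at \<open>?x\<close>, hence hold on an open interval when only
        coordinate \<open>i\<close> moves. Therefore \<open>?x\<close> is an unconstrained local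
        minimum in that direction and the derivative vanishes.\<close>
      have "R ?x < R z0 + 1" using RX[of "r m"] by simp
      then have "\<forall>\<^sub>F s in at (?x i). R (?u s) < R z0 + 1"
        using order_tendstoD(2)[OF contu[OF contR, unfolded isCont_def]] by simp
      moreover have "\<forall>\<^sub>F s in at (?x i). \<forall>g\<in>G - S. g (?u s) > 0"
      proof (rule eventually_ball_finite)
        show "\<forall>g\<in>G - S. \<forall>\<^sub>F s in at (?x i). g (?u s) > 0"
        proof
          fix g assume g: "g \<in> G - S"
          then have gG: "g \<in> G" by blast
          have "0 < g (?u (?x i))" using elim g by (simp only: fun_upd_triv)
          from order_tendstoD(1)[OF contu[OF contG[OF gG], unfolded isCont_def] this]
          show "\<forall>\<^sub>F s in at (?x i). g (?u s) > 0" .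
        qed
      qed (use G(1) in simp)
      ultimately have "\<forall>\<^sub>F s in at (?x i). ?u s \<in> K"
      proof eventually_elim
        case (elim s)
        then show ?case using X(1)[of "r m"] i by (auto simp: K_def supp_def intro: less_imp_le)
      qed
      then obtain d where d: "d > 0" "\<And>s. s \<noteq> ?x i \<Longrightarrow> dist s (?x i) < d \<Longrightarrow> ?u s \<in> K"
        unfolding eventually_at by auto
      have uK: "?u s \<in> K" if "\<bar>?x i - s\<bar> < d" for s
        using d(2)[of s] X(1)[of "r m"] that by (cases "s = ?x i") (auto simp: dist_real_def abs_minus_commute)
      have "R (?u s) = s ^ 6 + (\<Sum>j\<in>I - {i}. ?x j ^ 6)" for s
        unfolding R_def using i I by (subst sum.remove[of _ i]) auto
      then have "((\<lambda>s. R (?u s)) has_real_derivative 6 * ?x i ^ 5) (at (?x i))"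
        by (auto intro!: derivative_eq_intros)
      from DERIV_add[OF dq(2)[of ?x i] DERIV_cdivide[OF this, of ?n]]
      have "((\<lambda>s. Q (?u s) + R (?u s) / ?n) has_real_derivative q i ?x + 6 * ?x i ^ 5 / ?n) (at (?x i))" .
      from DERIV_local_min[OF this d(1)] X(2)[OF uK]
      have "q i ?x + 6 * ?x i ^ 5 / ?n = 0" by simp
      then show ?thesis by (simp add: field_simps)
    qed
    then show ?case unfolding sol_def by auto
  qed
  have t: "filterlim (\<lambda>m. - (real (Suc (r m)) / 6)) at_infinity sequentially"
  proof -
    have "filterlim (\<lambda>m. real (Suc m) / 6) at_top sequentially" by real_asymp
    from filterlim_compose[OF this filterlim_subseq[OF r(1)]]
    have "filterlim (\<lambda>m. - (real (Suc (r m)) / 6)) at_bot sequentially"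
      by (simp add: filterlim_uminus_at_bot)
    then show ?thesis using at_bot_le_at_infinity filterlim_mono by blast
  qed
  have "\<bar>l i\<bar> \<le> real H + 1" if "i \<in> I" for i
  proof -
    obtain c where c: "\<exists>a\<le>2*5^card I. \<exists>b\<le>2*5^card I. c a b \<noteq> 0"
      "\<And>a b. a\<le>2*5^card I \<Longrightarrow> b\<le>2*5^card I \<Longrightarrow> \<bar>c a b\<bar> \<le> int H"
      "\<And>t x. sol t x \<Longrightarrow> (\<Sum>a\<le>2*5^card I. \<Sum>b\<le>2*5^card I. of_int (c a b) * t ^ a * x i ^ b) = 0"
      using polynomial_relation[OF \<open>i \<in> I\<close>] by blast
    show ?thesis
    proof (rule leading_coeff_limit[OF c(1,2) t lim[OF continuous_on_product_coordinates[of i]]])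
      show "\<forall>\<^sub>F m in sequentially. (\<Sum>a\<le>2*5^card I. \<Sum>b\<le>2*5^card I.
          of_int (c a b) * (- (real (Suc (r m)) / 6)) ^ a * X (r m) i ^ b) = 0"
        using sol by (rule eventually_mono) (rule c(3))
    qed
  qed
  with lG show ?thesis by blast
qed

section \<open>Disks with integer coordinates\<close>

lemma balls_meet_iff:
  fixes c d :: "'a::real_normed_vector"
  assumes "r > 0" "s > 0"
  shows "ball c r \<inter> ball d s \<noteq> {} \<longleftrightarrow> dist c d < r + s"
proof
  assume "ball c r \<inter> ball d s \<noteq> {}"
  then show "dist c d < r + s" using disjoint_ballI[of r s c d] by force
next
  assume less: "dist c d < r + s"
  define p where "p = c + (r / (r + s)) *\<^sub>R (d - c)"
  have "dist c p = r / (r + s) * dist c d"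
    using assms by (simp add: p_def dist_norm norm_minus_commute)
  moreover have "dist d p = s / (r + s) * dist c d"
  proof -
    have "d - p = (s / (r + s)) *\<^sub>R (d - c)"
    proof -
      have "d - p = (1 - r / (r + s)) *\<^sub>R (d - c)" by (simp add: p_def algebra_simps)
      moreover have "1 - r / (r + s) = s / (r + s)" using assms by (simp add: field_simps)
      ultimately show ?thesis by simp
    qed
    then show ?thesis using assms by (simp add: dist_norm norm_minus_commute)
  qed
  moreover have "k / (r + s) * dist c d < k" if "k > 0" for k
    using mult_strict_left_mono[OF less that] assms by (simp add: field_simps)
  ultimately have "p \<in> ball c r \<inter> ball d s" using assms by simp
  then show "ball c r \<inter> ball d s \<noteq> {}" by blast
qed

lemma dist_vector2: "dist (vector [a, b] :: real ^ 2) (vector [c, d]) = sqrt ((a - c)\<^sup>2 + (b - d)\<^sup>2)"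
  by (simp add: dist_vec_def L2_set_def UNIV_2 dist_real_def)

text \<open>Free of square roots and over any ordered domain, so that the same predicate serves real
  realizations and their integer roundings.\<close>

definition overlap :: "('v \<Rightarrow> 'a::linordered_idom) \<Rightarrow> ('v \<Rightarrow> 'a) \<Rightarrow> ('v \<Rightarrow> 'a) \<Rightarrow> 'v \<Rightarrow> 'v \<Rightarrow> bool" where
  "overlap x y r u v \<longleftrightarrow> (x u - x v)\<^sup>2 + (y u - y v)\<^sup>2 < (r u + r v)\<^sup>2"

definition disk :: "('v \<Rightarrow> real) \<Rightarrow> ('v \<Rightarrow> real) \<Rightarrow> ('v \<Rightarrow> real) \<Rightarrow> 'v \<Rightarrow> (real ^ 2) set" where
  "disk x y r v = ball (vector [x v, y v]) (r v)"

lemma disks_meet_iff: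
  assumes "r u > 0" "r v > 0"
  shows "disk x y r u \<inter> disk x y r v \<noteq> {} \<longleftrightarrow> overlap x y r u v"
proof -
  have "sqrt ((x u - x v)\<^sup>2 + (y u - y v)\<^sup>2) < r u + r v \<longleftrightarrow> overlap x y r u v"
    unfolding overlap_def using assms real_sqrt_less_iff[of _ "(r u + r v)\<^sup>2"] by simp
  then show ?thesis
    unfolding disk_def balls_meet_iff[OF assms] dist_vector2 .
qed

lemma disk_graph_obtain:
  fixes G :: "'v pair_pre_digraph"
  assumes "disk_graph G"
  obtains x y r :: "'v \<Rightarrow> real" where "finite (pverts G)" "\<And>v. v \<in> pverts G \<Longrightarrow> r v > 0"
    "parcs G = {(u, v). u \<in> pverts G \<and> v \<in> pverts G \<and> u \<noteq> v \<and> overlap x y r u v}"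
proof -
  obtain V :: "nat set" and A where V: "finite V" "\<And>v. v \<in> V \<Longrightarrow> open_disk (A v)"
    "digraph_iso (with_proj (intersection_graph V A)) (with_proj G)"
    using assms unfolding disk_graph_def by auto
  let ?H = "with_proj (intersection_graph V A)"
  obtain h where h: "pre_digraph.digraph_isomorphism ?H h" "with_proj G = app_iso h ?H"
    using V(3) unfolding digraph_iso_def by auto
  define f where "f = iso_verts h"
  have verts: "pverts G = f ` V"
    using h(2) unfolding f_def with_proj_def app_iso_def by (simp add: intersection_graph_def)
  have inj: "inj_on f V"
    using h(1) unfolding pre_digraph.digraph_isomorphism_def f_def by (simp add: intersection_graph_def)
  \<comment> \<open>Both graphs store arcs as pairs of endpoints. Therefore the isomorphism must
    keep the projections, and its action on arcs is determined by its action on vertices.\<close>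
  have proj: "iso_tail h = fst" "iso_head h = snd"
    using h(2) unfolding with_proj_def app_iso_def by simp_all
  have arc: "iso_arcs h a = (f (fst a), f (snd a))" if "a \<in> parcs (intersection_graph V A)" for a
    using h(1) that unfolding pre_digraph.digraph_isomorphism_def proj f_def
    by (simp add: prod_eq_iff)
  have arcs: "parcs G = (\<lambda>a. (f (fst a), f (snd a))) ` parcs (intersection_graph V A)"
    using h(2) arc unfolding with_proj_def app_iso_def by (auto simp: image_iff)
  define g where "g = inv_into V f"
  have g: "g (f v) = v" if "v \<in> V" for v using that inj unfolding g_def by simp
  have "\<forall>v\<in>V. \<exists>c r. r > 0 \<and> A v = ball c r"
    using V(2) unfolding open_disk_def by blast
  then obtain c r where cr: "\<And>v. v \<in> V \<Longrightarrow> r v > 0 \<and> A v = ball (c v) (r v)"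
    by metis
  define x y \<rho> where "x v = c (g v) $ 1" and "y v = c (g v) $ 2" and "\<rho> v = r (g v)" for v
  have A: "A v = disk x y \<rho> (f v)" if "v \<in> V" for v
  proof -
    have "(vector [c v $ 1, c v $ 2] :: real ^ 2) = c v"
      by (simp add: vec_eq_iff forall_2)
    then show ?thesis using cr[OF that] g[OF that] by (simp add: disk_def x_def y_def \<rho>_def)
  qed
  have pos: "\<rho> v > 0" if "v \<in> pverts G" for v
    using that cr g unfolding verts \<rho>_def by auto
  have "A u \<inter> A v \<noteq> {} \<longleftrightarrow> overlap x y \<rho> (f u) (f v)" if "u \<in> V" "v \<in> V" for u v
    using disks_meet_iff[of \<rho> "f u" "f v" x y] pos A that unfolding verts by auto
  then have "parcs (intersection_graph V A) =
      {(u, v). u \<in> V \<and> v \<in> V \<and> u \<noteq> v \<and> overlap x y \<rho> (f u) (f v)}"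
    unfolding intersection_graph_def by (auto simp del: Int_iff)
  then have "parcs G = {(u, v). u \<in> pverts G \<and> v \<in> pverts G \<and> u \<noteq> v \<and> overlap x y \<rho> u v}"
    unfolding arcs verts using inj by (auto simp: image_iff inj_on_eq_iff) blast
  moreover have "finite (pverts G)" using V(1) verts by simp
  ultimately show thesis using that pos by blast
qed

lemma bitsize_of_int: "bitsize (of_int k) = bitsize_int k + 2"
proof -
  have "quotient_of (of_int k) = (k, 1)" using quotient_of_int[of k] by (simp add: Rat.of_int_def)
  then show ?thesis by (simp add: bitsize_def bitsize_int_def)
qed

lemma bitsize_int_le:
  assumes "real_of_int \<bar>k\<bar> + 1 \<le> 2 ^ b"
  shows "bitsize_int k \<le> Suc b"
proof -
  have "log 2 (real_of_int (\<bar>k\<bar> + 1)) \<le> real b"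
    using assms by (subst log_le_iff) (auto simp: powr_realpow)
  then show ?thesis unfolding bitsize_int_def by (simp add: ceiling_le_iff nat_le_iff)
qed

lemma bitsize_of_int_le:
  assumes "real_of_int \<bar>k\<bar> + 1 \<le> 2 ^ b"
  shows "bitsize (of_int k) \<le> b + 3"
  using bitsize_int_le[OF assms] by (simp add: bitsize_of_int)

lemma integer_realization:
  fixes G :: "nat pair_pre_digraph" and X Y R :: "nat \<Rightarrow> int"
  assumes pos: "\<And>v. v \<in> pverts G \<Longrightarrow> R v > 0"
    and arcs: "parcs G = {(u, v). u \<in> pverts G \<and> v \<in> pverts G \<and> u \<noteq> v \<and> overlap X Y R u v}"
    and le: "\<And>v. v \<in> pverts G \<Longrightarrow> real_of_int \<bar>X v\<bar> + 1 \<le> 2 ^ b"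
      "\<And>v. v \<in> pverts G \<Longrightarrow> real_of_int \<bar>Y v\<bar> + 1 \<le> 2 ^ b"
      "\<And>v. v \<in> pverts G \<Longrightarrow> real_of_int \<bar>R v\<bar> + 1 \<le> 2 ^ b"
  shows "\<exists>x y r. rat_realization G x y r \<and>
    (\<Sum>v\<in>pverts G. bitsize (x v) + bitsize (y v) + bitsize (r v)) \<le> card (pverts G) * (3 * (b + 3))"
proof -
  have disk: "rat_disk (of_int (X v)) (of_int (Y v)) (of_int (R v)) =
      disk (\<lambda>v. of_int (X v)) (\<lambda>v. of_int (Y v)) (\<lambda>v. of_int (R v)) v" for v
    by (simp add: rat_disk_def disk_def)
  have ov: "overlap (\<lambda>v. of_int (X v)) (\<lambda>v. of_int (Y v)) (\<lambda>v. of_int (R v) :: real) u v \<longleftrightarrow>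
      overlap X Y R u v" for u v
    unfolding overlap_def of_int_diff[symmetric] of_int_add[symmetric] of_int_power[symmetric]
      of_int_less_iff ..
  have "rat_realization G (\<lambda>v. of_int (X v)) (\<lambda>v. of_int (Y v)) (\<lambda>v. of_int (R v))"
  proof -
    let ?D = "disk (\<lambda>v. of_int (X v)) (\<lambda>v. of_int (Y v)) (\<lambda>v. of_int (R v) :: real)"
    have meet: "?D u \<inter> ?D v \<noteq> {} \<longleftrightarrow> overlap X Y R u v" if "u \<in> pverts G" "v \<in> pverts G" for u v
      using pos that by (subst disks_meet_iff) (auto simp: ov)
    have arcs': "{(u, v). u \<in> pverts G \<and> v \<in> pverts G \<and> u \<noteq> v \<and> ?D u \<inter> ?D v \<noteq> {}} = parcs G"
      unfolding arcs using meet by blast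
    have "intersection_graph (pverts G) ?D = G"
      unfolding intersection_graph_def arcs' by (cases G) simp
    then show ?thesis
      unfolding rat_realization_def realizes_def disk using pos by simp
  qed
  moreover have "(\<Sum>v\<in>pverts G. bitsize (of_int (X v)) + bitsize (of_int (Y v)) + bitsize (of_int (R v)))
      \<le> (\<Sum>v\<in>pverts G. 3 * (b + 3))"
  proof (rule sum_mono)
    fix v assume v: "v \<in> pverts G"
    show "bitsize (of_int (X v)) + bitsize (of_int (Y v)) + bitsize (of_int (R v)) \<le> 3 * (b + 3)"
      using add_mono[OF add_mono[OF bitsize_of_int_le[OF le(1)[OF v]] bitsize_of_int_le[OF le(2)[OF v]]]
        bitsize_of_int_le[OF le(3)[OF v]]] by simp
  qed
  ultimately show ?thesis unfolding sum_constant of_nat_id by blast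
qed

context special_system begin

text \<open>\<open>H + 1\<close> is \<open>(2 * W) ^ (2 * D)\<close> and \<open>W\<close> itself is
  exponential in \<open>D\<close>, so the number of bits grows with \<open>D\<^sup>2\<close>. For
  \<open>3 * n\<close> variables this is \<open>5 ^ (6 * n) = 15625 ^ n\<close>, which is the source
  of the singly exponential bit bound.\<close>

lemma H_bound:
  assumes card_I: "card I = 3 * n" and L_eq: "L = 1352 * n\<^sup>2 + 1"
  shows "H + 1 \<le> 2 ^ (4 * 15625 ^ n * (13 + 2 * n))"
proof -
  define D :: nat where "D = 5 ^ card I"
  have D: "D \<ge> 1" "D\<^sup>2 = 15625 ^ n"
  proof -
    have "D\<^sup>2 = (5 ^ 6) ^ n" unfolding D_def card_I power_mult[symmetric] by (simp add: mult.commute)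
    then show "D\<^sup>2 = 15625 ^ n" by simp
  qed (simp add: D_def)
  have pow: "k + 1 \<le> 2 ^ k" for k :: nat using less_exp[of k] by (simp add: Suc_le_eq)
  have L_le: "L \<le> 2 ^ (11 + 2 * n)"
  proof -
    have "n \<le> 2 ^ n" using pow[of n] by simp
    then have "n\<^sup>2 \<le> (2 ^ n)\<^sup>2" by (rule power_mono) simp
    then have "n\<^sup>2 \<le> 2 ^ (2 * n)" by (simp add: power_mult[symmetric] mult.commute)
    moreover have "(1::nat) \<le> 2 ^ (2 * n)" by simp
    ultimately have "L \<le> 2048 * 2 ^ (2 * n)" unfolding L_eq by linarith
    then show ?thesis by (simp add: power_add)
  qed
  have "W \<le> 2 ^ (2 * D) * (2 ^ (11 + 2 * n)) ^ (2 * D)"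
    unfolding W_def D_def[symmetric] by (intro mult_mono power_mono L_le pow) auto
  also have "\<dots> = 2 ^ (2 * D * (12 + 2 * n))"
    by (simp add: power_add[symmetric] power_mult[symmetric] algebra_simps)
  finally have "2 * W \<le> 2 ^ (2 * D * (12 + 2 * n) + 1)" by simp
  also have "\<dots> \<le> 2 ^ (2 * D * (13 + 2 * n))"
    using D(1) by (intro power_increasing) (auto simp: algebra_simps)
  finally have "(2 * W) ^ (2 * D) \<le> (2 ^ (2 * D * (13 + 2 * n))) ^ (2 * D)"
    by (rule power_mono) simp
  also have "\<dots> = 2 ^ (4 * D\<^sup>2 * (13 + 2 * n))"
    by (simp add: power_mult[symmetric] power2_eq_square algebra_simps)
  finally have "(2 * W) ^ (2 * D) \<le> 2 ^ (4 * D\<^sup>2 * (13 + 2 * n))" .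
  moreover have "(2 * W) ^ (2 * D) \<ge> 1"
    using L unfolding W_def by (simp add: Suc_le_eq)
  ultimately show ?thesis unfolding H_def D_def[symmetric] D(2)[symmetric] by linarith
qed

end

text \<open>\<open>H\<close> depends on \<open>I\<close> and \<open>L\<close> alone, so the zero
  system is enough to apply \<open>H_bound\<close> outside the locale.\<close>

lemma zero_special_system: "finite I \<Longrightarrow> L \<ge> 1 \<Longrightarrow> special_system I L (\<lambda>_ _. 0)"
  using int_poly_const[of 0 L I 3] by (simp add: special_system_def)

section \<open>Small rational realizations\<close>

text \<open>Shrinking all radii slightly preserves the finitely many strict overlaps and pulls
  touching disks apart. All conditions then hold with a positive margin, which a scaling raises to
  1, so that they become closed conditions with integer coefficients.\<close>

lemma strict_realization:
  fixes x y r :: "nat \<Rightarrow> real"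
  assumes fin: "finite V" and "\<forall>v\<in>V. r v > 0"
  shows "\<exists>x' y' r' :: nat \<Rightarrow> real. (\<forall>v\<in>V. r' v \<ge> 1) \<and>
    (\<forall>u\<in>V. \<forall>v\<in>V. (if overlap x y r u v then 1 else -1) *
       ((r' u + r' v)\<^sup>2 - ((x' u - x' v)\<^sup>2 + (y' u - y' v)\<^sup>2)) \<ge> 1)"
proof -
  have pos: "r v > 0" if "v \<in> V" for v using assms(2) that by blast
  define d where "d u v = (x u - x v)\<^sup>2 + (y u - y v)\<^sup>2" for u v
  have "\<forall>\<^sub>F s in at_left 1. \<forall>u\<in>V. \<forall>v\<in>V. overlap x y r u v \<longrightarrow> d u v < (s * (r u + r v))\<^sup>2"
  proof (intro eventually_ball_finite fin ballI)
    fix u v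
    have "((\<lambda>s. (s * (r u + r v))\<^sup>2) \<longlongrightarrow> (1 * (r u + r v))\<^sup>2) (at_left 1)"
      by (intro tendsto_intros)
    then show "\<forall>\<^sub>F s in at_left 1. overlap x y r u v \<longrightarrow> d u v < (s * (r u + r v))\<^sup>2"
      using order_tendstoD(1)[of _ _ _ "d u v"] unfolding overlap_def d_def
      by (cases "overlap x y r u v") (auto simp: overlap_def)
  qed
  moreover have "\<forall>\<^sub>F s in at_left 1. s \<in> {0<..<1::real}"
    by (rule eventually_at_leftI[of 0]) auto
  ultimately have "\<forall>\<^sub>F s in at_left 1. s \<in> {0<..<1::real} \<and>
      (\<forall>u\<in>V. \<forall>v\<in>V. overlap x y r u v \<longrightarrow> d u v < (s * (r u + r v))\<^sup>2)"
    by eventually_elim auto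
  then obtain s where s: "0 < s" "s < 1"
    "\<And>u v. u \<in> V \<Longrightarrow> v \<in> V \<Longrightarrow> overlap x y r u v \<Longrightarrow> d u v < (s * (r u + r v))\<^sup>2"
    using eventually_happens'[OF trivial_limit_at_left_real] by force
  have less: "(s * (r u + r v))\<^sup>2 < d u v" if "u \<in> V" "v \<in> V" "\<not> overlap x y r u v" for u v
  proof -
    have "s * (r u + r v) < 1 * (r u + r v)"
      using s pos that by (intro mult_strict_right_mono) (auto intro: add_pos_pos)
    then have "(s * (r u + r v))\<^sup>2 < (r u + r v)\<^sup>2"
      using s pos[OF that(1)] pos[OF that(2)] by (intro power_strict_mono) auto
    then show ?thesis using that unfolding overlap_def d_def by simp
  qed
  have large: "\<forall>\<^sub>F k in at_top. k\<^sup>2 * m \<ge> 1" if "m > 0" for m :: real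
    using that by real_asymp
  have "\<forall>\<^sub>F k in at_top. \<forall>u\<in>V. \<forall>v\<in>V. k\<^sup>2 * \<bar>d u v - (s * (r u + r v))\<^sup>2\<bar> \<ge> 1"
  proof (intro eventually_ball_finite fin ballI large)
    fix u v assume "u \<in> V" "v \<in> V"
    then show "\<bar>d u v - (s * (r u + r v))\<^sup>2\<bar> > 0" using s(3)[of u v] less[of u v] by fastforce
  qed
  moreover have "\<forall>\<^sub>F k in at_top. \<forall>v\<in>V. k * (s * r v) \<ge> 1"
  proof (intro eventually_ball_finite fin ballI)
    fix v assume "v \<in> V"
    then have "s * r v > 0" using s pos by simp
    then show "\<forall>\<^sub>F k in at_top. k * (s * r v) \<ge> 1" by real_asymp
  qed
  ultimately have "\<forall>\<^sub>F k in at_top. (\<forall>u\<in>V. \<forall>v\<in>V. k\<^sup>2 * \<bar>d u v - (s * (r u + r v))\<^sup>2\<bar> \<ge> 1) \<and>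
     (\<forall>v\<in>V. k * (s * r v) \<ge> 1)"
    by eventually_elim auto
  then obtain k where k: "\<And>u v. u \<in> V \<Longrightarrow> v \<in> V \<Longrightarrow> k\<^sup>2 * \<bar>d u v - (s * (r u + r v))\<^sup>2\<bar> \<ge> 1"
    "\<And>v. v \<in> V \<Longrightarrow> k * (s * r v) \<ge> 1"
    using eventually_happens'[OF trivial_limit_at_top_linorder] by force
  have eq: "(k * x u - k * x v)\<^sup>2 + (k * y u - k * y v)\<^sup>2 = k\<^sup>2 * d u v"
    "(k * (s * r u) + k * (s * r v))\<^sup>2 = k\<^sup>2 * (s * (r u + r v))\<^sup>2" for u v
    by (simp_all add: d_def power2_eq_square algebra_simps)
  show ?thesis
  proof (rule exI[of _ "\<lambda>v. k * x v"], rule exI[of _ "\<lambda>v. k * y v"],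
      rule exI[of _ "\<lambda>v. k * (s * r v)"], intro conjI ballI)
    fix u v assume uv: "u \<in> V" "v \<in> V"
    show "(if overlap x y r u v then 1 else -1) * ((k * (s * r u) + k * (s * r v))\<^sup>2 -
        ((k * x u - k * x v)\<^sup>2 + (k * y u - k * y v)\<^sup>2)) \<ge> 1"
      using k(1)[OF uv] s(3)[OF uv] less[OF uv] unfolding eq
      by (cases "overlap x y r u v") (simp_all add: abs_of_neg abs_of_pos right_diff_distrib)
  next
    fix v assume "v \<in> V"
    then show "k * (s * r v) \<ge> 1" by (rule k(2))
  qed
qed

lemma round_square_bound:
  fixes a M q e :: real
  assumes "\<bar>a\<bar> \<le> 2 * M" "\<bar>e\<bar> \<le> 1" "q \<ge> 0"
  shows "\<bar>(q * a + e)\<^sup>2 - q\<^sup>2 * a\<^sup>2\<bar> \<le> 4 * q * M + 1"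
proof -
  have "(q * a + e)\<^sup>2 - q\<^sup>2 * a\<^sup>2 = 2 * q * a * e + e\<^sup>2"
    by (simp add: power2_eq_square algebra_simps)
  also have "\<bar>\<dots>\<bar> \<le> \<bar>2 * q * a * e\<bar> + \<bar>e\<^sup>2\<bar>" by (rule abs_triangle_ineq)
  also have "\<bar>2 * q * a * e\<bar> \<le> 2 * q * (2 * M) * 1"
    unfolding abs_mult using assms by (intro mult_mono) auto
  also have "\<bar>e\<^sup>2\<bar> \<le> 1" using assms(2) by (simp add: abs_square_le_1)
  finally show ?thesis by simp
qed

lemma round_difference:
  fixes z w q M :: real
  assumes "\<bar>z\<bar> \<le> M" "\<bar>w\<bar> \<le> M" "q \<ge> 0"
  shows "\<bar>(of_int (round (q * z)) - of_int (round (q * w)))\<^sup>2 - q\<^sup>2 * (z - w)\<^sup>2\<bar> \<le> 4 * q * M + 1"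
    and "\<bar>(of_int (round (q * z)) + of_int (round (q * w)))\<^sup>2 - q\<^sup>2 * (z + w)\<^sup>2\<bar> \<le> 4 * q * M + 1"
proof -
  let ?e = "\<lambda>z. of_int (round (q * z)) - q * z"
  have e: "\<bar>?e z\<bar> \<le> 1 / 2" for z using of_int_round_abs_le[of "q * z"] by simp
  have minus: "of_int (round (q * z)) - of_int (round (q * w)) = q * (z - w) + (?e z - ?e w)"
    and plus: "of_int (round (q * z)) + of_int (round (q * w)) = q * (z + w) + (?e z + ?e w)"
    by (simp_all add: algebra_simps)
  have le: "\<bar>?e z - ?e w\<bar> \<le> 1" "\<bar>?e z + ?e w\<bar> \<le> 1" using e[of z] e[of w] by linarith+
  show "\<bar>(of_int (round (q * z)) - of_int (round (q * w)))\<^sup>2 - q\<^sup>2 * (z - w)\<^sup>2\<bar> \<le> 4 * q * M + 1"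
    unfolding minus by (rule round_square_bound) (use assms le in auto)
  show "\<bar>(of_int (round (q * z)) + of_int (round (q * w)))\<^sup>2 - q\<^sup>2 * (z + w)\<^sup>2\<bar> \<le> 4 * q * M + 1"
    unfolding plus by (rule round_square_bound) (use assms le in auto)
qed

lemma small_realization:
  fixes G :: "nat pair_pre_digraph"
  assumes G: "disk_graph G" and n: "card (pverts G) = n" "n > 0"
  shows "\<exists>x y r. rat_realization G x y r \<and>
    (\<Sum>v\<in>pverts G. bitsize (x v) + bitsize (y v) + bitsize (r v)) \<le> 2 ^ (25 * n)"
proof -
  define V where "V = pverts G"
  obtain x y r :: "nat \<Rightarrow> real" where xyr: "finite (pverts G)" "\<And>v. v \<in> pverts G \<Longrightarrow> r v > 0"
    "parcs G = {(u, v). u \<in> pverts G \<and> v \<in> pverts G \<and> u \<noteq> v \<and> overlap x y r u v}"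
    by (rule disk_graph_obtain[OF G]) (rule that)
  note V = xyr(1,2)[folded V_def] and arcs = xyr(3)[folded V_def]
  have card_V: "card V = n" using n unfolding V_def by simp
  define \<sigma> :: "nat \<Rightarrow> nat \<Rightarrow> int" where "\<sigma> u v = (if overlap x y r u v then 1 else -1)" for u v
  obtain x' y' r' :: "nat \<Rightarrow> real" where pos: "\<And>v. v \<in> V \<Longrightarrow> r' v \<ge> 1"
    and sep: "\<And>u v. u \<in> V \<Longrightarrow> v \<in> V \<Longrightarrow>
       \<sigma> u v * ((r' u + r' v)\<^sup>2 - ((x' u - x' v)\<^sup>2 + (y' u - y' v)\<^sup>2)) \<ge> 1"
  proof -
    have "real_of_int (if b then 1 else -1) = (if b then 1 else -1)" for b by simp
    moreover have "\<forall>v\<in>V. r v > 0" using V(2) by blast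
    from strict_realization[OF V(1) this, of x y]
    obtain x' y' r' :: "nat \<Rightarrow> real" where *: "\<forall>v\<in>V. r' v \<ge> 1" "\<forall>u\<in>V. \<forall>v\<in>V. (if overlap x y r u v then 1 else -1) *
       ((r' u + r' v)\<^sup>2 - ((x' u - x' v)\<^sup>2 + (y' u - y' v)\<^sup>2)) \<ge> 1"
      by blast
    ultimately show thesis by (intro that[of r' x' y']) (auto simp: \<sigma>_def)
  qed
  \<comment> \<open>Variables \<open>3 * v\<close>, \<open>3 * v + 1\<close> and
    \<open>3 * v + 2\<close> hold the two coordinates of the center and the radius of
    \<open>v\<close>.\<close>
  define I where "I = (\<lambda>(v, j). 3 * v + j) ` (V \<times> {..<3::nat})"
  have fin_I: "finite I" unfolding I_def using V by auto
  have "inj_on (\<lambda>(v, j). 3 * v + j) (V \<times> {..<3::nat})"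
    by (auto simp: inj_on_def) presburger+
  then have card_I: "card I = 3 * n"
    unfolding I_def by (subst card_image) (auto simp: card_cartesian_product card_V)
  have mem_I: "3 * v \<in> I" "3 * v + 1 \<in> I" "3 * v + 2 \<in> I" if "v \<in> V" for v
    using that unfolding I_def by (force simp: image_iff)+
  define ov where "ov u v z = (z (3 * u + 2) + z (3 * v + 2))\<^sup>2 -
      ((z (3 * u) - z (3 * v))\<^sup>2 + (z (3 * u + 1) - z (3 * v + 1))\<^sup>2)" for u v and z :: "nat \<Rightarrow> real"
  define C where "C = (\<lambda>v z. z (3 * v + 2) - 1) ` V \<union>
     (\<lambda>(u, v) z. \<sigma> u v * ov u v z - 1) ` (V \<times> V)"
  have fin_C: "finite C" unfolding C_def using V by auto
  have "card C \<le> card V + card (V \<times> V)"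
    unfolding C_def by (intro order_trans[OF card_Un_le] add_mono card_image_le) (use V in auto)
  also have "\<dots> = n + n * n" by (simp add: card_cartesian_product card_V)
  also have "\<dots> \<le> 2 * n\<^sup>2" using n(2) by (simp add: power2_eq_square)
  finally have card_C: "card C \<le> 2 * n\<^sup>2" .
  \<comment> \<open>There are at most \<open>2 * n\<^sup>2\<close> constraints. Each has coefficient
    sum at most 13, namely 4 for each of the three squares in \<open>ov\<close> and 1 for the
    constant, and \<open>4 * 2 * 13\<^sup>2 = 1352\<close>.\<close>
  define L where "L = 1352 * n\<^sup>2 + 1"
  have L: "4 * (card C * 13\<^sup>2) + 1 \<le> L" unfolding L_def using card_C by simp
  have var: "int_poly I 1 1 (\<lambda>z. z (3 * v))" "int_poly I 1 1 (\<lambda>z. z (3 * v + 1))"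
    "int_poly I 1 1 (\<lambda>z. z (3 * v + 2))" if "v \<in> V" for v
    by (intro int_poly_var mem_I that)+
  have poly: "int_poly I 2 13 g" if "g \<in> C" for g
    using that unfolding C_def
  proof (elim UnE imageE)
    fix v assume g: "g = (\<lambda>z. z (3 * v + 2) - 1)" and v: "v \<in> V"
    have "int_poly I 1 (1 + 1) (\<lambda>z. z (3 * v + 2) - of_int 1)"
      by (intro int_poly_diff var v int_poly_const) simp
    then show ?thesis unfolding g unfolding of_int_1 by (rule int_poly_mono) simp_all
  next
    fix p assume g: "g = (case p of (u, v) \<Rightarrow> \<lambda>z. \<sigma> u v * ov u v z - 1)" and "p \<in> V \<times> V"
    then obtain u v where p: "p = (u, v)" "u \<in> V" "v \<in> V" by auto
    have sq: "int_poly I 2 4 (\<lambda>z. (f z)\<^sup>2)" if "int_poly I 1 2 f" for f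
    proof -
      have "int_poly I (1 + 1) (2 * 2) (\<lambda>z. f z * f z)" by (intro int_poly_mult that)
      then show ?thesis unfolding power2_eq_square by (rule int_poly_mono) simp_all
    qed
    have diff: "int_poly I 2 4 (\<lambda>z. (f z - g z)\<^sup>2)" "int_poly I 2 4 (\<lambda>z. (f z + g z)\<^sup>2)"
      if "int_poly I 1 1 f" "int_poly I 1 1 g" for f g
      by (rule sq[OF int_poly_diff[OF that, unfolded one_add_one]],
        rule sq[OF int_poly_add[OF that, unfolded one_add_one]])
    have "int_poly I 2 12 (ov u v)"
      using int_poly_diff[OF diff(2)[OF var(3) var(3)]
          int_poly_add[OF diff(1)[OF var(1) var(1)] diff(1)[OF var(2) var(2)]], OF p(2,3) p(2,3) p(2,3)]
      unfolding ov_def by simp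
    then have "int_poly I (0 + 2) (nat \<bar>\<sigma> u v\<bar> * 12) (\<lambda>z. \<sigma> u v * mon {#} z * ov u v z)"
      by (rule int_poly_mult_monom) auto
    then have "int_poly I 2 12 (\<lambda>z. \<sigma> u v * ov u v z)"
      unfolding mon_simps mult_1_right by (rule int_poly_mono) (auto simp: \<sigma>_def)
    from int_poly_diff[OF this int_poly_const[of 1 1]] show ?thesis unfolding g p by simp
  qed
  define z where "z i = (if i mod 3 = 0 then x' (i div 3) else if i mod 3 = 1 then y' (i div 3) else r' (i div 3))" for i
  have z: "z (3 * v) = x' v" "z (3 * v + 1) = y' v" "z (3 * v + 2) = r' v" for v
  proof -
    have "3 * v mod 3 = 0" "3 * v div 3 = v" "(3 * v + 1) mod 3 = 1" "(3 * v + 1) div 3 = v"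
      "(3 * v + 2) mod 3 = 2" "(3 * v + 2) div 3 = v" by presburger+
    then show "z (3 * v) = x' v" "z (3 * v + 1) = y' v" "z (3 * v + 2) = r' v"
      unfolding z_def by (simp_all only:) simp_all
  qed
  have feasible: "g z \<ge> 0" if "g \<in> C" for g
    using that pos sep unfolding C_def ov_def by (auto simp: z[simplified])
  define H where "H = special_system.H I L"
  have "\<exists>w. (\<forall>g\<in>C. g w \<ge> 0) \<and> (\<forall>i\<in>I. \<bar>w i\<bar> \<le> real H + 1)"
    unfolding H_def by (rule bounded_feasible_point[OF fin_I fin_C _ _ L]) (erule poly, erule feasible)
  then obtain w where w0: "\<forall>g\<in>C. g w \<ge> 0" "\<forall>i\<in>I. \<bar>w i\<bar> \<le> real H + 1"
    by (elim exE conjE) (rule that)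
  note w = bspec[OF w0(1)] bspec[OF w0(2)]
  define M where "M = real H + 1"
  \<comment> \<open>Rounding to the grid of width \<open>1 / q\<close> changes each of the three
    scaled squares by at most \<open>4 * q * M + 1\<close>, while the scaled margin is
    \<open>q\<^sup>2\<close>. The factor 16 makes the margin prevail.\<close>
  define q where "q = 16 * M"
  define X Y R where "X v = round (q * w (3 * v))" and "Y v = round (q * w (3 * v + 1))"
    and "R v = round (q * w (3 * v + 2))" for v
  have M: "M \<ge> 1" unfolding M_def by simp
  have q0: "q \<ge> 0" "q \<ge> 16" using M unfolding q_def by auto
  have w_le: "\<bar>w i\<bar> \<le> M" if "i \<in> I" for i using w(2)[OF that] unfolding M_def .
  have margin: "q\<^sup>2 > 3 * (4 * q * M + 1)"
  proof -
    have "M * M \<ge> 1 * 1" using M by (intro mult_mono) auto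
    then show ?thesis unfolding q_def by (simp add: power2_eq_square)
  qed
  have ov_iff: "overlap X Y R u v \<longleftrightarrow> overlap x y r u v" if uv: "u \<in> V" "v \<in> V" for u v
  proof -
    define a where "a = real_of_int ((R u + R v)\<^sup>2 - ((X u - X v)\<^sup>2 + (Y u - Y v)\<^sup>2))"
    have "\<bar>a - q\<^sup>2 * ov u v w\<bar> \<le> 3 * (4 * q * M + 1)"
      using round_difference(2)[OF w_le w_le q0(1), OF mem_I(3)[OF uv(1)] mem_I(3)[OF uv(2)]]
        round_difference(1)[OF w_le w_le q0(1), OF mem_I(1)[OF uv(1)] mem_I(1)[OF uv(2)]]
        round_difference(1)[OF w_le w_le q0(1), OF mem_I(2)[OF uv(1)] mem_I(2)[OF uv(2)]]
      unfolding a_def ov_def X_def Y_def R_def of_int_diff of_int_add of_int_power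
        right_diff_distrib distrib_left by linarith
    moreover have "\<sigma> u v * ov u v w \<ge> 1"
    proof -
      have "(\<lambda>z. \<sigma> u v * ov u v z - 1) \<in> C" unfolding C_def using uv by force
      from w(1)[OF this] show ?thesis by simp
    qed
    then have "q\<^sup>2 * (\<sigma> u v * ov u v w) \<ge> q\<^sup>2 * 1" by (intro mult_left_mono) auto
    ultimately have "0 < a \<longleftrightarrow> overlap x y r u v"
      using margin by (cases "overlap x y r u v") (auto simp: \<sigma>_def)
    then show ?thesis unfolding overlap_def[of X] a_def of_int_0_less_iff by simp
  qed
  have R_pos: "R v > 0" if "v \<in> V" for v
  proof -
    have "(\<lambda>z. z (3 * v + 2) - 1) \<in> C" unfolding C_def using that by blast
    from w(1)[OF this] have "q * w (3 * v + 2) \<ge> 16 * 1" using q0 by (intro mult_mono) auto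
    then show ?thesis using of_int_round_abs_le[of "q * w (3 * v + 2)"] unfolding R_def by linarith
  qed
  define b where "b = 5 + 8 * 15625 ^ n * (13 + 2 * n)"
  have M_le: "18 * M\<^sup>2 \<le> 2 ^ b"
  proof -
    have "special_system.H I L + 1 \<le> 2 ^ (4 * 15625 ^ n * (13 + 2 * n))"
      unfolding L_def
      by (rule special_system.H_bound[OF zero_special_system[OF fin_I] card_I]) simp_all
    then have "real (special_system.H I L + 1) \<le> real (2 ^ (4 * 15625 ^ n * (13 + 2 * n)))"
      unfolding of_nat_le_iff .
    then have "M \<le> 2 ^ (4 * 15625 ^ n * (13 + 2 * n))" unfolding M_def H_def by simp
    then have "M\<^sup>2 \<le> (2 ^ (4 * 15625 ^ n * (13 + 2 * n)))\<^sup>2" using M by (intro power_mono) auto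
    then have "18 * M\<^sup>2 \<le> 32 * (2 ^ (4 * 15625 ^ n * (13 + 2 * n)))\<^sup>2"
      using zero_le_power2[of M] by linarith
    also have "\<dots> = 2 ^ 5 * (2 ^ (4 * 15625 ^ n * (13 + 2 * n)))\<^sup>2" by simp
    also have "\<dots> = 2 ^ b"
      unfolding b_def power_mult[symmetric] power_add[symmetric] by (simp add: algebra_simps)
    finally show ?thesis .
  qed
  have size: "real_of_int \<bar>round (q * w i)\<bar> + 1 \<le> 2 ^ b" if "i \<in> I" for i
  proof -
    have "\<bar>q * w i\<bar> \<le> q * M" unfolding abs_mult using w_le[OF that] q0 by (intro mult_mono) auto
    then have "real_of_int \<bar>round (q * w i)\<bar> + 1 \<le> q * M + 2"
      using of_int_round_abs_le[of "q * w i"] by linarith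
    also have "\<dots> \<le> 18 * M\<^sup>2"
      using mult_mono[OF M M] M unfolding q_def by (simp add: power2_eq_square)
    finally show ?thesis using M_le by simp
  qed
  have "\<exists>x y r. rat_realization G x y r \<and>
      (\<Sum>v\<in>pverts G. bitsize (x v) + bitsize (y v) + bitsize (r v)) \<le> n * (3 * (b + 3))"
    unfolding n(1)[symmetric]
  proof (rule integer_realization[of G R X Y])
    show "parcs G = {(u, v). u \<in> pverts G \<and> v \<in> pverts G \<and> u \<noteq> v \<and> overlap X Y R u v}"
      unfolding xyr(3) using ov_iff unfolding V_def by blast
  qed (use V R_pos size mem_I in \<open>auto simp: V_def X_def Y_def R_def\<close>)
  \<comment> \<open>The rate 25 comes from \<open>384 * 15625 * 2 * 2 = 24000000\<close>, which is
    below \<open>2 ^ 25\<close>.\<close>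
  moreover have "n * (3 * (b + 3)) \<le> 2 ^ (25 * n)"
  proof -
    have one: "(1::nat) \<le> 15625 ^ n" by simp
    have "n \<le> 2 ^ n" using less_exp[of n] by simp
    then have sq: "n * n \<le> 2 ^ n * 2 ^ n" by (intro mult_mono) auto
    have "b + 3 \<le> 8 * 15625 ^ n * (14 + 2 * n)"
      using one unfolding b_def by (simp add: algebra_simps)
    also have "\<dots> \<le> 8 * 15625 ^ n * (16 * n)"
      using n(2) by (intro mult_left_mono) auto
    finally have "n * (3 * (b + 3)) \<le> n * (3 * (8 * 15625 ^ n * (16 * n)))"
      by (intro mult_left_mono) auto
    also have "\<dots> = 384 * 15625 ^ n * (n * n)" by simp
    also have "\<dots> \<le> 384 ^ n * 15625 ^ n * (2 ^ n * 2 ^ n)"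
      using n(2) sq by (intro mult_mono self_le_power) auto
    also have "\<dots> = 24000000 ^ n" by (simp add: power_mult_distrib[symmetric])
    also have "\<dots> \<le> (2 ^ 25) ^ n" by (intro power_mono) auto
    finally show ?thesis by (simp add: power_mult)
  qed
  ultimately show ?thesis by (meson order_trans)
qed

lemma g_DG_graph_le:
  fixes G :: "nat pair_pre_digraph"
  assumes G: "disk_graph G" and n: "card (pverts G) = n" "n > 0"
  shows "g_DG_graph G \<le> 2 ^ (25 * n)"
proof -
  obtain x y r where xyr: "rat_realization G x y r"
    "(\<Sum>v\<in>pverts G. bitsize (x v) + bitsize (y v) + bitsize (r v)) \<le> 2 ^ (25 * n)"
    using small_realization[OF assms] by blast
  have "g_DG_graph G \<le> (\<Sum>v\<in>pverts G. bitsize (x v) + bitsize (y v) + bitsize (r v))"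
    unfolding g_DG_graph_def by (rule Least_le) (use xyr(1) in blast)
  with xyr(2) show ?thesis by simp
qed

text \<open>The construction for the upper bound also proves that rational realizations exist, which
  makes the \<open>LEAST\<close> meaningful.\<close>

lemma g_DG_graph_attained:
  fixes G :: "nat pair_pre_digraph"
  assumes "disk_graph G" "card (pverts G) > 0"
  shows "\<exists>x y r. rat_realization G x y r \<and>
    g_DG_graph G = (\<Sum>v\<in>pverts G. bitsize (x v) + bitsize (y v) + bitsize (r v))"
proof -
  have "\<exists>k x y r. rat_realization G x y r \<and>
      k = (\<Sum>v\<in>pverts G. bitsize (x v) + bitsize (y v) + bitsize (r v))"
    using small_realization[OF assms(1) refl assms(2)] by blast
  then show ?thesis unfolding g_DG_graph_def by (rule LeastI_ex)
qed

section \<open>A Ptolemaic function on disks\<close>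

text \<open>The inversive distance of two circles, a Moebius invariant. For positive radii it is
  below 1 exactly when the open disks meet and equals 1 at external tangency.\<close>

definition inv_dist :: "complex \<times> real \<Rightarrow> complex \<times> real \<Rightarrow> real" where
  "inv_dist D E = ((cmod (fst D - fst E))\<^sup>2 - (snd D)\<^sup>2 - (snd E)\<^sup>2) / (2 * snd D * snd E)"

definition depth :: "complex \<times> real \<Rightarrow> real" where
  "depth D = inv_dist D (0, 1)"

text \<open>For a disk outside the unit disk, \<open>depth\<close> and \<open>spread\<close> are
  cosh and sinh of the same number. They are 1 and 0 when the disk touches the unit disk.\<close>

definition spread :: "complex \<times> real \<Rightarrow> real" where
  "spread D = sqrt ((depth D)\<^sup>2 - 1)"

text \<open>
  The closed form of \<open>gap\<close> is \<open>gap_sq\<close> below. Writing it as a Hermitian product of the pairs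
  \<open>(spin1, spin2)\<close> reduces the Ptolemy inequality to an identity between 2x2 minors.
\<close>

definition spin1 :: "complex \<times> real \<Rightarrow> real" where
  "spin1 D = sqrt (depth D + 1 / snd D + spread D)"

definition spin2 :: "complex \<times> real \<Rightarrow> complex" where
  "spin2 D = fst D / of_real (snd D * spin1 D)"

text \<open>For disks of radii \<open>r\<close>, \<open>r'\<close> touching the unit disk from
  outside at points \<open>p\<close>, \<open>q\<close> this is
  \<open>cmod (p - q) * sqrt ((1 + r) * (1 + r') / (4 * r * r'))\<close>, and its Ptolemy inequality
  is the one behind Casey's theorem. The factors \<open>1 + depth\<close> extend it to disks at any
  depth so that the values 1 and 2 still separate disjoint from meeting disks.\<close>

definition gap :: "complex \<times> real \<Rightarrow> complex \<times> real \<Rightarrow> real" where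
  "gap D E = cmod (of_real (spin1 D * spin1 E) - spin2 D * cnj (spin2 E)) /
     sqrt ((1 + depth D) * (1 + depth E))"

definition exterior_disk :: "complex \<times> real \<Rightarrow> bool" where
  "exterior_disk D \<longleftrightarrow> snd D > 0 \<and> cmod (fst D) \<ge> 1 + snd D"

lemma depth_alt: "depth D = ((cmod (fst D))\<^sup>2 - (snd D)\<^sup>2 - 1) / (2 * snd D)"
  by (simp add: depth_def inv_dist_def)

lemma depth_ge: assumes "exterior_disk D" shows "depth D \<ge> 1"
proof -
  have "(cmod (fst D))\<^sup>2 \<ge> (1 + snd D)\<^sup>2"
    using assms unfolding exterior_disk_def by (intro power_mono) auto
  then show ?thesis
    using assms unfolding exterior_disk_def depth_alt by (simp add: field_simps power2_eq_square)
qed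

lemma depth_gt: assumes "snd D > 0" "cmod (fst D) > 1 + snd D" shows "depth D > 1"
proof -
  have "(cmod (fst D))\<^sup>2 > (1 + snd D)\<^sup>2"
    using assms by (intro power_strict_mono) auto
  then show ?thesis
    using assms unfolding depth_alt by (simp add: field_simps power2_eq_square)
qed

lemma spread_sq: "exterior_disk D \<Longrightarrow> (spread D)\<^sup>2 = (depth D)\<^sup>2 - 1"
  using one_le_power[OF depth_ge, of D 2] unfolding spread_def by simp

lemma spread_nonneg: "exterior_disk D \<Longrightarrow> spread D \<ge> 0"
  using one_le_power[OF depth_ge, of D 2] unfolding spread_def by simp

lemma spread_le: "exterior_disk D \<Longrightarrow> spread D \<le> depth D"
  by (rule power2_le_imp_le) (simp add: spread_sq, rule order_trans[OF zero_le_one depth_ge])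

lemma spin1_sq: "exterior_disk D \<Longrightarrow> (spin1 D)\<^sup>2 = depth D + 1 / snd D + spread D"
  using depth_ge[of D] spread_nonneg[of D] unfolding spin1_def exterior_disk_def by simp

lemma spin1_pos: "exterior_disk D \<Longrightarrow> spin1 D > 0"
  using depth_ge[of D] spread_nonneg[of D] unfolding spin1_def exterior_disk_def
  by (simp add: add_pos_nonneg add_pos_pos)

lemma norm_ratio_sq:
  assumes "exterior_disk D"
  shows "(cmod (fst D) / snd D)\<^sup>2 = (depth D + 1 / snd D)\<^sup>2 - (spread D)\<^sup>2"
proof -
  have "snd D > 0" using assms by (simp add: exterior_disk_def)
  then show ?thesis
    unfolding spread_sq[OF assms] depth_alt by (simp add: field_simps power2_eq_square)
qed

lemma spin2_norm_sq:
  assumes "exterior_disk D"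
  shows "(cmod (spin2 D))\<^sup>2 = depth D + 1 / snd D - spread D"
proof -
  let ?T = "depth D + 1 / snd D" and ?m = "spread D"
  have pos: "snd D > 0" using assms by (simp add: exterior_disk_def)
  have "(cmod (spin2 D))\<^sup>2 = (cmod (fst D) / snd D)\<^sup>2 / (spin1 D)\<^sup>2"
    using pos spin1_pos[OF assms] by (simp add: spin2_def norm_divide norm_mult power_divide power_mult_distrib)
  also have "\<dots> = (?T - ?m) * (?T + ?m) / (?T + ?m)"
    unfolding norm_ratio_sq[OF assms] spin1_sq[OF assms] by (simp add: power2_eq_square algebra_simps)
  also have "\<dots> = ?T - ?m"
    using spin1_sq[OF assms] spin1_pos[OF assms] by (metis less_irrefl nonzero_mult_div_cancel_right zero_less_power)
  finally show ?thesis .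
qed

lemma spin_form_sq:
  assumes D: "exterior_disk D" and E: "exterior_disk E"
  shows "(cmod (of_real (spin1 D * spin1 E) - spin2 D * cnj (spin2 E)))\<^sup>2 =
    2 * (inv_dist D E + depth D * depth E + spread D * spread E)"
proof -
  define T T' where "T = depth D + 1 / snd D" and "T' = depth E + 1 / snd E"
  have pos: "snd D > 0" "snd E > 0" using assms by (simp_all add: exterior_disk_def)
  have sp: "spin1 D > 0" "spin1 E > 0" using assms spin1_pos by auto
  have norm_diff: "(cmod (of_real x - z))\<^sup>2 = x\<^sup>2 + (cmod z)\<^sup>2 - 2 * (x * Re z)" for x z
    unfolding cmod_power2 by (simp add: power2_eq_square algebra_simps)
  have "spin1 D * spin1 E * Re (spin2 D * cnj (spin2 E)) = Re (fst D * cnj (fst E)) / (snd D * snd E)"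
  proof -
    have "spin2 D * cnj (spin2 E) = (fst D * cnj (fst E)) / of_real (snd D * snd E * (spin1 D * spin1 E))"
      by (simp add: spin2_def)
    then have "Re (spin2 D * cnj (spin2 E)) = Re (fst D * cnj (fst E)) / (snd D * snd E * (spin1 D * spin1 E))"
      by (simp only: Re_divide_of_real)
    then show ?thesis using sp by simp
  qed
  then have "(cmod (of_real (spin1 D * spin1 E) - spin2 D * cnj (spin2 E)))\<^sup>2 =
     (T + spread D) * (T' + spread E) + (T - spread D) * (T' - spread E)
       - 2 * (Re (fst D * cnj (fst E)) / (snd D * snd E))"
    unfolding norm_diff power_mult_distrib norm_mult complex_mod_cnj spin1_sq[OF D] spin1_sq[OF E]
      spin2_norm_sq[OF D] spin2_norm_sq[OF E] T_def T'_def by simp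
  also have "\<dots> = 2 * (T * T' - Re (fst D * cnj (fst E)) / (snd D * snd E) + spread D * spread E)"
    by (simp add: algebra_simps)
  also have "T * T' - Re (fst D * cnj (fst E)) / (snd D * snd E) = inv_dist D E + depth D * depth E"
  proof -
    have norm: "(cmod (fst D - fst E))\<^sup>2 = (cmod (fst D))\<^sup>2 + (cmod (fst E))\<^sup>2 - 2 * Re (fst D * cnj (fst E))"
      unfolding cmod_power2 by (simp add: power2_eq_square algebra_simps)
    show ?thesis
      using pos unfolding T_def T'_def inv_dist_def depth_alt norm
      by (simp add: field_simps power2_eq_square)
  qed
  finally show ?thesis by simp
qed

lemma gap_sq:
  assumes "exterior_disk D" "exterior_disk E"
  shows "(gap D E)\<^sup>2 = 2 * (inv_dist D E + depth D * depth E + spread D * spread E) /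
    ((1 + depth D) * (1 + depth E))"
  using spin_form_sq[OF assms] depth_ge[OF assms(1)] depth_ge[OF assms(2)]
  by (simp add: gap_def power_divide)

lemma gap_nonneg: "exterior_disk D \<Longrightarrow> exterior_disk E \<Longrightarrow> gap D E \<ge> 0"
  using depth_ge[of D] depth_ge[of E] by (simp add: gap_def)

lemma inv_dist_commute: "inv_dist D E = inv_dist E D"
  by (simp add: inv_dist_def norm_minus_commute algebra_simps)

lemma gap_commute: "exterior_disk D \<Longrightarrow> exterior_disk E \<Longrightarrow> gap D E = gap E D"
  using gap_sq[of D E] gap_sq[of E D] gap_nonneg[of D E] gap_nonneg[of E D]
  by (metis inv_dist_commute mult.commute power2_eq_imp_eq)

text \<open>For depths \<open>a\<close> and \<open>b\<close> at least 1,
  \<open>(a - 1) * (b - 1) \<ge> 0\<close> means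
  \<open>(1 + a) * (1 + b) \<le> 2 * (1 + a * b)\<close>, so the denominator of
  \<open>gap_sq\<close> is at most its numerator.\<close>

lemma gap_ge_1:
  assumes "exterior_disk D" "exterior_disk E" "inv_dist D E \<ge> 1"
  shows "gap D E \<ge> 1"
proof -
  let ?a = "depth D" and ?b = "depth E"
  have ab: "?a \<ge> 1" "?b \<ge> 1" using assms depth_ge by auto
  have "(?a - 1) * (?b - 1) \<ge> 0" using ab by simp
  moreover have "spread D * spread E \<ge> 0" using assms spread_nonneg by simp
  moreover have "?a * ?b \<ge> 0" using ab by simp
  ultimately have "(1 + ?a) * (1 + ?b) \<le> 2 * (inv_dist D E + ?a * ?b + spread D * spread E)"
    using assms(3) by (simp add: algebra_simps)
  then have "(gap D E)\<^sup>2 \<ge> 1\<^sup>2"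
    unfolding gap_sq[OF assms(1,2)] using ab by (simp add: le_divide_eq)
  then show ?thesis by (rule power2_le_imp_le) (use gap_nonneg assms in auto)
qed

text \<open>As \<open>spread\<close> is at most \<open>depth\<close>, the numerator of
  \<open>gap_sq\<close> is below \<open>2 * (1 + 2 * a * b)\<close> for the depths \<open>a\<close>
  and \<open>b\<close>. For disks touching the unit disk the bound would be 1; the value 2 is the
  price for arbitrary depths.\<close>

lemma gap_less_2:
  assumes "exterior_disk D" "exterior_disk E" "inv_dist D E < 1"
  shows "gap D E < 2"
proof -
  let ?a = "depth D" and ?b = "depth E"
  have ab: "?a \<ge> 1" "?b \<ge> 1" using assms depth_ge by auto
  have "spread D * spread E \<le> ?a * ?b"
    using assms spread_le spread_nonneg ab by (intro mult_mono) auto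
  then have "2 * (inv_dist D E + ?a * ?b + spread D * spread E) < 4 * ((1 + ?a) * (1 + ?b))"
    using assms(3) ab by (simp add: algebra_simps)
  then have "(gap D E)\<^sup>2 < 2\<^sup>2"
    unfolding gap_sq[OF assms(1,2)] using ab by (simp add: divide_less_eq)
  then show ?thesis by (rule power2_less_imp_less) simp
qed

text \<open>This bound is polynomial in inversive distances, so a large gap forces large or finely
  divided coordinates.\<close>

lemma gap_sq_le:
  assumes "exterior_disk D" "exterior_disk E"
  shows "(gap D E)\<^sup>2 \<le> (inv_dist D E + 2 * depth D * depth E) / 2"
proof -
  let ?a = "depth D" and ?b = "depth E" and ?s = "inv_dist D E + depth D * depth E + spread D * spread E"
  have ab: "?a \<ge> 1" "?b \<ge> 1" using assms depth_ge by auto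
  have "0 \<le> 2 * ?s" using spin_form_sq[OF assms, symmetric] by simp
  moreover have "2 * 2 \<le> (1 + ?a) * (1 + ?b)" using ab by (intro mult_mono) auto
  ultimately have "(gap D E)\<^sup>2 \<le> 2 * ?s / 4"
    unfolding gap_sq[OF assms] by (intro divide_left_mono) auto
  also have "spread D * spread E \<le> ?a * ?b"
    using assms spread_le spread_nonneg ab by (intro mult_mono) auto
  finally show ?thesis by simp
qed

text \<open>Disks touching the unit disk at the same point have gap 0, so one of them has to stay
  away from it. Its positive \<open>spread\<close> gives \<open>cmod (spin2 D) < spin1 D\<close>,
  and the two terms of the Hermitian product cannot cancel.\<close>

lemma gap_pos:
  assumes "exterior_disk D" "exterior_disk E" "cmod (fst D) > 1 + snd D"
  shows "gap D E > 0"
proof -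
  have "depth D > 1" using assms by (intro depth_gt) (auto simp: exterior_disk_def)
  then have "spread D > 0"
    unfolding spread_def by (simp add: power2_eq_square less_1_mult)
  then have "(cmod (spin2 D))\<^sup>2 < (spin1 D)\<^sup>2"
    unfolding spin2_norm_sq[OF assms(1)] spin1_sq[OF assms(1)] by simp
  then have 1: "cmod (spin2 D) < spin1 D"
    by (rule power2_less_imp_less) (rule less_imp_le[OF spin1_pos[OF assms(1)]])
  have "(cmod (spin2 E))\<^sup>2 \<le> (spin1 E)\<^sup>2"
    unfolding spin2_norm_sq[OF assms(2)] spin1_sq[OF assms(2)] using spread_nonneg[OF assms(2)] by simp
  then have 2: "cmod (spin2 E) \<le> spin1 E"
    by (rule power2_le_imp_le) (rule less_imp_le[OF spin1_pos[OF assms(2)]])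
  have "cmod (spin2 D * cnj (spin2 E)) \<le> cmod (spin2 D) * spin1 E"
    unfolding norm_mult complex_mod_cnj using 2 by (intro mult_left_mono) auto
  also have "\<dots> < spin1 D * spin1 E"
    using 1 spin1_pos[OF assms(2)] by (rule mult_strict_right_mono)
  also have "\<dots> = cmod (of_real (spin1 D * spin1 E))"
    unfolding norm_of_real using spin1_pos[OF assms(1)] spin1_pos[OF assms(2)] by simp
  finally have "of_real (spin1 D * spin1 E) - spin2 D * cnj (spin2 E) \<noteq> 0" by fastforce
  then show ?thesis using depth_ge[OF assms(1)] depth_ge[OF assms(2)] by (simp add: gap_def)
qed

text \<open>
  The form \<open>\<alpha>\<alpha>' - \<beta> cnj \<beta>'\<close> is Hermitian of signature (1,1), so its 2x2 minors factor through
  the symplectic form \<open>\<alpha>\<beta>' - \<beta>\<alpha>'\<close>, whose modulus it dominates.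
\<close>

lemma gap_ptolemy:
  assumes "exterior_disk A" "exterior_disk B" "exterior_disk C" "exterior_disk D"
  shows "gap A B * gap C D \<le> gap A C * gap B D + gap A D * gap B C"
proof -
  define h where "h P Q = of_real (spin1 P * spin1 Q) - spin2 P * cnj (spin2 Q)" for P Q
  define w where "w P Q = of_real (spin1 P) * spin2 Q - spin2 P * of_real (spin1 Q)" for P Q
  have w_le: "cmod (w P Q) \<le> cmod (h P Q)" if "exterior_disk P" "exterior_disk Q" for P Q
  proof -
    have "(cmod (w P Q))\<^sup>2 = (cmod (h P Q))\<^sup>2 -
        ((spin1 P)\<^sup>2 - (cmod (spin2 P))\<^sup>2) * ((spin1 Q)\<^sup>2 - (cmod (spin2 Q))\<^sup>2)"
      unfolding w_def h_def cmod_power2 by (simp add: power2_eq_square algebra_simps)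
    also have "\<dots> \<le> (cmod (h P Q))\<^sup>2"
      using spread_nonneg that by (simp add: spin1_sq spin2_norm_sq)
    finally show ?thesis by (rule power2_le_imp_le) simp
  qed
  have h_comm: "cmod (h P Q) = cmod (h Q P)" for P Q
  proof -
    have "h Q P = cnj (h P Q)" by (simp add: h_def mult.commute)
    then show ?thesis by simp
  qed
  have "h A B * h C D = h A D * h C B - w A C * cnj (w B D)"
    unfolding h_def w_def by (simp add: algebra_simps)
  then have "cmod (h A B) * cmod (h C D) \<le> cmod (h A D * h C B) + cmod (w A C * cnj (w B D))"
    by (metis norm_mult norm_triangle_ineq4)
  also have "\<dots> \<le> cmod (h A D) * cmod (h B C) + cmod (h A C) * cmod (h B D)"
    unfolding norm_mult complex_mod_cnj h_comm[of C B]
    using w_le assms by (intro add_mono mult_mono) auto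
  finally have *: "cmod (h A B) * cmod (h C D) \<le> cmod (h A C) * cmod (h B D) + cmod (h A D) * cmod (h B C)"
    by simp
  define s where "s P = sqrt (1 + depth P)" for P
  have s: "s P > 0" if "exterior_disk P" for P using depth_ge[OF that] by (simp add: s_def)
  have gap: "gap P Q = cmod (h P Q) / (s P * s Q)" for P Q
    by (simp add: gap_def h_def s_def real_sqrt_mult)
  have "s A * s B * s C * s D \<ge> 0"
    using s assms by (intro mult_nonneg_nonneg less_imp_le) auto
  from divide_right_mono[OF * this] show ?thesis
    unfolding gap by (simp add: add_divide_distrib mult_ac)
qed

section \<open>Forced growth\<close>

text \<open>
  The forced growth only needs the triangle inequality. \<open>d\<close> stands for the gap
  normalised by a reference disk, \<open>b\<close>, \<open>t\<close>, \<open>c\<close>, \<open>y\<close> for the weights of the disks of one level.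
\<close>

lemma weight_copied:
  fixes b b' t c y :: real
  assumes b: "b \<ge> 100" and y: "y \<ge> 4" and pos: "t > 0" "c > 0" "b' > 0"
    and cb: "c * b \<le> 2 * (c * t) + 2 * t + 4 * b' + 2 * b"
    and yb': "y * b' \<le> 2 * (y * c) + 2 * (c * t) + 2 * t + 2 * b'"
    and yb: "y * b \<le> 2 * (y * c) + 2 * (c * t) + 2 * t + 4 * b' + 2 * b"
  shows "t \<ge> b / 100"
proof (rule ccontr)
  assume "\<not> ?thesis"
  then have t: "100 * t < b" by simp
  have ct: "100 * (c * t) \<le> c * b" using mult_left_mono[of "100 * t" b c] t pos by simp
  \<comment> \<open>From \<open>y \<ge> 4\<close> follow \<open>2 \<le> y / 2\<close> and
    \<open>y / 2 \<le> y - 2\<close>, which allows \<open>y\<close> to be divided out: a huge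
    \<open>Y\<close> acts like a disk at infinity.\<close>
  have b'_le: "b' \<le> 4 * c + c * t + t"
  proof -
    have "(y / 2) * b' \<le> (y - 2) * b'" using y pos by (intro mult_right_mono) auto
    also have "\<dots> \<le> 2 * (y * c) + 2 * (c * t) + 2 * t" using yb' by (simp add: algebra_simps)
    also have "\<dots> \<le> 2 * (y * c) + (y / 2) * (c * t) + (y / 2) * t"
    proof -
      have "2 * (c * t) \<le> (y / 2) * (c * t)" by (rule mult_right_mono) (use y pos in auto)
      moreover have "2 * t \<le> (y / 2) * t" by (rule mult_right_mono) (use y pos in auto)
      ultimately show ?thesis by (simp add: mult.assoc)
    qed
    finally have "(y / 2) * b' \<le> (y / 2) * (4 * c + c * t + t)" by (simp add: algebra_simps)
    then show ?thesis using y by (simp add: mult_le_cancel_left)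
  qed
  have cb': "c * b \<ge> 100 * c" using mult_left_mono[of 100 b c] b pos by simp
  \<comment> \<open>With \<open>t\<close> below \<open>b / 100\<close>, all terms in
    \<open>cb\<close> except the one in \<open>b\<close> are absorbed by the left side, so
    \<open>c\<close> is bounded. Then \<open>yb\<close>, divided by \<open>y / 2\<close>, bounds
    \<open>b\<close> by a constant and a small multiple of \<open>t\<close>, against
    \<open>b \<ge> 100\<close>.\<close>
  have "c * b \<le> 3 * b"
    using cb b'_le ct cb' t b by linarith
  then have c: "c \<le> 3" using b by (simp add: mult_le_cancel_right)
  have "(y / 2) * b \<le> (y - 2) * b" using y b by (intro mult_right_mono) auto
  also have "\<dots> \<le> 2 * (y * c) + 2 * (c * t) + 2 * t + 4 * b'" using yb by (simp add: algebra_simps)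
  also have "\<dots> \<le> 2 * (y * c) + 16 * c + 6 * (c * t) + 6 * t" using b'_le by simp
  also have "\<dots> \<le> 2 * (y * c) + 4 * y * c + (3 / 2 * y) * (c * t) + (3 / 2 * y) * t"
  proof -
    have "16 * c \<le> (4 * y) * c" by (rule mult_right_mono) (use y pos in auto)
    moreover have "6 * (c * t) \<le> (3 / 2 * y) * (c * t)" by (rule mult_right_mono) (use y pos in auto)
    moreover have "6 * t \<le> (3 / 2 * y) * t" by (rule mult_right_mono) (use y pos in auto)
    ultimately show ?thesis by linarith
  qed
  finally have "(y / 2) * b \<le> (y / 2) * (12 * c + 3 * (c * t) + 3 * t)" by (simp add: algebra_simps)
  then have "b \<le> 12 * c + 3 * (c * t) + 3 * t" using y by (simp add: mult_le_cancel_left)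
  moreover have "c * t \<le> 3 * t" using c pos by (intro mult_right_mono) auto
  ultimately show False using c t b by linarith
qed

text \<open>The disjoint disks of weights \<open>b\<close> and \<open>t\<close> keep their low
  neighbours about \<open>b * t\<close> apart, and the next disk, of weight \<open>b'\<close>, has
  to bridge this distance by meeting both. With \<open>t\<close> comparable to \<open>b\<close>, its
  weight is of order \<open>b\<^sup>2\<close>.\<close>

lemma weight_squared:
  fixes b b' t :: real
  assumes b: "b \<ge> 1000" and t: "t \<ge> b / 100"
    and bridge: "b * t \<le> 4 * b' + 2 * b + 2 * t"
  shows "b\<^sup>2 \<le> 800 * b'"
proof -
  have "(b - 2) * (b / 100) \<le> (b - 2) * t" using b t by (intro mult_left_mono) auto
  also have "\<dots> \<le> 4 * b' + 2 * b" using bridge by (simp add: algebra_simps)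
  finally have "b * b \<le> 400 * b' + 202 * b" by (simp add: algebra_simps)
  moreover have "404 * b \<le> b * b" using b by (intro mult_right_mono) auto
  ultimately show ?thesis by (simp add: power2_eq_square)
qed

text \<open>In the model, \<open>s\<close> and \<open>t k\<close> are low disks under
  \<open>E\<close>, of weight at most 1. \<open>T k\<close> stands beside \<open>B k\<close>, and
  \<open>C k\<close> covers \<open>B k\<close> like a ceiling up to \<open>Y\<close>; since
  \<open>T k\<close> reaches this ceiling it cannot be small, which is \<open>weight_copied\<close>.
  \<open>B (Suc k)\<close> meets both \<open>s\<close> and \<open>t k\<close>, so it has to span the
  distance between them.\<close>

lemma forced_growth:
  fixes E Y s :: "complex \<times> real" and B T C t :: "nat \<Rightarrow> complex \<times> real"
  assumes ext: "exterior_disk E" "exterior_disk Y" "exterior_disk s"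
      "\<And>k. k \<le> m \<Longrightarrow> exterior_disk (B k)" "\<And>k. k \<le> m \<Longrightarrow> exterior_disk (T k)"
      "\<And>k. k \<le> m \<Longrightarrow> exterior_disk (C k)" "\<And>k. k \<le> m \<Longrightarrow> exterior_disk (t k)"
    and E: "cmod (fst E) > 1 + snd E"
    and low: "inv_dist s E \<ge> 1" "\<And>k. k \<le> m \<Longrightarrow> inv_dist (t k) E \<ge> 1"
    and Bs: "\<And>k. k \<le> m \<Longrightarrow> inv_dist (B k) s < 1"
    and BT: "\<And>k. k \<le> m \<Longrightarrow> inv_dist (B k) (T k) \<ge> 1"
    and Tt: "\<And>k. k \<le> m \<Longrightarrow> inv_dist (T k) (t k) < 1"
    and CB: "\<And>k. k \<le> m \<Longrightarrow> inv_dist (C k) (B k) \<ge> 1"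
    and CT: "\<And>k. k \<le> m \<Longrightarrow> inv_dist (C k) (T k) < 1"
    and CY: "\<And>k. k \<le> m \<Longrightarrow> inv_dist (C k) Y < 1"
    and BY: "\<And>k. k \<le> m \<Longrightarrow> inv_dist (B k) Y \<ge> 1"
    and Bt: "\<And>k. k < m \<Longrightarrow> inv_dist (B (Suc k)) (t k) < 1"
    and YE: "gap Y E \<le> 1 / 4" and BE: "gap (B 0) E \<le> 1 / 1600"
    and k: "k < m"
  shows "gap s (t k) \<ge> 2 ^ 2 ^ k"
proof -
  define w where "w X = 1 / gap X E" for X
  define d where "d X X' = gap X X' * w X * w X'" for X X'
  have e_pos: "gap X E > 0" if "exterior_disk X" for X
    using gap_pos[OF ext(1) that E] gap_commute[OF ext(1) that] by simp
  have w_pos: "w X > 0" if "exterior_disk X" for X using e_pos[OF that] by (simp add: w_def)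
  have tri: "d X Z \<le> d X X' + d X' Z" if "exterior_disk X" "exterior_disk X'" "exterior_disk Z" for X X' Z
  proof -
    have "gap X Z * gap X' E \<le> gap X X' * gap Z E + gap X E * gap X' Z"
      using gap_ptolemy[OF that(1) that(3) that(2) ext(1)] gap_commute[OF that(2,3)] by simp
    then show ?thesis
      using e_pos[OF that(1)] e_pos[OF that(2)] e_pos[OF that(3)]
      unfolding d_def w_def by (simp add: field_simps)
  qed
  have comm: "d X X' = d X' X" if "exterior_disk X" "exterior_disk X'" for X X'
    using gap_commute[OF that] by (simp add: d_def)
  have adj: "d X X' \<le> 2 * (w X * w X')" if "exterior_disk X" "exterior_disk X'" "inv_dist X X' < 1" for X X'
  proof -
    have "gap X X' * (w X * w X') \<le> 2 * (w X * w X')"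
      using gap_less_2[OF that] w_pos[OF that(1)] w_pos[OF that(2)] by (intro mult_right_mono) auto
    then show ?thesis by (simp add: d_def mult.assoc)
  qed
  have far: "d X X' \<ge> w X * w X'" if "exterior_disk X" "exterior_disk X'" "inv_dist X X' \<ge> 1" for X X'
  proof -
    have "1 * (w X * w X') \<le> gap X X' * (w X * w X')"
      using gap_ge_1[OF that] w_pos[OF that(1)] w_pos[OF that(2)] by (intro mult_right_mono) auto
    then show ?thesis by (simp add: d_def mult.assoc)
  qed
  have low_w: "w X \<le> 1" if "exterior_disk X" "inv_dist X E \<ge> 1" for X
    using gap_ge_1[OF that(1) ext(1) that(2)] by (simp add: w_def)
  have low_adj: "d X X' \<le> 2 * w X"
    if "exterior_disk X" "exterior_disk X'" "inv_dist X X' < 1" "inv_dist X' E \<ge> 1" for X X'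
  proof -
    have "w X * w X' \<le> w X * 1"
      using low_w[OF that(2,4)] w_pos[OF that(1)] by (intro mult_left_mono) auto
    then show ?thesis using adj[OF that(1,2,3)] by simp
  qed
  have Y4: "w Y \<ge> 4" using YE e_pos[OF ext(2)] by (simp add: w_def le_divide_eq)
  have st_le: "w (B k) * w (T k) \<le> d s (t k) + 2 * w (B k) + 2 * w (T k)" if "k \<le> m" for k
  proof -
    note x = ext(3) ext(4-7)[OF that]
    have "w (B k) * w (T k) \<le> d (B k) (T k)" using far x BT[OF that] by blast
    also have "\<dots> \<le> d (B k) s + (d s (t k) + d (t k) (T k))"
      using tri[OF x(2) x(1) x(3)] tri[OF x(1) x(5) x(3)] by linarith
    finally show ?thesis
      using low_adj[OF x(2) x(1) Bs[OF that] low(1)] low_adj[OF x(3) x(5) Tt[OF that] low(2)[OF that]]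
        comm[OF x(3,5)] by linarith
  qed
  have step: "w (T k) \<ge> w (B k) / 100 \<and> (w (B k))\<^sup>2 \<le> 800 * w (B (Suc k))"
    if "k < m" and b: "w (B k) \<ge> 1000" for k
  proof -
    have k: "k \<le> m" "Suc k \<le> m" using that by auto
    note x = ext(2,3) ext(4-7)[OF k(1)] ext(4)[OF k(2)]
    note l = low(1) low(2)[OF k(1)]
    have ss: "d (B k) s \<le> 2 * w (B k)" using low_adj x Bs[OF k(1)] l by blast
    have ss': "d (B (Suc k)) s \<le> 2 * w (B (Suc k))" using low_adj x Bs[OF k(2)] l by blast
    have tt: "d (T k) (t k) \<le> 2 * w (T k)" using low_adj x Tt[OF k(1)] l by blast
    have tt': "d (B (Suc k)) (t k) \<le> 2 * w (B (Suc k))" using low_adj x Bt[OF that(1)] l by blast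
    have ct: "d (C k) (T k) \<le> 2 * (w (C k) * w (T k))" using adj x CT[OF k(1)] by blast
    have cy: "d (C k) Y \<le> 2 * (w (C k) * w Y)" using adj x CY[OF k(1)] by blast
    have cb: "w (C k) * w (B k) \<le> d (C k) (B k)" using far x CB[OF k(1)] by blast
    have by1: "w (B k) * w Y \<le> d (B k) Y" using far x BY[OF k(1)] by blast
    have by2: "w (B (Suc k)) * w Y \<le> d (B (Suc k)) Y" using far x BY[OF k(2)] by blast
    \<comment> \<open>Consecutive disks in the chain \<open>B k\<close>, \<open>s\<close>,
      \<open>B (Suc k)\<close>, \<open>t k\<close>, \<open>T k\<close>, \<open>C k\<close>,
      \<open>Y\<close> meet. A step to or from a low disk costs only twice the weight of the other
      disk, whereas the last two steps cost products of weights.\<close>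
    have path1: "d (B (Suc k)) (C k) \<le> d (B (Suc k)) (t k) + d (T k) (t k) + d (C k) (T k)"
      using tri[OF x(7) x(6) x(5)] tri[OF x(6) x(4) x(5)] tri[OF x(7) x(4) x(5)] tri[OF x(7) x(6) x(4)]
        comm[OF x(4) x(6)] comm[OF x(5) x(4)] by linarith
    have path2: "d (B k) (C k) \<le> d (B k) s + d (B (Suc k)) s + d (B (Suc k)) (C k)"
      using tri[OF x(3) x(2) x(7)] tri[OF x(3) x(7) x(5)] comm[OF x(7) x(2)] by linarith
    have "w (T k) \<ge> w (B k) / 100"
    proof (rule weight_copied[where b' = "w (B (Suc k))" and c = "w (C k)" and y = "w Y"])
      show "w (C k) * w (B k) \<le> 2 * (w (C k) * w (T k)) + 2 * w (T k) + 4 * w (B (Suc k)) + 2 * w (B k)"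
        using cb path1 path2 ss ss' tt tt' ct comm[OF x(5) x(3)] by linarith
      show "w Y * w (B (Suc k)) \<le> 2 * (w Y * w (C k)) + 2 * (w (C k) * w (T k)) + 2 * w (T k) + 2 * w (B (Suc k))"
        using by2 path1 tri[OF x(7) x(5) x(1)] tt tt' ct cy by (simp add: mult.commute)
      show "w Y * w (B k) \<le> 2 * (w Y * w (C k)) + 2 * (w (C k) * w (T k)) + 2 * w (T k) + 4 * w (B (Suc k)) + 2 * w (B k)"
        using by1 path1 path2 tri[OF x(3) x(5) x(1)] ss ss' tt tt' ct cy by (simp add: mult.commute)
    qed (use b Y4 w_pos[OF x(4)] w_pos[OF x(5)] w_pos[OF x(7)] in auto)
    moreover have "w (B k) * w (T k) \<le> 4 * w (B (Suc k)) + 2 * w (B k) + 2 * w (T k)"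
      using st_le[OF k(1)] tri[OF x(2) x(7) x(6)] ss' tt' comm[OF x(7) x(2)] by linarith
    ultimately show ?thesis using weight_squared[OF b] by blast
  qed
  \<comment> \<open>The factor 800 reproduces itself under \<open>weight_squared\<close>, since
    \<open>(800 * z)\<^sup>2 = 800 * (800 * z\<^sup>2)\<close>. At \<open>k = 0\<close> it demands
    the weight \<open>800 * 2\<close>, hence the bound \<open>1 / 1600\<close>.\<close>
  have growth: "w (B k) \<ge> 800 * 2 ^ 2 ^ k" if "k \<le> m" for k
    using that
  proof (induction k)
    case 0
    then show ?case using BE e_pos[OF ext(4)[of 0]] by (simp add: w_def le_divide_eq)
  next
    case (Suc k)
    have "(2::real) ^ 1 \<le> 2 ^ 2 ^ k" by (intro power_increasing) auto
    then have b: "w (B k) \<ge> 1000" using Suc by simp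
    have "(800 * 2 ^ 2 ^ k)\<^sup>2 \<le> (w (B k))\<^sup>2" using Suc by (intro power_mono) auto
    also have "\<dots> \<le> 800 * w (B (Suc k))" using step[of k] b Suc by auto
    finally have "800 * (800 * (2 ^ 2 ^ k)\<^sup>2) \<le> 800 * w (B (Suc k))"
      by (simp add: power2_eq_square)
    then show ?case by (simp add: power_mult[symmetric] mult.commute)
  qed
  let ?b = "w (B k)" and ?t = "w (T k)"
  have km: "k \<le> m" using k by simp
  have "(2::real) ^ 1 \<le> 2 ^ 2 ^ k" by (intro power_increasing) auto
  then have b: "?b \<ge> 1000" using growth[OF km] by simp
  then have "(?b - 2) * (?b / 100) \<le> (?b - 2) * ?t" using step[OF k b] by (intro mult_left_mono) auto
  also have "\<dots> \<le> d s (t k) + 2 * ?b" using st_le[OF km] by (simp add: algebra_simps)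
  finally have "?b * ?b \<le> 100 * d s (t k) + 202 * ?b" by (simp add: algebra_simps)
  moreover have "1000 * ?b \<le> ?b * ?b" using b by (intro mult_right_mono) auto
  ultimately have "?b \<le> d s (t k)" using b by linarith
  moreover have "2 ^ 2 ^ k \<le> ?b" using growth[OF km] zero_le_power[of "2::real" "2 ^ k"] by linarith
  moreover have "d s (t k) \<le> gap s (t k)"
  proof -
    have "w s * w (t k) \<le> 1 * 1"
      using low_w[OF ext(3) low(1)] low_w[OF ext(7)[OF km] low(2)[OF km]] w_pos[OF ext(7)[OF km]]
      by (intro mult_mono) auto
    then have "gap s (t k) * (w s * w (t k)) \<le> gap s (t k) * 1"
      using gap_nonneg[OF ext(3) ext(7)[OF km]] by (intro mult_left_mono) auto
    then show ?thesis by (simp add: d_def mult.assoc)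
  qed
  ultimately show ?thesis by linarith
qed

section \<open>Disks with many common neighbours\<close>

lemma inv_dist_less_1_iff:
  assumes "snd D > 0" "snd E > 0"
  shows "inv_dist D E < 1 \<longleftrightarrow> cmod (fst D - fst E) < snd D + snd E"
proof -
  have "inv_dist D E < 1 \<longleftrightarrow> (cmod (fst D - fst E))\<^sup>2 < (snd D + snd E)\<^sup>2"
  proof -
    have pos: "0 < 2 * snd D * snd E" using assms by simp
    show ?thesis unfolding inv_dist_def pos_divide_less_eq[OF pos] power2_sum by auto
  qed
  also have "\<dots> \<longleftrightarrow> cmod (fst D - fst E) < snd D + snd E"
    using assms power_less_imp_less_base[of "cmod (fst D - fst E)" 2 "snd D + snd E"]
      power_strict_mono[of "cmod (fst D - fst E)" "snd D + snd E" 2] by fastforce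
  finally show ?thesis .
qed

lemma fmeasurable_ball: "ball (x :: 'a::euclidean_space) r \<in> fmeasurable lborel"
  using emeasure_bounded_finite[OF bounded_ball] by (intro fmeasurableI) auto

text \<open>Each disk contains a disk of radius \<open>u\<close> whose center is within
  \<open>\<rho> + u\<close> of \<open>p\<close>: move the center towards \<open>p\<close>, as far as
  needed. These small disks are disjoint and lie in the ball of radius
  \<open>\<rho> + 2 * u\<close>, and the areas are compared.\<close>

lemma packing_bound:
  fixes c :: "nat \<Rightarrow> complex"
  assumes rad: "\<And>i. i < N \<Longrightarrow> r i > u" and u: "u > 0" and \<rho>: "\<rho> > 0"
    and meet: "\<And>i. i < N \<Longrightarrow> dist (c i) p < r i + \<rho>"
    and disj: "\<And>i j. i < N \<Longrightarrow> j < N \<Longrightarrow> i \<noteq> j \<Longrightarrow> dist (c i) (c j) \<ge> r i + r j"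
  shows "real N * u\<^sup>2 \<le> (\<rho> + 2 * u)\<^sup>2"
proof -
  have "\<exists>z. dist z (c i) \<le> r i - u \<and> dist z p \<le> \<rho> + u" if i: "i < N" for i
  proof (cases "dist (c i) p \<le> \<rho> + u")
    case True
    then show ?thesis using rad[OF i] by (intro exI[of _ "c i"]) auto
  next
    case False
    define D where "D = dist (c i) p"
    have D: "D > \<rho> + u" using False by (simp add: D_def)
    define z where "z = p + ((\<rho> + u) / D) *\<^sub>R (c i - p)"
    have "dist z p = (\<rho> + u) / D * D"
      using D \<rho> u by (simp add: z_def dist_norm D_def)
    then have 1: "dist z p = \<rho> + u" using D \<rho> u by simp
    have "c i - z = (1 - (\<rho> + u) / D) *\<^sub>R (c i - p)" by (simp add: z_def algebra_simps)
    then have "dist (c i) z = \<bar>1 - (\<rho> + u) / D\<bar> * D" by (simp add: dist_norm D_def)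
    also have "\<dots> = D - (\<rho> + u)" using D \<rho> u by (simp add: field_simps)
    also have "\<dots> \<le> r i - u" using meet[OF i] by (simp add: D_def)
    finally show ?thesis using 1 by (intro exI[of _ z]) (simp add: dist_commute)
  qed
  then have "\<forall>i\<in>{..<N}. \<exists>z. dist z (c i) \<le> r i - u \<and> dist z p \<le> \<rho> + u" by blast
  from bchoice[OF this] obtain z
    where z: "\<And>i. i < N \<Longrightarrow> dist (z i) (c i) \<le> r i - u" "\<And>i. i < N \<Longrightarrow> dist (z i) p \<le> \<rho> + u"
    by blast
  define F where "F i = ball (z i) u" for i
  have sub: "F i \<subseteq> ball (c i) (r i)" if "i < N" for i
  proof
    fix x assume "x \<in> F i"
    then show "x \<in> ball (c i) (r i)"
      using z(1)[OF that] dist_triangle[of "c i" x "z i"] by (simp add: F_def dist_commute)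
  qed
  have "pairwise (\<lambda>i j. disjnt (F i) (F j)) {..<N}"
  proof (rule pairwiseI)
    fix i j assume "i \<in> {..<N}" "j \<in> {..<N}" "i \<noteq> j"
    then have "ball (c i) (r i) \<inter> ball (c j) (r j) = {}"
      by (intro disjoint_ballI disj) auto
    then show "disjnt (F i) (F j)"
      using sub[of i] sub[of j] \<open>i \<in> _\<close> \<open>j \<in> _\<close> unfolding disjnt_def by auto
  qed
  then have "measure lborel (\<Union>i<N. F i) = (\<Sum>i<N. measure lborel (F i))"
    by (intro measure_UNION') (auto simp: F_def fmeasurable_ball)
  moreover have "measure lborel (\<Union>i<N. F i) \<le> measure lborel (ball p (\<rho> + 2 * u))"
  proof (rule measure_mono_fmeasurable)
    show "(\<Union>i<N. F i) \<subseteq> ball p (\<rho> + 2 * u)"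
    proof
      fix x assume "x \<in> (\<Union>i<N. F i)"
      then obtain i where "i < N" "dist (z i) x < u" by (auto simp: F_def)
      then show "x \<in> ball p (\<rho> + 2 * u)"
        using z(2)[of i] dist_triangle[of p x "z i"] by (simp add: dist_commute)
    qed
  qed (auto simp: F_def fmeasurable_ball)
  moreover have ball: "measure lborel (ball y s) = pi * s\<^sup>2" if "s \<ge> 0" for y :: complex and s
    using content_ball[of s y] that by (simp add: unit_ball_vol_2)
  ultimately have "real N * (pi * u\<^sup>2) \<le> pi * (\<rho> + 2 * u)\<^sup>2"
    using u \<rho> by (simp add: F_def)
  then have "pi * (real N * u\<^sup>2) \<le> pi * (\<rho> + 2 * u)\<^sup>2" by (simp add: mult_ac)
  then show ?thesis by (simp add: mult_le_cancel_left)
qed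

text \<open>\<open>q\<close> and \<open>u\<close> are the center and radius of the tiny disk. Scaled
  by its radius, the vector from \<open>q\<close> to the center of each exterior disk is nearly a
  unit vector, and disjointness from the unit disk forces it to be nearly \<open>q\<close>. So the
  depths are close to 1, the inversive distance is at most a little above -1, and the numerator of
  \<open>gap_sq\<close> is small. The bound \<open>1 / 36\<close> absorbs second-order
  terms.\<close>

lemma near_point_gap:
  fixes cE cV q :: complex
  assumes \<eta>: "0 < \<eta>" "\<eta> \<le> 1 / 36" and u: "0 \<le> u" "u \<le> \<eta>" "u \<le> \<eta> * rE" "u \<le> \<eta> * rV"
    and ext: "exterior_disk (cE, rE)" "exterior_disk (cV, rV)"
    and near: "cmod q \<le> 1 + u" "cmod (cE - q) \<le> rE + u" "cmod (cV - q) \<le> rV + u"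
  shows "(gap (cV, rV) (cE, rE))\<^sup>2 \<le> 28 * \<eta>"
proof -
  have point: "depth (c, r) \<le> 1 + 6 * \<eta> \<and> (norm v)\<^sup>2 \<ge> 1 - 2 * \<eta> \<and>
      (norm v)\<^sup>2 \<le> 1 + 2 * (u / r) + (u / r) * \<eta> \<and> (norm (v - q))\<^sup>2 \<le> 12 * \<eta>"
    if ext: "exterior_disk (c, r)" and near': "cmod (c - q) \<le> r + u" and ur: "u \<le> \<eta> * r"
      and v: "c = r *\<^sub>R v + q" for c v r
  proof -
    have r: "r > 0" "cmod c \<ge> 1 + r" using ext by (auto simp: exterior_disk_def)
    define h where "h = u / r"
    have h: "0 \<le> h" "h \<le> \<eta>" "u = h * r" using r u(1) ur by (auto simp: h_def field_simps)
    have hh: "h * h \<le> h * \<eta>" "h * \<eta> \<le> \<eta> / 36" "u * h \<le> \<eta> / 36" "u * u \<le> \<eta> / 36" "h * h \<le> \<eta> / 36"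
    proof -
      show "h * h \<le> h * \<eta>" using h by (intro mult_left_mono) auto
      have "x * y \<le> \<eta> * (1 / 36)" if "0 \<le> x" "x \<le> \<eta>" "0 \<le> y" "y \<le> \<eta>" for x y
        using that \<eta> by (intro mult_mono) auto
      from this[of h \<eta>] this[of u h] this[of u u] this[of h h] h u \<eta>
      show "h * \<eta> \<le> \<eta> / 36" "u * h \<le> \<eta> / 36" "u * u \<le> \<eta> / 36" "h * h \<le> \<eta> / 36" by auto
    qed
    have cq: "cmod (c - q) = r * norm v" using r by (simp add: v)
    have v_le: "norm v \<le> 1 + h" using near' r unfolding cq h_def by (simp add: field_simps)
    have "1 + r \<le> r * norm v + (1 + u)"
      using norm_triangle_ineq2[of c q] r(2) near(1) cq norm_triangle_ineq[of "c - q" q] by simp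
    then have "r * (1 - h) \<le> r * norm v" using h(3) by (simp add: algebra_simps)
    then have v_ge: "norm v \<ge> 1 - h" using r by simp
    have v_sq_le: "(norm v)\<^sup>2 \<le> (1 + h)\<^sup>2" using v_le by (intro power_mono) auto
    have v_sq_ge: "(norm v)\<^sup>2 \<ge> (1 - h)\<^sup>2" using v_ge h \<eta> by (intro power_mono) auto
    have q_sq: "(cmod q)\<^sup>2 \<le> (1 + u)\<^sup>2" using near(1) by (intro power_mono) auto
    have 1: "depth (c, r) \<le> 1 + 6 * \<eta>"
    proof -
      have "cmod c \<le> r + 1 + 2 * u"
        using norm_triangle_ineq[of "c - q" q] near(1) near' by simp
      then have "(cmod c)\<^sup>2 \<le> (r + 1 + 2 * u)\<^sup>2" by (intro power_mono) auto
      then have "depth (c, r) \<le> ((r + 1 + 2 * u)\<^sup>2 - r\<^sup>2 - 1) / (2 * r)"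
        using r unfolding depth_alt fst_conv snd_conv by (intro divide_right_mono) auto
      also have "\<dots> = 1 + 2 * u + 2 * h + 2 * (u * h)"
        using r by (simp add: h_def power2_eq_square field_simps)
      finally show ?thesis using u h hh \<eta> by linarith
    qed
    have 2: "(norm v)\<^sup>2 \<ge> 1 - 2 * \<eta>"
    proof -
      have "1 - 2 * h \<le> (1 - h)\<^sup>2" by (simp add: power2_eq_square algebra_simps)
      then show ?thesis using v_sq_ge h by linarith
    qed
    have 3: "(norm v)\<^sup>2 \<le> 1 + 2 * (u / r) + (u / r) * \<eta>"
      using v_sq_le hh(1) unfolding h_def[symmetric] by (simp add: power2_eq_square algebra_simps)
    \<comment> \<open>Expanding \<open>cmod c \<ge> 1 + r\<close> bounds
      \<open>v \<bullet> q\<close> from below. In the resulting estimate the terms in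
      \<open>r\<close> and \<open>1 / r\<close> cancel, so the bound is uniform in the
      radius.\<close>
    have 4: "(norm (v - q))\<^sup>2 \<le> 12 * \<eta>"
    proof -
      have "(1 + r)\<^sup>2 \<le> (cmod c)\<^sup>2" using r by (intro power_mono) auto
      also have "\<dots> = r\<^sup>2 * (norm v)\<^sup>2 + (norm q)\<^sup>2 + 2 * r * (v \<bullet> q)"
        unfolding v power2_norm_eq_inner by (simp add: inner_add inner_commute power2_eq_square algebra_simps)
      finally have "(1 + r)\<^sup>2 / r \<le> (r\<^sup>2 * (norm v)\<^sup>2 + (norm q)\<^sup>2 + 2 * r * (v \<bullet> q)) / r"
        using r by (intro divide_right_mono) auto
      then have "2 * (v \<bullet> q) \<ge> (1 + r)\<^sup>2 / r - r * (norm v)\<^sup>2 - (norm q)\<^sup>2 / r"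
        using r by (simp add: add_divide_distrib power2_eq_square)
      moreover have "(norm (v - q))\<^sup>2 = (norm v)\<^sup>2 + (norm q)\<^sup>2 - 2 * (v \<bullet> q)"
        unfolding power2_norm_eq_inner by (simp add: inner_diff inner_commute)
      ultimately have "(norm (v - q))\<^sup>2 \<le> (1 + r) * (norm v)\<^sup>2 + (1 + 1 / r) * (norm q)\<^sup>2 - (1 + r)\<^sup>2 / r"
        by (simp add: algebra_simps)
      also have "\<dots> \<le> (1 + r) * (1 + h)\<^sup>2 + (1 + 1 / r) * (1 + u)\<^sup>2 - (1 + r)\<^sup>2 / r"
        using v_sq_le q_sq r by (intro add_mono diff_mono mult_left_mono) auto
      also have "\<dots> = 4 * h + 4 * u + h * h + 2 * (u * h) + u * u"
        using r by (simp add: h_def power2_eq_square field_simps)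
      finally show ?thesis using u h hh \<eta> by linarith
    qed
    from 1 2 3 4 show ?thesis by blast
  qed
  have rE: "rE > 0" and rV: "rV > 0" using ext by (auto simp: exterior_disk_def)
  define vE vV where "vE = (cE - q) /\<^sub>R rE" and "vV = (cV - q) /\<^sub>R rV"
  have cE: "cE = rE *\<^sub>R vE + q" and cV: "cV = rV *\<^sub>R vV + q"
    using rE rV by (auto simp: vE_def vV_def)
  note E = point[OF ext(1) near(2) u(3) cE] and V = point[OF ext(2) near(3) u(4) cV]
  have "(norm (vV - vE))\<^sup>2 \<le> 2 * (norm (vV - q))\<^sup>2 + 2 * (norm (vE - q))\<^sup>2"
  proof -
    have "(norm (a - b))\<^sup>2 + (norm (a + b))\<^sup>2 = 2 * (norm a)\<^sup>2 + 2 * (norm b)\<^sup>2" for a b :: complex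
      unfolding power2_norm_eq_inner by (simp add: inner_diff inner_add inner_commute)
    from this[of "vV - q" "vE - q"]
    have "(norm (vV - vE))\<^sup>2 + (norm ((vV - q) + (vE - q)))\<^sup>2 = 2 * (norm (vV - q))\<^sup>2 + 2 * (norm (vE - q))\<^sup>2"
      by simp
    then show ?thesis using zero_le_power2[of "norm ((vV - q) + (vE - q))"] by linarith
  qed
  moreover have "(norm (vV - vE))\<^sup>2 = (norm vV)\<^sup>2 + (norm vE)\<^sup>2 - 2 * (vV \<bullet> vE)"
    unfolding power2_norm_eq_inner by (simp add: inner_diff inner_commute)
  ultimately have inner: "vV \<bullet> vE \<ge> 1 - 26 * \<eta>" using E V by linarith
  have "cmod (cV - cE) = norm (rV *\<^sub>R vV - rE *\<^sub>R vE)" by (simp add: cE cV)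
  then have "(cmod (cV - cE))\<^sup>2 = (norm (rV *\<^sub>R vV - rE *\<^sub>R vE))\<^sup>2" by simp
  also have "\<dots> = rV\<^sup>2 * (norm vV)\<^sup>2 + rE\<^sup>2 * (norm vE)\<^sup>2 - 2 * rV * rE * (vV \<bullet> vE)"
    unfolding power2_norm_eq_inner by (simp add: inner_diff inner_commute power2_eq_square algebra_simps)
  finally have norm_eq: "(cmod (cV - cE))\<^sup>2 =
      rV\<^sup>2 * (norm vV)\<^sup>2 + rE\<^sup>2 * (norm vE)\<^sup>2 - 2 * rV * rE * (vV \<bullet> vE)" .
  \<comment> \<open>The ratio of the radii is unbounded, but it occurs only with a factor
    \<open>(norm v)\<^sup>2 - 1\<close>. That factor is at most of order \<open>u\<close> over the
    radius in the numerator, so the product stays of order \<open>\<eta>\<close>.\<close>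
  have inv: "inv_dist (cV, rV) (cE, rE) =
      (rV / rE) * (((norm vV)\<^sup>2 - 1) / 2) + (rE / rV) * (((norm vE)\<^sup>2 - 1) / 2) - vV \<bullet> vE"
    using rE rV unfolding inv_dist_def fst_conv snd_conv norm_eq
    by (simp add: field_simps power2_eq_square)
  have part: "(r / r') * (((norm v)\<^sup>2 - 1) / 2) \<le> 3 / 2 * \<eta>"
    if "(norm v)\<^sup>2 \<le> 1 + 2 * (u / r) + (u / r) * \<eta>" "r > 0" "r' > 0" "u \<le> \<eta> * r'" for r r' and v :: complex
  proof -
    have "(r / r') * (((norm v)\<^sup>2 - 1) / 2) \<le> (r / r') * ((2 * (u / r) + (u / r) * \<eta>) / 2)"
      using that by (intro mult_left_mono divide_right_mono) auto
    also have "\<dots> = (u / r') * (1 + \<eta> / 2)" using that by (simp add: field_simps)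
    also have "\<dots> \<le> \<eta> * (3 / 2)"
      using that u \<eta> by (intro mult_mono) (auto simp: field_simps)
    finally show ?thesis by simp
  qed
  have i1: "inv_dist (cV, rV) (cE, rE) \<le> 29 * \<eta> - 1"
    using part[of vV rV rE] part[of vE rE rV] E V rE rV u inner unfolding inv by linarith
  have sq: "(1 + 6 * \<eta>)\<^sup>2 \<le> 1 + 13 * \<eta>"
    using \<eta> by (simp add: power2_eq_square algebra_simps)
  have "depth (cV, rV) * depth (cE, rE) \<le> (1 + 6 * \<eta>) * (1 + 6 * \<eta>)"
    using E V depth_ge[OF ext(1)] depth_ge[OF ext(2)] \<eta> by (intro mult_mono) auto
  then have i2: "depth (cV, rV) * depth (cE, rE) \<le> 1 + 13 * \<eta>"
    using sq by (simp add: power2_eq_square)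
  have i3: "spread (cV, rV) * spread (cE, rE) \<le> 13 * \<eta>"
  proof -
    have le: "(spread D)\<^sup>2 \<le> 13 * \<eta>" if "exterior_disk D" "depth D \<le> 1 + 6 * \<eta>" for D
    proof -
      have "(depth D)\<^sup>2 \<le> (1 + 6 * \<eta>)\<^sup>2" using that depth_ge[OF that(1)] by (intro power_mono) auto
      then show ?thesis unfolding spread_sq[OF that(1)] using sq by linarith
    qed
    have "2 * (spread (cV, rV) * spread (cE, rE)) \<le> (spread (cV, rV))\<^sup>2 + (spread (cE, rE))\<^sup>2"
      using sum_squares_bound[of "spread (cV, rV)" "spread (cE, rE)"] by simp
    then show ?thesis using le[OF ext(1)] le[OF ext(2)] E V by linarith
  qed
  have num: "2 * (inv_dist (cV, rV) (cE, rE) + depth (cV, rV) * depth (cE, rE) +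
      spread (cV, rV) * spread (cE, rE)) \<le> 110 * \<eta>"
    using add_mono[OF add_mono[OF i1 i2] i3] by simp
  have den: "(1 + depth (cV, rV)) * (1 + depth (cE, rE)) \<ge> 2 * 2"
    using depth_ge[OF ext(1)] depth_ge[OF ext(2)] by (intro mult_mono) auto
  have "(gap (cV, rV) (cE, rE))\<^sup>2 \<le> 110 * \<eta> / ((1 + depth (cV, rV)) * (1 + depth (cE, rE)))"
    unfolding gap_sq[OF ext(2,1)] using num den by (intro divide_right_mono) auto
  also have "\<dots> \<le> 110 * \<eta> / (2 * 2)"
    using den \<eta> by (intro divide_left_mono) auto
  finally show ?thesis using \<eta> by simp
qed

text \<open>
  Among sufficiently many disjoint disks that meet three disks, one is tiny compared with all
  three, so that the three pass close to a common point. Two of them being disjoint from the third,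
  they are nearly tangent to it there, on the same side.
\<close>

definition common_neighbours_bound :: "nat \<Rightarrow> real \<Rightarrow> bool" where
  "common_neighbours_bound N \<epsilon> \<longleftrightarrow> (\<forall>E V X. exterior_disk E \<and> exterior_disk V \<and>
    (\<forall>i<N. snd (X i) > 0 \<and> inv_dist (X i) (0, 1) < 1 \<and> inv_dist (X i) E < 1 \<and> inv_dist (X i) V < 1) \<and>
    (\<forall>i<N. \<forall>j<N. i \<noteq> j \<longrightarrow> inv_dist (X i) (X j) \<ge> 1) \<longrightarrow> gap V E \<le> \<epsilon>)"

lemma common_neighbours_bound_exists:
  assumes "\<epsilon> > 0"
  shows "\<exists>N. common_neighbours_bound N \<epsilon>"
proof -
  define \<eta> where "\<eta> = min (1 / 36) (\<epsilon>\<^sup>2 / 28)"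
  have \<eta>: "0 < \<eta>" "\<eta> \<le> 1 / 36" "28 * \<eta> \<le> \<epsilon>\<^sup>2" using assms by (auto simp: \<eta>_def min_def)
  obtain N :: nat where N: "real N * \<eta>\<^sup>2 > (1 + 2 * \<eta>)\<^sup>2"
    using reals_Archimedean3[of "\<eta>\<^sup>2"] \<eta> by auto
  show ?thesis unfolding common_neighbours_bound_def
  proof (intro exI[of _ N] allI impI, elim conjE)
    fix E V :: "complex \<times> real" and X :: "nat \<Rightarrow> complex \<times> real"
    assume ext: "exterior_disk E" "exterior_disk V"
      and X: "\<forall>i<N. snd (X i) > 0 \<and> inv_dist (X i) (0, 1) < 1 \<and> inv_dist (X i) E < 1 \<and> inv_dist (X i) V < 1"
      and disj: "\<forall>i<N. \<forall>j<N. i \<noteq> j \<longrightarrow> inv_dist (X i) (X j) \<ge> 1"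
    have pos: "snd E > 0" "snd V > 0" using ext by (auto simp: exterior_disk_def)
    have meet: "cmod (fst (X i)) < snd (X i) + 1" "cmod (fst (X i) - fst E) < snd (X i) + snd E"
      "cmod (fst (X i) - fst V) < snd (X i) + snd V" if "i < N" for i
      using X that inv_dist_less_1_iff[of "X i" "(0, 1)"] inv_dist_less_1_iff[of "X i" E]
        inv_dist_less_1_iff[of "X i" V] pos by auto
    have apart: "dist (fst (X i)) (fst (X j)) \<ge> snd (X i) + snd (X j)" if "i < N" "j < N" "i \<noteq> j" for i j
      using X disj that inv_dist_less_1_iff[of "X i" "X j"] by (force simp: dist_norm)
    \<comment> \<open>The packing takes place around the smallest of the three disks, the unit disk
      included. Thus the scale \<open>\<rho>\<close> cancels, and \<open>N\<close> depends on
      \<open>\<eta>\<close> alone.\<close>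
    define \<rho> where "\<rho> = min 1 (min (snd E) (snd V))"
    have \<rho>: "\<rho> > 0" "\<rho> \<le> 1" "\<rho> \<le> snd E" "\<rho> \<le> snd V" using pos by (auto simp: \<rho>_def)
    have "\<exists>i<N. snd (X i) \<le> \<eta> * \<rho>"
    proof (rule ccontr)
      assume "\<not> ?thesis"
      then have big: "snd (X i) > \<eta> * \<rho>" if "i < N" for i using that by force
      obtain p where p: "\<And>i. i < N \<Longrightarrow> dist (fst (X i)) p < snd (X i) + \<rho>"
      proof -
        consider "\<rho> = 1" | "\<rho> = snd E" | "\<rho> = snd V" unfolding \<rho>_def by linarith
        then show thesis
          using that[of 0] that[of "fst E"] that[of "fst V"] meet by cases (auto simp: dist_norm)
      qed
      have "real N * (\<eta> * \<rho>)\<^sup>2 \<le> (\<rho> + 2 * (\<eta> * \<rho>))\<^sup>2"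
        by (rule packing_bound[where c = "\<lambda>i. fst (X i)" and r = "\<lambda>i. snd (X i)" and p = p])
          (use big p apart \<eta> \<rho> in auto)
      then have "\<rho>\<^sup>2 * (real N * \<eta>\<^sup>2) \<le> \<rho>\<^sup>2 * (1 + 2 * \<eta>)\<^sup>2"
        by (simp add: power2_eq_square algebra_simps)
      then show False using N \<rho> by (simp add: mult_le_cancel_left)
    qed
    then obtain i where i: "i < N" "snd (X i) \<le> \<eta> * \<rho>" by blast
    define u where "u = snd (X i)"
    have u: "u \<ge> 0" "u \<le> \<eta>" "u \<le> \<eta> * snd E" "u \<le> \<eta> * snd V"
    proof -
      show "u \<ge> 0" using X i unfolding u_def by (auto intro: less_imp_le)
      have "\<eta> * \<rho> \<le> \<eta> * 1" "\<eta> * \<rho> \<le> \<eta> * snd E" "\<eta> * \<rho> \<le> \<eta> * snd V"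
        using \<rho> \<eta> by (intro mult_left_mono; simp)+
      then show "u \<le> \<eta>" "u \<le> \<eta> * snd E" "u \<le> \<eta> * snd V" using i(2) unfolding u_def by auto
    qed
    have "(gap (fst V, snd V) (fst E, snd E))\<^sup>2 \<le> 28 * \<eta>"
      by (rule near_point_gap[where q = "fst (X i)" and u = u])
        (use \<eta> u ext meet[OF i(1)] in \<open>auto simp: u_def norm_minus_commute\<close>)
    then have "(gap V E)\<^sup>2 \<le> \<epsilon>\<^sup>2" using \<eta>(3) by simp
    then show "gap V E \<le> \<epsilon>" by (rule power2_le_imp_le) (use assms in simp)
  qed
qed

section \<open>A configuration with the forcing pattern\<close>

text \<open>The radius of \<open>B\<close> at each level. A disk of radius \<open>R'\<close> resting
  on the line at 0 meets the low disk \<open>t\<close> at abscissa \<open>4 * R\<close> if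
  \<open>16 * R\<^sup>2 < 2 * R'\<close>, which \<open>9 * R\<^sup>2\<close> satisfies. The initial
  value is large enough for the first \<open>B\<close> to meet all \<open>N\<close> unit disks,
  spaced by 3.\<close>

primrec tower :: "nat \<Rightarrow> nat \<Rightarrow> real" where
  "tower N 0 = 3 * (real N)\<^sup>2 + 1"
| "tower N (Suc k) = 9 * (tower N k)\<^sup>2"

lemma tower_ge_1: "tower N k \<ge> 1"
proof (induction k)
  case (Suc k)
  from one_le_power[OF this, of 2] show ?case by simp
qed simp

lemma tower_mono: "k \<le> m \<Longrightarrow> tower N k \<le> tower N m"
proof (rule lift_Suc_mono_le[of "tower N"])
  fix k
  have "1 * tower N k \<le> (9 * tower N k) * tower N k"
    using tower_ge_1[of N k] by (intro mult_right_mono) auto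
  then show "tower N k \<le> tower N (Suc k)" by (simp add: power2_eq_square)
qed

text \<open>The columns of common neighbours extend to abscissas below
  \<open>3 * (2 * tower N m) * N\<close>. At this radius the huge circles deviate there from their
  tangent lines by no more than the column disks reach across those lines.\<close>

definition far_radius :: "nat \<Rightarrow> nat \<Rightarrow> real" where
  "far_radius N m = 18 * (2 * tower N m) * (real N + 1)\<^sup>2"

text \<open>
  The disk 0 plays the role of \<open>L\<close>, and 1, 2, 3 those of \<open>E\<close>, \<open>Y\<close>, \<open>s\<close> in \<open>forced_growth\<close>; 0, 1, 2
  have huge radius and stand for the half-planes \<open>y < 0\<close>, \<open>y > 1\<close> and \<open>y > 2 * tower N m\<close>. Then come
  \<open>N\<close> common neighbours of 0, 1, 2 and \<open>N\<close> common neighbours of 0, 1 and the first \<open>B\<close>. From index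
  \<open>4 + 2 * N\<close> on, there are four disks \<open>B\<close>, \<open>T\<close>, \<open>C\<close>, \<open>t\<close> per level.
\<close>

definition config :: "nat \<Rightarrow> nat \<Rightarrow> nat \<Rightarrow> real \<times> real \<times> real" where
  "config N m i = (let H = 2 * tower N m; \<Lambda> = far_radius N m; j = i - (4 + 2 * N); R = tower N (j div 4) in
     if i = 0 then (0, - \<Lambda>, \<Lambda>) else if i = 1 then (0, 1 + \<Lambda>, \<Lambda>)
     else if i = 2 then (0, H + \<Lambda>, \<Lambda>) else if i = 3 then (0, 1 / 2, 1 / 2)
     else if i < 4 + N then (3 * H * real (i - 4), H / 2, H)
     else if i < 4 + 2 * N then (3 * real (i - (4 + N)), 1 / 2, 1)
     else if j mod 4 = 0 then (0, R, R) else if j mod 4 = 1 then (4 * R, 4 * R, 4 * R)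
     else if j mod 4 = 2 then (0, 2 * R + \<Lambda>, \<Lambda>) else (4 * R, 1 / 2, 1 / 2))"

definition cfg_x :: "nat \<Rightarrow> nat \<Rightarrow> nat \<Rightarrow> real" where "cfg_x N m i = fst (config N m i)"
definition cfg_y :: "nat \<Rightarrow> nat \<Rightarrow> nat \<Rightarrow> real" where "cfg_y N m i = fst (snd (config N m i))"
definition cfg_r :: "nat \<Rightarrow> nat \<Rightarrow> nat \<Rightarrow> real" where "cfg_r N m i = snd (snd (config N m i))"

abbreviation cfg_overlap :: "nat \<Rightarrow> nat \<Rightarrow> nat \<Rightarrow> nat \<Rightarrow> bool" where
  "cfg_overlap N m \<equiv> overlap (cfg_x N m) (cfg_y N m) (cfg_r N m)"

definition level :: "nat \<Rightarrow> nat \<Rightarrow> nat \<Rightarrow> nat" where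
  "level N k j = 4 + 2 * N + (4 * k + j)"

lemma config_special:
  "config N m 0 = (0, - far_radius N m, far_radius N m)"
  "config N m 1 = (0, 1 + far_radius N m, far_radius N m)"
  "config N m 2 = (0, 2 * tower N m + far_radius N m, far_radius N m)"
  "config N m 3 = (0, 1 / 2, 1 / 2)"
  by (simp_all add: config_def Let_def)

lemma config_column:
  "i < N \<Longrightarrow> config N m (4 + i) = (3 * (2 * tower N m) * real i, tower N m, 2 * tower N m)"
  "i < N \<Longrightarrow> config N m (4 + N + i) = (3 * real i, 1 / 2, 1)"
  by (simp_all add: config_def Let_def)

lemma config_level:
  "config N m (level N k 0) = (0, tower N k, tower N k)"
  "config N m (level N k 1) = (4 * tower N k, 4 * tower N k, 4 * tower N k)"
  "config N m (level N k 2) = (0, 2 * tower N k + far_radius N m, far_radius N m)"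
  "config N m (level N k 3) = (4 * tower N k, 1 / 2, 1 / 2)"
proof -
  have "config N m (level N k j) =
    (if j = 0 then (0, tower N k, tower N k) else if j = 1 then (4 * tower N k, 4 * tower N k, 4 * tower N k)
     else if j = 2 then (0, 2 * tower N k + far_radius N m, far_radius N m)
     else (4 * tower N k, 1 / 2, 1 / 2))" if "j < 4" for j
  proof -
    define d where "d = 4 * k + j"
    have "d div 4 = k" "d mod 4 = j" using that by (simp_all add: d_def)
    then show ?thesis unfolding config_def Let_def level_def diff_add_inverse d_def[symmetric]
      using that by auto
  qed
  from this[of 0] this[of 1] this[of 2] this[of 3]
  show "config N m (level N k 0) = (0, tower N k, tower N k)"
    "config N m (level N k 1) = (4 * tower N k, 4 * tower N k, 4 * tower N k)"
    "config N m (level N k 2) = (0, 2 * tower N k + far_radius N m, far_radius N m)"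
    "config N m (level N k 3) = (4 * tower N k, 1 / 2, 1 / 2)" by simp_all
qed

lemma far_radius:
  shows "tower N m \<le> far_radius N m" "9 * (2 * tower N m) * (real i)\<^sup>2 \<le> far_radius N m \<or> i > N"
    "9 * (real i)\<^sup>2 \<le> far_radius N m \<or> i > N" "1 \<le> far_radius N m"
proof -
  have t: "tower N m \<ge> 1" by (rule tower_ge_1)
  have N: "(real N + 1)\<^sup>2 \<ge> 1" by (rule one_le_power) simp
  have le: "tower N m * 1 \<le> tower N m * (real N + 1)\<^sup>2" using t N by (intro mult_left_mono) auto
  then show 1: "tower N m \<le> far_radius N m" unfolding far_radius_def using t by linarith
  with t show "1 \<le> far_radius N m" by simp
  have "9 * (2 * tower N m) * (real i)\<^sup>2 \<le> far_radius N m" if "i \<le> N"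
  proof -
    have "(real i)\<^sup>2 \<le> (real N + 1)\<^sup>2" using that by (intro power_mono) auto
    then have "tower N m * (real i)\<^sup>2 \<le> tower N m * (real N + 1)\<^sup>2" using t by (intro mult_left_mono) auto
    moreover have "0 \<le> tower N m * (real N + 1)\<^sup>2" using t by simp
    ultimately show ?thesis unfolding far_radius_def by simp
  qed
  then show 2: "9 * (2 * tower N m) * (real i)\<^sup>2 \<le> far_radius N m \<or> i > N" by linarith
  have "1 * (real i)\<^sup>2 \<le> (2 * tower N m) * (real i)\<^sup>2" using t by (intro mult_right_mono) auto
  with 2 show "9 * (real i)\<^sup>2 \<le> far_radius N m \<or> i > N" by auto
qed

lemma cfg_r_pos: "cfg_r N m i > 0"
proof -
  have "tower N k > 0" for k using tower_ge_1[of N k] by simp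
  then show ?thesis
    using far_radius(4)[of N m] unfolding cfg_r_def config_def Let_def by auto
qed

lemma cfg_overlap_iff:
  "config N m i = (a, b, c) \<Longrightarrow> config N m j = (a', b', c') \<Longrightarrow>
    cfg_overlap N m i j \<longleftrightarrow> (a - a')\<^sup>2 + (b - b')\<^sup>2 < (c + c')\<^sup>2"
  by (simp add: overlap_def cfg_x_def cfg_y_def cfg_r_def)

lemma floor_disjoint:
  assumes "config N m i = (a, b, c)" "0 < c" "c \<le> b"
  shows "\<not> cfg_overlap N m i 0"
proof -
  have "(c + far_radius N m)\<^sup>2 \<le> (b + far_radius N m)\<^sup>2"
    using assms far_radius(4)[of N m] by (intro power_mono) auto
  then show ?thesis
    unfolding cfg_overlap_iff[OF assms(1) config_special(1)] by (simp add: not_less add_increasing)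
qed

lemma config_floor:
  "\<not> cfg_overlap N m 1 0" "\<not> cfg_overlap N m 2 0" "\<not> cfg_overlap N m 3 0"
  "j < 4 \<Longrightarrow> \<not> cfg_overlap N m (level N k j) 0"
proof -
  have t: "tower N m \<ge> 1" "tower N k \<ge> 1" "far_radius N m \<ge> 1"
    by (rule tower_ge_1 far_radius(4))+
  show "\<not> cfg_overlap N m 1 0" by (rule floor_disjoint[OF config_special(2)]) (use t in linarith)+
  show "\<not> cfg_overlap N m 2 0" by (rule floor_disjoint[OF config_special(3)]) (use t in linarith)+
  show "\<not> cfg_overlap N m 3 0" by (rule floor_disjoint[OF config_special(4)]) linarith+
  have "\<not> cfg_overlap N m (level N k 0) 0" by (rule floor_disjoint[OF config_level(1)]) (use t in linarith)+
  moreover have "\<not> cfg_overlap N m (level N k 1) 0"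
    by (rule floor_disjoint[OF config_level(2)]) (use t in linarith)+
  moreover have "\<not> cfg_overlap N m (level N k 2) 0"
    by (rule floor_disjoint[OF config_level(3)]) (use t in linarith)+
  moreover have "\<not> cfg_overlap N m (level N k 3) 0" by (rule floor_disjoint[OF config_level(4)]) linarith+
  moreover assume "j < 4"
  then have "j = 0 \<or> j = 1 \<or> j = 2 \<or> j = 3" by linarith
  ultimately show "\<not> cfg_overlap N m (level N k j) 0" by blast
qed

text \<open>Several disjoint pairs touch, which is allowed since the disks are open:
  \<open>s\<close> touches \<open>E\<close>, \<open>B\<close> and \<open>T\<close>, of radii
  \<open>R\<close> and \<open>4 * R\<close>, have centers at distance \<open>5 * R\<close>, and
  \<open>C\<close> rests on top of \<open>B\<close> at height \<open>2 * R\<close>, where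
  \<open>T\<close> still reaches it. The last claim is the recursion of
  \<open>tower\<close>.\<close>

lemma config_levels:
  assumes "k \<le> m"
  shows "\<not> cfg_overlap N m 3 1" "\<not> cfg_overlap N m (level N k 3) 1"
    "cfg_overlap N m (level N k 0) 3" "\<not> cfg_overlap N m (level N k 0) (level N k 1)"
    "cfg_overlap N m (level N k 1) (level N k 3)" "\<not> cfg_overlap N m (level N k 2) (level N k 0)"
    "cfg_overlap N m (level N k 2) (level N k 1)" "cfg_overlap N m (level N k 2) 2"
    "\<not> cfg_overlap N m (level N k 0) 2" "cfg_overlap N m (level N (Suc k) 0) (level N k 3)"
proof -
  define \<Lambda> R where "\<Lambda> = far_radius N m" and "R = tower N k"
  have t: "R \<ge> 1" "R \<le> tower N m" "tower N m \<le> \<Lambda>" "\<Lambda> \<ge> 1"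
    using tower_ge_1 tower_mono[OF assms] far_radius(1,4) by (auto simp: \<Lambda>_def R_def)
  note ov = cfg_overlap_iff and sp = config_special[of N m, folded \<Lambda>_def]
    and lv = config_level[where k = k and m = m and N = N, folded \<Lambda>_def R_def]
  have RR: "R * R \<ge> R * 1" using t by (intro mult_left_mono) auto
  show "\<not> cfg_overlap N m 3 1" "\<not> cfg_overlap N m (level N k 3) 1"
    unfolding ov[OF sp(4) sp(2)] ov[OF lv(4) sp(2)]
    by (simp_all add: power2_eq_square algebra_simps not_less)
  show "cfg_overlap N m (level N k 0) 3" "\<not> cfg_overlap N m (level N k 0) (level N k 1)"
    unfolding ov[OF lv(1) sp(4)] ov[OF lv(1) lv(2)] using t
    by (simp_all add: power2_eq_square algebra_simps not_less)
  show "cfg_overlap N m (level N k 1) (level N k 3)"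
    unfolding ov[OF lv(2) lv(4)] using t
    by (simp_all add: power2_eq_square algebra_simps)
  show "\<not> cfg_overlap N m (level N k 2) (level N k 0)"
    unfolding ov[OF lv(3) lv(1)] by (simp add: not_less add.commute)
  show "cfg_overlap N m (level N k 2) (level N k 1)"
  proof -
    have "R * R \<le> R * \<Lambda>" "R * \<Lambda> > 0" using t by (auto intro: mult_left_mono)
    then have "4 * (R * R) < 12 * (R * \<Lambda>)" by linarith
    then show ?thesis unfolding ov[OF lv(3) lv(2)]
      by (simp add: power2_eq_square algebra_simps)
  qed
  show "cfg_overlap N m (level N k 2) 2"
  proof -
    have "\<bar>2 * R - 2 * tower N m\<bar> < 2 * \<Lambda>" using t by linarith
    then have "(2 * R - 2 * tower N m)\<^sup>2 < (2 * \<Lambda>)\<^sup>2"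
      using power_strict_mono[of "\<bar>2 * R - 2 * tower N m\<bar>" "2 * \<Lambda>" 2] by simp
    then show ?thesis unfolding ov[OF lv(3) sp(3)] by simp
  qed
  show "\<not> cfg_overlap N m (level N k 0) 2"
  proof -
    have "(R + \<Lambda>)\<^sup>2 \<le> (2 * tower N m + \<Lambda> - R)\<^sup>2" using t by (intro power_mono) auto
    then show ?thesis unfolding ov[OF lv(1) sp(3)] by (simp add: not_less power2_commute)
  qed
  have "tower N (Suc k) = 9 * (R * R)" by (simp add: R_def power2_eq_square)
  with config_level(1)[of N m "Suc k"]
  have lv': "config N m (level N (Suc k) 0) = (0, 9 * (R * R), 9 * (R * R))" by simp
  show "cfg_overlap N m (level N (Suc k) 0) (level N k 3)"
    unfolding ov[OF lv' lv(4)] using RR t by (simp add: power2_eq_square algebra_simps)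
qed

lemma config_columns:
  assumes i: "i < N"
  shows "cfg_overlap N m (4 + i) 0" "cfg_overlap N m (4 + i) 1" "cfg_overlap N m (4 + i) 2"
    "cfg_overlap N m (4 + N + i) 0" "cfg_overlap N m (4 + N + i) 1"
    "cfg_overlap N m (4 + N + i) (level N 0 0)"
    "j < N \<Longrightarrow> i \<noteq> j \<Longrightarrow> \<not> cfg_overlap N m (4 + i) (4 + j)"
    "j < N \<Longrightarrow> i \<noteq> j \<Longrightarrow> \<not> cfg_overlap N m (4 + N + i) (4 + N + j)"
proof -
  define \<Lambda> H where "\<Lambda> = far_radius N m" and "H = tower N m"
  have H: "H \<ge> 1" "H \<le> \<Lambda>" "\<Lambda> \<ge> 1" using tower_ge_1 far_radius(1,4) by (auto simp: \<Lambda>_def H_def)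
  have far: "18 * (H * (real i * real i)) \<le> \<Lambda>" "9 * (real i * real i) \<le> \<Lambda>"
    using far_radius(2)[where N = N and m = m and i = i] far_radius(3)[where N = N and m = m and i = i] i by (auto simp: \<Lambda>_def H_def power2_eq_square)
  note ov = cfg_overlap_iff and sp = config_special[of N m, folded \<Lambda>_def H_def]
    and cl = config_column[OF i, where m = m, folded H_def]
  have far': "(3 * (2 * H) * real i - 0)\<^sup>2 \<le> 2 * (H * \<Lambda>)"
    using mult_left_mono[OF far(1), of "2 * H"] H by (simp add: power2_eq_square mult_ac)
  have HH: "H * H > 0" "H * \<Lambda> \<ge> 1 * \<Lambda>" using H by (auto intro!: mult_right_mono simp del: mult_1)
  have "(2 * H + \<Lambda>)\<^sup>2 - (H - - \<Lambda>)\<^sup>2 - 2 * (H * \<Lambda>) = 3 * (H * H)"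
    "(2 * H + \<Lambda>)\<^sup>2 - (H - (2 * H + \<Lambda>))\<^sup>2 - 2 * (H * \<Lambda>) = 3 * (H * H)"
    "(2 * H + \<Lambda>)\<^sup>2 - (H - (1 + \<Lambda>))\<^sup>2 - 2 * (H * \<Lambda>)
      = 3 * (H * H) + 4 * (H * \<Lambda>) - 2 * \<Lambda> - 1 + 2 * H"
    by (simp_all add: power2_eq_square algebra_simps)
  with HH H have "(H - - \<Lambda>)\<^sup>2 + 2 * (H * \<Lambda>) < (2 * H + \<Lambda>)\<^sup>2"
    "(H - (2 * H + \<Lambda>))\<^sup>2 + 2 * (H * \<Lambda>) < (2 * H + \<Lambda>)\<^sup>2"
    "(H - (1 + \<Lambda>))\<^sup>2 + 2 * (H * \<Lambda>) < (2 * H + \<Lambda>)\<^sup>2" by linarith+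
  then show "cfg_overlap N m (4 + i) 0" "cfg_overlap N m (4 + i) 2" "cfg_overlap N m (4 + i) 1"
    unfolding ov[OF cl(1) sp(1)] ov[OF cl(1) sp(2)] ov[OF cl(1) sp(3)] using far' by linarith+
  show "cfg_overlap N m (4 + N + i) 0" "cfg_overlap N m (4 + N + i) 1"
    unfolding ov[OF cl(2) sp(1)] ov[OF cl(2) sp(2)] using far(2) H
    by (simp_all add: power2_eq_square algebra_simps)
  show "cfg_overlap N m (4 + N + i) (level N 0 0)"
  proof -
    have "real i * real i \<le> real N * real N" using i by (intro mult_mono) auto
    then show ?thesis unfolding ov[OF cl(2) config_level(1)]
      by (simp add: power2_eq_square algebra_simps)
  qed
  assume j: "j < N" "i \<noteq> j"
  have "\<bar>real i - real j\<bar> \<ge> 1" using j(2) by linarith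
  then have ij: "(real i - real j)\<^sup>2 \<ge> 1" by (metis one_le_power power2_abs)
  have "(H * H) * 1 \<le> (H * H) * (real i - real j)\<^sup>2" using ij by (intro mult_left_mono) auto
  moreover have "(2 * H + 2 * H)\<^sup>2 = 16 * (H * H)"
    "(3 * (2 * H) * real i - 3 * (2 * H) * real j)\<^sup>2 = 36 * ((H * H) * (real i - real j)\<^sup>2)"
    by (simp_all add: power2_eq_square algebra_simps)
  ultimately show "\<not> cfg_overlap N m (4 + i) (4 + j)"
    unfolding ov[OF cl(1) config_column(1)[OF j(1), where m = m, folded H_def]] not_less diff_self
      power_zero_numeral using HH(1) by linarith
  show "\<not> cfg_overlap N m (4 + N + i) (4 + N + j)"
    unfolding ov[OF cl(2) config_column(2)[OF j(1), where m = m]] using ij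
    by (simp add: power2_eq_square algebra_simps not_less)
qed

section \<open>Bit sizes\<close>

text \<open>The unit disk of the normalised picture corresponds to the disk of radius
  \<open>\<rho>\<close> around the center of disk 0. Keeping \<open>\<rho>\<close> separate from
  \<open>r 0\<close> allows disk 0 to be shrunk slightly.\<close>

definition normalized :: "(nat \<Rightarrow> real) \<Rightarrow> (nat \<Rightarrow> real) \<Rightarrow> (nat \<Rightarrow> real) \<Rightarrow> real \<Rightarrow> nat \<Rightarrow> complex \<times> real" where
  "normalized x y r \<rho> i = (Complex ((x i - x 0) / \<rho>) ((y i - y 0) / \<rho>), r i / \<rho>)"

lemma inv_dist_normalized:
  assumes "\<rho> > 0"
  shows "inv_dist (normalized x y r \<rho> i) (normalized x y r \<rho> j) =
      ((x i - x j)\<^sup>2 + (y i - y j)\<^sup>2 - (r i)\<^sup>2 - (r j)\<^sup>2) / (2 * r i * r j)"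
    "depth (normalized x y r \<rho> i) = ((x i - x 0)\<^sup>2 + (y i - y 0)\<^sup>2 - (r i)\<^sup>2 - \<rho>\<^sup>2) / (2 * r i * \<rho>)"
proof -
  have norms: "(cmod (fst (normalized x y r \<rho> i) - fst (normalized x y r \<rho> j)))\<^sup>2 =
      ((x i - x j)\<^sup>2 + (y i - y j)\<^sup>2) / \<rho>\<^sup>2"
    "(cmod (fst (normalized x y r \<rho> i)))\<^sup>2 = ((x i - x 0)\<^sup>2 + (y i - y 0)\<^sup>2) / \<rho>\<^sup>2"
    "snd (normalized x y r \<rho> v) = r v / \<rho>" for v
    by (simp_all add: normalized_def cmod_power2 diff_divide_distrib[symmetric] power_divide
        add_divide_distrib[symmetric])
  have scale: "(A / \<rho>\<^sup>2 - (a / \<rho>)\<^sup>2 - (b / \<rho>)\<^sup>2) / (2 * (a / \<rho>) * (b / \<rho>)) = (A - a\<^sup>2 - b\<^sup>2) / (2 * a * b)" for A a b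
  proof -
    have 1: "A / \<rho>\<^sup>2 - (a / \<rho>)\<^sup>2 - (b / \<rho>)\<^sup>2 = (A - a\<^sup>2 - b\<^sup>2) / \<rho>\<^sup>2"
      by (simp add: power_divide diff_divide_distrib)
    have 2: "2 * (a / \<rho>) * (b / \<rho>) = 2 * a * b / \<rho>\<^sup>2" by (simp add: power2_eq_square)
    show ?thesis unfolding 1 2 using assms by simp
  qed
  show "inv_dist (normalized x y r \<rho> i) (normalized x y r \<rho> j) =
      ((x i - x j)\<^sup>2 + (y i - y j)\<^sup>2 - (r i)\<^sup>2 - (r j)\<^sup>2) / (2 * r i * r j)"
    unfolding inv_dist_def norms scale ..
  show "depth (normalized x y r \<rho> i) = ((x i - x 0)\<^sup>2 + (y i - y 0)\<^sup>2 - (r i)\<^sup>2 - \<rho>\<^sup>2) / (2 * r i * \<rho>)"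
    using scale[of _ "r i" \<rho>] assms unfolding depth_alt norms by simp
qed

lemma inv_dist_normalized_less_1_iff:
  assumes "\<rho> > 0" "r i > 0" "r j > 0"
  shows "inv_dist (normalized x y r \<rho> i) (normalized x y r \<rho> j) < 1 \<longleftrightarrow> overlap x y r i j"
proof -
  have "2 * r i * r j > 0" using assms by simp
  then show ?thesis
    unfolding inv_dist_normalized[OF assms(1)] overlap_def
    by (simp add: pos_divide_less_eq power2_sum) linarith
qed

lemma overlap_iff_cmod:
  assumes "r i > 0" "r j > 0"
  shows "overlap x y r i j \<longleftrightarrow> cmod (Complex (x i - x j) (y i - y j)) < r i + r j"
proof -
  have "overlap x y r i j \<longleftrightarrow> (cmod (Complex (x i - x j) (y i - y j)))\<^sup>2 < (r i + r j)\<^sup>2"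
    by (simp add: overlap_def cmod_power2)
  also have "\<dots> \<longleftrightarrow> cmod (Complex (x i - x j) (y i - y j)) < r i + r j"
    using assms power_less_imp_less_base[of "cmod (Complex (x i - x j) (y i - y j))" 2 "r i + r j"]
      power_strict_mono[of "cmod (Complex (x i - x j) (y i - y j))" "r i + r j" 2] by fastforce
  finally show ?thesis .
qed

lemma cmod_normalized:
  assumes "\<rho> > 0"
  shows "cmod (fst (normalized x y r \<rho> i)) = cmod (Complex (x i - x 0) (y i - y 0)) / \<rho>"
proof -
  have "fst (normalized x y r \<rho> i) = Complex (x i - x 0) (y i - y 0) / of_real \<rho>"
    by (simp add: normalized_def complex_eq_iff)
  then show ?thesis using assms by (simp add: norm_divide)
qed

lemma snd_normalized: "snd (normalized x y r \<rho> i) = r i / \<rho>"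
  by (simp add: normalized_def)

text \<open>Inversive distances are quotients of quantities of order \<open>Q\<^sup>2\<close> by
  products of radii, which are at least of order \<open>1 / Q\<^sup>2\<close>. They are therefore of
  order \<open>Q ^ 4\<close>, and the product of two depths is of order
  \<open>Q ^ 8\<close>.\<close>

lemma gap_normalized_le:
  assumes Q: "Q \<ge> 1" and coord: "\<And>v. v \<in> {0, i, j} \<Longrightarrow> \<bar>x v\<bar> \<le> Q \<and> \<bar>y v\<bar> \<le> Q \<and> 1 / Q \<le> r v"
    and \<rho>: "r 0 / 2 \<le> \<rho>" and "exterior_disk (normalized x y r \<rho> i)" "exterior_disk (normalized x y r \<rho> j)"
  shows "(gap (normalized x y r \<rho> i) (normalized x y r \<rho> j))\<^sup>2 \<le> 2 ^ 7 * Q ^ 8"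
proof -
  have 0: "1 / Q > 0" using Q by simp
  have rho: "1 / (2 * Q) \<le> \<rho>" using coord[of 0] \<rho> by (simp add: field_simps)
  then have rho_pos: "\<rho> > 0" using Q by (intro less_le_trans[OF _ rho]) simp
  have sq: "(x u - x v)\<^sup>2 + (y u - y v)\<^sup>2 \<le> 8 * Q\<^sup>2" if "u \<in> {0, i, j}" "v \<in> {0, i, j}" for u v
  proof -
    have "\<bar>x u - x v\<bar> \<le> 2 * Q" "\<bar>y u - y v\<bar> \<le> 2 * Q" using coord[OF that(1)] coord[OF that(2)] by auto
    then have "(x u - x v)\<^sup>2 \<le> (2 * Q)\<^sup>2" "(y u - y v)\<^sup>2 \<le> (2 * Q)\<^sup>2"
      using power_mono[of "\<bar>x u - x v\<bar>" "2 * Q" 2] power_mono[of "\<bar>y u - y v\<bar>" "2 * Q" 2] by simp_all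
    then show ?thesis by (simp add: power_mult_distrib)
  qed
  have frac: "(a - b\<^sup>2 - c\<^sup>2) / (2 * b * c) \<le> 4 * Q\<^sup>2 / (d * e)"
    if "a \<le> 8 * Q\<^sup>2" "d \<le> b" "e \<le> c" "d > 0" "e > 0" for a b c d e
  proof -
    have bc: "d * e \<le> b * c" "d * e > 0" using that by (auto intro: mult_mono)
    have "(a - b\<^sup>2 - c\<^sup>2) / (2 * b * c) \<le> 8 * Q\<^sup>2 / (2 * b * c)"
    proof (rule divide_right_mono)
      show "a - b\<^sup>2 - c\<^sup>2 \<le> 8 * Q\<^sup>2"
        using that(1) zero_le_power2[of b] zero_le_power2[of c] by linarith
      show "0 \<le> 2 * b * c" using bc by simp
    qed
    also have "\<dots> = 4 * Q\<^sup>2 / (b * c)" by simp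
    also have "\<dots> \<le> 4 * Q\<^sup>2 / (d * e)" using bc by (intro divide_left_mono) auto
    finally show ?thesis .
  qed
  have Q4: "4 * Q\<^sup>2 / (1 / Q * (1 / Q)) = 4 * Q ^ 4" "4 * Q\<^sup>2 / (1 / Q * (1 / (2 * Q))) = 8 * Q ^ 4"
    by (simp_all add: power2_eq_square power4_eq_xxxx)
  have r: "1 / Q \<le> r i" "1 / Q \<le> r j" using coord by blast+
  have I: "inv_dist (normalized x y r \<rho> i) (normalized x y r \<rho> j) \<le> 4 * Q ^ 4"
    using frac[OF sq r 0 0, of i j] unfolding inv_dist_normalized[OF rho_pos] Q4 by blast
  have "1 / (2 * Q) > 0" using Q by simp
  from frac[OF sq r(1) rho 0 this, of i 0] frac[OF sq r(2) rho 0 this, of j 0]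
  have a: "depth (normalized x y r \<rho> v) \<le> 8 * Q ^ 4" if "v \<in> {i, j}" for v
    using that unfolding inv_dist_normalized[OF rho_pos] Q4 by blast
  have a0: "depth (normalized x y r \<rho> v) \<ge> 0" if "v \<in> {i, j}" for v
    using assms depth_ge[of "normalized x y r \<rho> i"] depth_ge[of "normalized x y r \<rho> j"] that by auto
  have "depth (normalized x y r \<rho> i) * depth (normalized x y r \<rho> j) \<le> (8 * Q ^ 4) * (8 * Q ^ 4)"
    using a a0 Q by (intro mult_mono) auto
  also have "\<dots> = 64 * Q ^ 8" by (simp flip: power_add)
  finally have dd: "depth (normalized x y r \<rho> i) * depth (normalized x y r \<rho> j) \<le> 64 * Q ^ 8" .
  have "Q ^ 4 \<le> Q ^ 8" "1 \<le> Q ^ 8" using Q by (auto intro: power_increasing one_le_power)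
  moreover have "g \<le> 128 * Q8"
    if "g \<le> (I + 2 * d) / 2" "I \<le> 4 * Q4" "d \<le> 64 * Q8" "Q4 \<le> Q8" "1 \<le> Q8" for g I d Q4 Q8 :: real
    using that by simp
  ultimately have "(gap (normalized x y r \<rho> i) (normalized x y r \<rho> j))\<^sup>2 \<le> 128 * Q ^ 8"
    using I dd gap_sq_le[OF assms(4,5), unfolded mult.assoc] by blast
  then show ?thesis by simp
qed

section \<open>Growth in every realization of the pattern\<close>

text \<open>The index bound counts four special disks, \<open>2 * N\<close> common neighbours and
  the four disks of each of the levels 0 to \<open>m\<close> inclusive.\<close>

definition copies_config :: "nat \<Rightarrow> nat \<Rightarrow> (nat \<Rightarrow> real) \<Rightarrow> (nat \<Rightarrow> real) \<Rightarrow> (nat \<Rightarrow> real) \<Rightarrow> bool" where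
  "copies_config N m x y r \<longleftrightarrow> (\<forall>i < 8 + 2 * N + 4 * m. r i > 0) \<and>
    (\<forall>i < 8 + 2 * N + 4 * m. \<forall>j < 8 + 2 * N + 4 * m. i \<noteq> j \<longrightarrow> (overlap x y r i j \<longleftrightarrow> cfg_overlap N m i j))"

lemma copies_config_gap:
  assumes bound: "common_neighbours_bound N (1 / 1600)"
    and copy: "copies_config N (Suc m) x y r"
  obtains \<rho> where "r 0 / 2 \<le> \<rho>" "exterior_disk (normalized x y r \<rho> 3)"
    "exterior_disk (normalized x y r \<rho> (level N m 3))"
    "gap (normalized x y r \<rho> 3) (normalized x y r \<rho> (level N m 3)) \<ge> 2 ^ 2 ^ m"
proof -
  have N: "gap V E \<le> 1 / 1600" if "exterior_disk E" "exterior_disk V"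
    "\<And>i. i < N \<Longrightarrow> snd (X i) > 0 \<and> inv_dist (X i) (0, 1) < 1 \<and> inv_dist (X i) E < 1 \<and> inv_dist (X i) V < 1"
    "\<And>i j. i < N \<Longrightarrow> j < N \<Longrightarrow> i \<noteq> j \<Longrightarrow> inv_dist (X i) (X j) \<ge> 1" for E V X
    by (rule bound[unfolded common_neighbours_bound_def, THEN spec, THEN spec, THEN spec[of _ X], THEN mp])
      (rule conjI[OF that(1) conjI[OF that(2) conjI]]; intro allI impI; rule that; assumption)
  define n where "n = 8 + 2 * N + 4 * Suc m"
  have pos: "r i > 0" if "i < n" for i using copy that unfolding copies_config_def n_def by blast
  have ov: "overlap x y r i j \<longleftrightarrow> cfg_overlap N (Suc m) i j" if "i < n" "j < n" "i \<noteq> j" for i j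
    using copy that unfolding copies_config_def n_def by blast
  define d where "d i = cmod (Complex (x i - x 0) (y i - y 0))" for i
  have special: "0 < n" "1 < n" "2 < n" "3 < n" "\<And>i. i < N \<Longrightarrow> 4 + i < n" "\<And>i. i < N \<Longrightarrow> 4 + N + i < n"
    "\<And>k j. k \<le> Suc m \<Longrightarrow> j < 4 \<Longrightarrow> level N k j < n"
    unfolding n_def level_def by auto
  have column: "d i < r i + r 0" if "i \<in> (+) 4 ` {..<N} \<union> (+) (4 + N) ` {..<N}" for i
  proof -
    have "i < n" "i \<noteq> 0" "cfg_overlap N (Suc m) i 0"
      using that special config_columns(1,4) by auto
    then show ?thesis using ov[of i 0] special(1) overlap_iff_cmod[of r i 0 x y] pos unfolding d_def by blast
  qed
  \<comment> \<open>The finitely many strict overlaps of the column disks with disk 0 survive a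
    slight decrease of its radius. After the decrease every disk disjoint from disk 0 is strictly
    outside, as \<open>gap_pos\<close> requires of \<open>E\<close>.\<close>
  have "\<forall>i\<in>(+) 4 ` {..<N} \<union> (+) (4 + N) ` {..<N}. \<forall>\<^sub>F \<rho> in at_left (r 0). d i - r i < \<rho>"
  proof
    fix i assume "i \<in> (+) 4 ` {..<N} \<union> (+) (4 + N) ` {..<N}"
    from column[OF this] have "d i - r i < r 0" by simp
    from eventually_at_left_real[OF this] show "\<forall>\<^sub>F \<rho> in at_left (r 0). d i - r i < \<rho>"
      by (rule eventually_mono) simp
  qed
  then have "\<forall>\<^sub>F \<rho> in at_left (r 0). \<forall>i\<in>(+) 4 ` {..<N} \<union> (+) (4 + N) ` {..<N}. d i - r i < \<rho>"
    by (subst eventually_ball_finite_distrib) auto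
  moreover have "\<forall>\<^sub>F \<rho> in at_left (r 0). \<rho> \<in> {r 0 / 2<..<r 0}"
    by (rule eventually_at_left_real) (use pos[OF special(1)] in simp)
  ultimately have "\<forall>\<^sub>F \<rho> in at_left (r 0). r 0 / 2 < \<rho> \<and> \<rho> < r 0 \<and>
      (\<forall>i\<in>(+) 4 ` {..<N} \<union> (+) (4 + N) ` {..<N}. d i < r i + \<rho>)"
    by eventually_elim force
  from eventually_happens[OF this] obtain \<rho> where \<rho>: "r 0 / 2 < \<rho>" "\<rho> < r 0"
    "\<And>i. i \<in> (+) 4 ` {..<N} \<union> (+) (4 + N) ` {..<N} \<Longrightarrow> d i < r i + \<rho>"
    by auto
  have \<rho>0: "\<rho> > 0" using \<rho>(1) pos[OF special(1)] by simp
  define D where "D = normalized x y r \<rho>"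
  have snd_D: "snd (D i) > 0" if "i < n" for i
    using pos[OF that] \<rho>0 unfolding D_def snd_normalized by simp
  have D_iff: "inv_dist (D i) (D j) < 1 \<longleftrightarrow> cfg_overlap N (Suc m) i j" if "i < n" "j < n" "i \<noteq> j" for i j
    unfolding D_def using inv_dist_normalized_less_1_iff[OF \<rho>0 pos[OF that(1)] pos[OF that(2)]] ov[OF that] by simp
  have ext: "cmod (fst (D i)) > 1 + snd (D i)" if "i < n" "i \<noteq> 0" "\<not> cfg_overlap N (Suc m) i 0" for i
  proof -
    have "d i \<ge> r i + r 0"
      using ov[OF that(1) special(1) that(2)] that(3) overlap_iff_cmod[of r i 0 x y] pos[OF that(1)] pos[OF special(1)]
      unfolding d_def by (simp add: not_less)
    then have "d i / \<rho> > (\<rho> + r i) / \<rho>" using \<rho> \<rho>0 by (intro divide_strict_right_mono) auto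
    then show ?thesis
      using \<rho>0 unfolding D_def cmod_normalized[OF \<rho>0] snd_normalized d_def by (simp add: add_divide_distrib)
  qed
  have ext': "exterior_disk (D i)" if "i < n" "i \<noteq> 0" "\<not> cfg_overlap N (Suc m) i 0" for i
    unfolding exterior_disk_def using ext[OF that] snd_D[OF that(1)] by simp
  have level0: "level N k j \<noteq> 0" "level N k j \<noteq> 1" "level N k j \<noteq> 2" "level N k j \<noteq> 3" for k j
    unfolding level_def by auto
  note ext1 = ext'[OF special(2) _ config_floor(1)] ext'[OF special(3) _ config_floor(2)]
    ext'[OF special(4) _ config_floor(3)]
  have extl: "exterior_disk (D (level N k j))" if "k \<le> Suc m" "j < 4" for k j
    by (rule ext'[OF special(7)[OF that] level0(1) config_floor(4)[OF that(2)]])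
  have unit: "inv_dist (D i) (0, 1) < 1" if "i < n" "d i < r i + \<rho>" for i
  proof -
    have "d i / \<rho> < (r i + \<rho>) / \<rho>" using that \<rho>0 by (intro divide_strict_right_mono) auto
    then have "cmod (fst (D i)) < snd (D i) + 1"
      using \<rho>0 unfolding D_def cmod_normalized[OF \<rho>0] snd_normalized d_def by (simp add: add_divide_distrib)
    then show ?thesis using inv_dist_less_1_iff[of "D i" "(0, 1)"] snd_D[OF that(1)] by simp
  qed
  have gap1: "gap (D 2) (D 1) \<le> 1 / 1600"
  proof (rule N[of _ _ "\<lambda>i. D (4 + i)"])
    fix i assume i: "i < N"
    show "snd (D (4 + i)) > 0 \<and> inv_dist (D (4 + i)) (0, 1) < 1 \<and> inv_dist (D (4 + i)) (D 1) < 1 \<and>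
      inv_dist (D (4 + i)) (D 2) < 1"
      using i special snd_D D_iff[OF special(5)[OF i] special(2)] D_iff[OF special(5)[OF i] special(3)]
        config_columns(2,3)[OF i] unit[OF special(5)[OF i] \<rho>(3)] by auto
    show "inv_dist (D (4 + i)) (D (4 + j)) \<ge> 1" if "j < N" "i \<noteq> j" for j
      using D_iff[OF special(5)[OF i] special(5)[OF that(1)]] config_columns(7)[OF i that] that(2)
      by (simp add: not_less)
  qed (use ext1 in auto)
  have gap2: "gap (D (level N 0 0)) (D 1) \<le> 1 / 1600"
  proof (rule N[of _ _ "\<lambda>i. D (4 + N + i)"])
    fix i assume i: "i < N"
    have "4 + N + i \<noteq> level N 0 0" unfolding level_def using i by simp
    then show "snd (D (4 + N + i)) > 0 \<and> inv_dist (D (4 + N + i)) (0, 1) < 1 \<and> inv_dist (D (4 + N + i)) (D 1) < 1 \<and>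
      inv_dist (D (4 + N + i)) (D (level N 0 0)) < 1"
      using i special snd_D D_iff[OF special(6)[OF i] special(2)] D_iff[OF special(6)[OF i] special(7)[of 0 0]]
        config_columns(5,6)[OF i] unit[OF special(6)[OF i] \<rho>(3)] by auto
    show "inv_dist (D (4 + N + i)) (D (4 + N + j)) \<ge> 1" if "j < N" "i \<noteq> j" for j
      using D_iff[OF special(6)[OF i] special(6)[OF that(1)]] config_columns(8)[OF i that] that(2)
      by (simp add: not_less)
  qed (use ext1 extl in auto)
  have lv_neq: "level N k i \<noteq> level N k' j" if "4 * k + i \<noteq> 4 * k' + j" for k k' i j
    using that unfolding level_def by simp
  \<comment> \<open>One extra level is supplied because the weight of \<open>T\<close> at level
    \<open>m\<close> is controlled through \<open>B\<close> at level \<open>Suc m\<close>.\<close>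
  have "gap (D 3) (D (level N m 3)) \<ge> 2 ^ 2 ^ m"
  proof (rule forced_growth[where m = "Suc m" and E = "D 1" and Y = "D 2" and B = "\<lambda>k. D (level N k 0)"
        and T = "\<lambda>k. D (level N k 1)" and C = "\<lambda>k. D (level N k 2)" and t = "\<lambda>k. D (level N k 3)"])
    show "cmod (fst (D 1)) > 1 + snd (D 1)" by (rule ext[OF special(2) _ config_floor(1)]) simp
    show "inv_dist (D 3) (D 1) \<ge> 1"
      using D_iff[OF special(4,2)] config_levels(1)[of 0 "Suc m" N] by (simp add: not_less)
    fix k :: nat assume k: "k \<le> Suc m"
    note lv = special(7)[OF k, of 0] special(7)[OF k, of 1] special(7)[OF k, of 2] special(7)[OF k, of 3] and c = config_levels[OF k, of N]
    show "inv_dist (D (level N k 3)) (D 1) \<ge> 1" using D_iff[OF lv(4) special(2) level0(2)] c(2) by (simp add: not_less)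
    show "inv_dist (D (level N k 0)) (D 3) < 1" using D_iff[OF lv(1) special(4) level0(4)] c(3) by simp
    show "inv_dist (D (level N k 0)) (D (level N k 1)) \<ge> 1" using D_iff[OF lv(1) lv(2) lv_neq] c(4) by (simp add: not_less)
    show "inv_dist (D (level N k 1)) (D (level N k 3)) < 1" using D_iff[OF lv(2) lv(4) lv_neq] c(5) by simp
    show "inv_dist (D (level N k 2)) (D (level N k 0)) \<ge> 1" using D_iff[OF lv(3) lv(1) lv_neq] c(6) by (simp add: not_less)
    show "inv_dist (D (level N k 2)) (D (level N k 1)) < 1" using D_iff[OF lv(3) lv(2) lv_neq] c(7) by simp
    show "inv_dist (D (level N k 2)) (D 2) < 1" using D_iff[OF lv(3) special(3) level0(3)] c(8) by simp
    show "inv_dist (D (level N k 0)) (D 2) \<ge> 1" using D_iff[OF lv(1) special(3) level0(3)] c(9) by (simp add: not_less)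
  next
    fix k :: nat assume k: "k < Suc m"
    then have k': "k \<le> Suc m" "Suc k \<le> Suc m" by auto
    show "inv_dist (D (level N (Suc k) 0)) (D (level N k 3)) < 1"
      using D_iff[OF special(7)[OF k'(2)] special(7)[OF k'(1)] lv_neq] config_levels(10)[OF k'(1), of N] by simp
  qed (use ext1 extl gap1 gap2 in auto)
  with \<rho>(1) ext1(3) extl[of m 3] show thesis by (intro that[of \<rho>]) (auto simp: D_def)
qed

lemma disk_graph_disks:
  fixes V :: "nat set"
  assumes "finite V" "\<And>v. v \<in> V \<Longrightarrow> r v > 0"
  shows "disk_graph (intersection_graph V (disk x y r))"
proof -
  interpret pair_graph "intersection_graph V (disk x y r)"
    by (rule pair_graph_intersection_graph[OF assms(1)])
  let ?G = "intersection_graph V (disk x y r)"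
  let ?h = "\<lparr>iso_verts = id, iso_arcs = id, iso_head = snd, iso_tail = fst\<rparr>"
  have "pre_digraph.digraph_isomorphism (with_proj ?G) ?h"
    unfolding pre_digraph.digraph_isomorphism_def using wf_digraph by (simp add: inj_on_def)
  moreover have "with_proj ?G = app_iso ?h (with_proj ?G)" by (simp add: app_iso_def with_proj_def)
  ultimately have "digraph_iso (with_proj ?G) (with_proj ?G)" unfolding digraph_iso_def by blast
  moreover have "open_disk (disk x y r v)" if "v \<in> V" for v
    unfolding open_disk_def disk_def using assms(2)[OF that] by blast
  ultimately show ?thesis unfolding disk_graph_def using assms(1) by blast
qed

section \<open>Bit sizes against magnitudes\<close>

lemma abs_less_bitsize: "real_of_int \<bar>k\<bar> + 1 \<le> 2 ^ bitsize_int k"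
proof -
  have "real_of_int \<bar>k\<bar> + 1 = 2 powr log 2 (real_of_int (\<bar>k\<bar> + 1))" by simp
  also have "\<dots> \<le> 2 powr real (bitsize_int k)"
    unfolding bitsize_int_def by (intro powr_mono) linarith+
  finally show ?thesis by (simp add: powr_realpow)
qed

lemma bitsize_bounds:
  shows "\<bar>real_of_rat q\<bar> \<le> 2 ^ bitsize q" "q > 0 \<Longrightarrow> 1 / 2 ^ bitsize q \<le> real_of_rat q"
proof -
  obtain a b where ab: "quotient_of q = (a, b)" by (cases "quotient_of q")
  have b: "b > 0" using quotient_of_denom_pos[OF ab] .
  have q: "real_of_rat q = of_int a / of_int b"
    using quotient_of_div[OF ab] by (simp add: of_rat_divide)
  have size: "real_of_int \<bar>a\<bar> \<le> 2 ^ bitsize_int a" "real_of_int b \<le> 2 ^ bitsize_int b"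
    using abs_less_bitsize[of a] abs_less_bitsize[of b] by linarith+
  have bits: "(2::real) ^ bitsize q = 2 ^ bitsize_int a * 2 ^ bitsize_int b"
    using ab by (simp add: bitsize_def power_add)
  have "\<bar>real_of_rat q\<bar> \<le> real_of_int \<bar>a\<bar> / 1"
    unfolding q abs_divide using b by (intro frac_le) auto
  also have "\<dots> \<le> 2 ^ bitsize_int a * 2 ^ bitsize_int b"
    using mult_mono[OF size(1), of 1 "2 ^ bitsize_int b"] by simp
  finally show "\<bar>real_of_rat q\<bar> \<le> 2 ^ bitsize q" unfolding bits .
  assume "q > 0"
  then have "real_of_rat q > 0" by simp
  then have "a \<ge> 1" unfolding q using b by (simp add: zero_less_divide_iff)
  have "1 / (2 ^ bitsize_int a * 2 ^ bitsize_int b) \<le> 1 / (1 * real_of_int b)"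
    using size b by (intro divide_left_mono mult_mono) auto
  also have "\<dots> \<le> real_of_rat q"
    unfolding q using \<open>a \<ge> 1\<close> b by (simp add: divide_right_mono)
  finally show "1 / 2 ^ bitsize q \<le> real_of_rat q" unfolding bits .
qed

text \<open>The total bit size bounds that of each coordinate, so \<open>Q = 2 ^ \<beta>\<close> is
  admissible in \<open>gap_normalized_le\<close>. Comparing exponents in
  \<open>2 ^ 2 ^ Suc m \<le> 2 ^ (7 + 8 * \<beta>)\<close> removes one exponential.\<close>

lemma config_graph_bits:
  assumes bound: "common_neighbours_bound N (1 / 1600)"
    and n: "8 + 2 * N + 4 * Suc m \<le> n"
  shows "\<exists>G\<in>DG n. 2 ^ Suc m \<le> 7 + 8 * g_DG_graph G"
proof -
  define D where "D = disk (cfg_x N (Suc m)) (cfg_y N (Suc m)) (cfg_r N (Suc m))"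
  \<comment> \<open>\<open>config\<close> yields a disk at every index, so vertices beyond the
    pattern are padding that brings the graph to exactly \<open>n\<close> vertices.\<close>
  define G where "G = intersection_graph {..<n} D"
  have verts: "pverts G = {..<n}" unfolding G_def intersection_graph_def by simp
  have disk: "disk_graph G" unfolding G_def D_def by (rule disk_graph_disks) (simp_all add: cfg_r_pos)
  have "G \<in> DG n" using disk unfolding DG_def by (simp add: verts)
  have "card (pverts G) > 0" using n by (simp add: verts)
  from g_DG_graph_attained[OF disk this] obtain x y r where real: "rat_realization G x y r"
    and bits: "g_DG_graph G = (\<Sum>v\<in>{..<n}. bitsize (x v) + bitsize (y v) + bitsize (r v))"
    unfolding verts by blast
  define \<xi> \<eta> \<rho> where "\<xi> v = real_of_rat (x v)" and "\<eta> v = real_of_rat (y v)" and "\<rho> v = real_of_rat (r v)" for v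
  have r_pos: "r v > 0" if "v < n" for v using real that unfolding rat_realization_def verts by simp
  then have pos: "\<rho> v > 0" if "v < n" for v using that unfolding \<rho>_def by simp
  have "rat_disk (x v) (y v) (r v) = disk \<xi> \<eta> \<rho> v" for v
    unfolding rat_disk_def disk_def \<xi>_def \<eta>_def \<rho>_def ..
  then have eq: "intersection_graph {..<n} (disk \<xi> \<eta> \<rho>) = G"
    using real unfolding rat_realization_def realizes_def verts by simp
  have ov: "overlap \<xi> \<eta> \<rho> i j \<longleftrightarrow> cfg_overlap N (Suc m) i j" if "i < n" "j < n" "i \<noteq> j" for i j
  proof -
    have "(i, j) \<in> parcs (intersection_graph {..<n} (disk \<xi> \<eta> \<rho>)) \<longleftrightarrow> (i, j) \<in> parcs G"
      unfolding eq ..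
    then show ?thesis
      using that unfolding G_def intersection_graph_def D_def
      by (simp add: disks_meet_iff pos cfg_r_pos)
  qed
  have "copies_config N (Suc m) \<xi> \<eta> \<rho>" unfolding copies_config_def using pos ov n by simp
  from copies_config_gap[OF bound this] obtain t where t: "\<rho> 0 / 2 \<le> t"
    "exterior_disk (normalized \<xi> \<eta> \<rho> t 3)" "exterior_disk (normalized \<xi> \<eta> \<rho> t (level N m 3))"
    "gap (normalized \<xi> \<eta> \<rho> t 3) (normalized \<xi> \<eta> \<rho> t (level N m 3)) \<ge> 2 ^ 2 ^ m"
    by blast
  define \<beta> where "\<beta> = g_DG_graph G"
  have coord: "\<bar>\<xi> v\<bar> \<le> 2 ^ \<beta> \<and> \<bar>\<eta> v\<bar> \<le> 2 ^ \<beta> \<and> 1 / 2 ^ \<beta> \<le> \<rho> v" if "v < n" for v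
  proof -
    have "bitsize (x v) + bitsize (y v) + bitsize (r v) \<le> \<beta>"
      unfolding \<beta>_def bits using that by (intro member_le_sum) auto
    then have le: "(2::real) ^ bitsize (x v) \<le> 2 ^ \<beta>" "(2::real) ^ bitsize (y v) \<le> 2 ^ \<beta>"
      "1 / (2::real) ^ \<beta> \<le> 1 / 2 ^ bitsize (r v)"
      by (auto intro!: power_increasing divide_left_mono)
    then show ?thesis
      using bitsize_bounds(1)[of "x v"] bitsize_bounds(1)[of "y v"] bitsize_bounds(2)[OF r_pos[OF that]]
      unfolding \<xi>_def \<eta>_def \<rho>_def by linarith
  qed
  have lt: "v < n" if "v \<in> {0, 3, level N m 3}" for v using that n unfolding level_def by auto
  have "((2::real) ^ 2 ^ m)\<^sup>2 \<le> (gap (normalized \<xi> \<eta> \<rho> t 3) (normalized \<xi> \<eta> \<rho> t (level N m 3)))\<^sup>2"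
    using t(4) by (rule power_mono) simp
  also have "\<dots> \<le> 2 ^ 7 * (2 ^ \<beta>) ^ 8"
    by (rule gap_normalized_le[OF _ coord[OF lt] t(1,2,3)]) simp
  also have "\<dots> = 2 ^ (7 + 8 * \<beta>)" by (simp add: power_add power_mult mult.commute[of 8])
  also have "((2::real) ^ 2 ^ m)\<^sup>2 = 2 ^ 2 ^ Suc m" by (simp add: power_mult[symmetric] mult.commute)
  finally have "2 ^ Suc m \<le> 7 + 8 * \<beta>" by simp
  with \<open>G \<in> DG n\<close> show ?thesis unfolding \<beta>_def by blast
qed

theorem corollary1p4:
  shows "\<exists>c1 c2 :: real. \<exists>n0 :: nat. c1 > 0 \<and> c2 > 0 \<and>
    (\<forall>n\<ge>n0. 2 powr (c1 * real n) \<le> real (g_DG n) \<and>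
             real (g_DG n) \<le> 2 powr (c2 * real n))"
proof -
  obtain N where N: "common_neighbours_bound N (1 / 1600)"
    using common_neighbours_bound_exists[of "1 / 1600"] by auto
  have upper: "g_DG_graph G \<le> 2 ^ (25 * n)" if "G \<in> DG n" "n > 0" for G n
    using that g_DG_graph_le unfolding DG_def by blast
  have fin: "finite (g_DG_graph ` DG n)" if "n > 0" for n
    by (rule finite_subset[of _ "{..2 ^ (25 * n)}"]) (use upper that in auto)
  have "2 powr (1 / 8 * real n) \<le> real (g_DG n) \<and> real (g_DG n) \<le> 2 powr (25 * real n)"
    if n: "n \<ge> 60 + 4 * N" for n
  proof -
    define m where "m = (n - 8 - 2 * N) div 4 - 1"
    obtain a where a: "n = a + 8 + 2 * N" using n by (intro that[of "n - 8 - 2 * N"]) linarith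
    have "a div 4 \<ge> 1" using n a by simp
    then have "a div 4 = Suc m" unfolding m_def a by simp
    moreover have "4 * (a div 4) \<le> a" "a < 4 * (a div 4) + 4" by simp_all
    ultimately have m: "8 + 2 * N + 4 * Suc m \<le> n" "m > 3" "n \<le> 4 * m + 2 * N + 15" using n a by simp_all
    obtain G where G: "G \<in> DG n" "2 ^ Suc m \<le> 7 + 8 * g_DG_graph G"
      using config_graph_bits[OF N m(1)] by blast
    have g: "g_DG_graph G \<le> g_DG n"
      unfolding g_DG_def using fin[of n] G(1) n by (intro Max_ge) auto
    \<comment> \<open>One half of \<open>2 ^ Suc m\<close> absorbs the constant 7.\<close>
    have "(2::nat) ^ 4 \<le> 2 ^ m" using m(2) by (intro power_increasing) auto
    then have "2 ^ m \<le> 8 * g_DG n" using G(2) g by simp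
    then have "real (2 ^ m) \<le> real (8 * g_DG n)" unfolding of_nat_le_iff .
    then have "2 powr real m / 2 powr 3 \<le> real (g_DG n)" by (simp add: powr_realpow)
    then have "2 powr (real m - 3) \<le> real (g_DG n)" unfolding powr_diff .
    \<comment> \<open>A level takes four vertices, so \<open>m\<close> is about
      \<open>n / 4\<close>. The rate \<open>1 / 8\<close> leaves room for the fixed number of other
      vertices and for the loss of 3 in the exponent, once
      \<open>n \<ge> 54 + 4 * N\<close>.\<close>
    moreover have "1 / 8 * real n \<le> real m - 3" using m(3) n by linarith
    then have "2 powr (1 / 8 * real n) \<le> 2 powr (real m - 3)" by (rule powr_mono) simp
    ultimately have "2 powr (1 / 8 * real n) \<le> real (g_DG n)" by linarith
    moreover have "g_DG n \<le> 2 ^ (25 * n)"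
      unfolding g_DG_def using fin[of n] G(1) upper n by (subst Max_le_iff) auto
    then have "real (g_DG n) \<le> real (2 ^ (25 * n))" unfolding of_nat_le_iff .
    moreover have "real (2 ^ (25 * n)) = 2 powr (25 * real n)" by (simp flip: powr_realpow)
    ultimately show ?thesis by (simp only: simp_thms)
  qed
  then show ?thesis by (intro exI[of _ "1 / 8"] exI[of _ 25] exI[of _ "60 + 4 * N"]) auto
qed

end
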